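(* Let $G$ be a compact second countable abelian group with Haar measure $\mu$, let $f:G\to\mathbb{C}$ be a measurable function and let $\varphi:G\times G\to\mathbb{C}$, $\varphi(s,t)=f(s-t)$. Then the following hold: (i) If $E_f$ is not an $M$-set then $\varphi$ is a closable multiplier. (ii) If $E_f$ is an $M_1$-set then $\varphi$ is not a closable multiplier.
   Context: $A(G)$ is the Fourier algebra of $G$, i.e. the image of $\ell^1(\hat G)=L^1(\hat G)$ under Fourier transform, where $\hat G$ is the (discrete) dual group. For measurable $f:G\to\mathbb{C}$ let $J_f=\{h\in A(G): fh \text{ is } \mu\text{-a.e. equal to a function in }A(G)\}$ and let $E_f=\{s\in G:h(s)=0\text{ for all }h\in J_f\}$, a closed subset of $G$. $PM(G)=A(G)^*$ is the space of pseudomeasures, identified with $\ell^\infty(\hat G)$ via $F\mapsto\{\hat F(\chi)\}_{\chi\in\hat G}$; $F$ is a pseudofunction if $\hat F$ vanishes at infinity. For $F\in PM(G)$, $u\in A(G)$ define $uF\in PM(G)$ by $(uF)(g)=F(ug)$, $g\in A(G)$; the support of $F$ is $\{x\in G: uF\ne0\text{ whenever }u\in A(G),\ u(x)\neq0\}$. For closed $E\subseteq G$, $PM(E)$ is the space of all pseudomeasures supported in $E$, and $N(E)$ is the closure in the $\sigma(PM(G),A(G))$-topology of the space of all bounded Radon measures on $G$ supported in $E$. A closed set $E$ is an $M$-set (resp. an $M_1$-set) if $PM(E)$ (resp. $N(E)$) contains a non-zero pseudofunction. Let $H=L^2(G)$; for $k\in L^2(G\times G)$ let $I_k:H\to H$,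 $(I_k\xi)(y)=\int_Gk(x,y)\xi(x)\,d\mu(x)$. For a measurable function $\varphi$ on $G\times G$ let $D(\varphi)=\{k\in L^2(G\times G):\varphi k\in L^2(G\times G)\}$ and let $S_\varphi$ be the densely defined operator on the space $\mathcal{K}(H)$ of compact operators (operator norm) with domain $\{I_k:k\in D(\varphi)\}$, $S_\varphi(I_k)=I_{\varphi k}$. The function $\varphi$ is a closable multiplier if the norm closure of the graph of $S_\varphi$ in $\mathcal{K}(H)\oplus\mathcal{K}(H)$ is the graph of an operator. *)

theory Defs
  imports "HOL-Analysis.Analysis"
begin

section \<open>Haar measure, dual group, Fourier algebra\<close>

text \<open>
  On a second countable locally compact group every Borel measure that is finite on compact
  sets is regular, so regularity is not listed.  No normalisation is imposed.
\<close>
definition haar_measure :: "'a::{topological_ab_group_add, t2_space, second_countable_topology} measure \<Rightarrow> bool"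
  where "haar_measure \<mu> \<longleftrightarrow>
    sets \<mu> = sets borel \<and>
    (\<forall>x. \<forall>A\<in>sets borel. emeasure \<mu> ((+) x ` A) = emeasure \<mu> A) \<and>
    (\<forall>K. compact K \<longrightarrow> emeasure \<mu> K < \<infinity>) \<and>
    emeasure \<mu> UNIV \<noteq> 0"

definition dual_group :: "('a::topological_ab_group_add \<Rightarrow> complex) set"
  where "dual_group = {\<gamma>. continuous_on UNIV \<gamma> \<and>
    (\<forall>x y. \<gamma> (x + y) = \<gamma> x * \<gamma> y) \<and> (\<forall>x. norm (\<gamma> x) = 1)}"

definition l1_dual :: "(('a::topological_ab_group_add \<Rightarrow> complex) \<Rightarrow> complex) set"
  where "l1_dual = {a. (\<lambda>\<gamma>. norm (a \<gamma>)) summable_on dual_group}"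

definition fourier_transform ::
    "(('a::topological_ab_group_add \<Rightarrow> complex) \<Rightarrow> complex) \<Rightarrow> 'a \<Rightarrow> complex"
  where "fourier_transform a s = (\<Sum>\<^sub>\<infinity>\<gamma>\<in>dual_group. a \<gamma> * cnj (\<gamma> s))"

definition fourier_algebra :: "('a::topological_ab_group_add \<Rightarrow> complex) set"
  where "fourier_algebra = fourier_transform ` l1_dual"

definition J_ideal :: "'a::topological_ab_group_add measure \<Rightarrow> ('a \<Rightarrow> complex) \<Rightarrow> ('a \<Rightarrow> complex) set"
  where "J_ideal \<mu> f =
    {h \<in> fourier_algebra. \<exists>g\<in>fourier_algebra. AE s in \<mu>. f s * h s = g s}"

definition E_set :: "'a::topological_ab_group_add measure \<Rightarrow> ('a \<Rightarrow> complex) \<Rightarrow> 'a set"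
  where "E_set \<mu> f = {s. \<forall>h\<in>J_ideal \<mu> f. h s = 0}"


section \<open>Pseudomeasures\<close>

text \<open>
  Elements of the dual of \<open>A(G)\<close> are represented by functions that are
  \<^const>\<open>undefined\<close> outside \<open>A(G)\<close> (\<^const>\<open>extensional\<close>), so that equality of functionals is
  equality in HOL.  The norm of \<open>A(G)\<close> is carried over from \<open>l1_dual\<close> by the Fourier
  transform, and boundedness is stated with respect to it.
\<close>
definition pseudomeasures :: "(('a::topological_ab_group_add \<Rightarrow> complex) \<Rightarrow> complex) set"
  where "pseudomeasures = {F \<in> extensional fourier_algebra.
    (\<forall>u\<in>fourier_algebra. \<forall>v\<in>fourier_algebra. F (\<lambda>s. u s + v s) = F u + F v) \<and>
    (\<forall>c. \<forall>u\<in>fourier_algebra. F (\<lambda>s. c * u s) = c * F u) \<and>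
    (\<exists>C. \<forall>a\<in>l1_dual. norm (F (fourier_transform a)) \<le> C * (\<Sum>\<^sub>\<infinity>\<gamma>\<in>dual_group. norm (a \<gamma>)))}"

definition zero_pm :: "('a::topological_ab_group_add \<Rightarrow> complex) \<Rightarrow> complex"
  where "zero_pm = (\<lambda>u\<in>fourier_algebra. 0)"

text \<open>
  With this convention \<open>F (fourier_transform a) = (\<Sum>\<gamma>. a \<gamma> * pm_transform F \<gamma>)\<close>, and for a
  measure \<open>m\<close> one gets the usual coefficients, the integrals of \<open>cnj \<circ> \<gamma>\<close> against \<open>m\<close>.
\<close>
definition pm_transform ::
    "(('a::topological_ab_group_add \<Rightarrow> complex) \<Rightarrow> complex) \<Rightarrow> ('a \<Rightarrow> complex) \<Rightarrow> complex"
  where "pm_transform F \<gamma> = F (\<lambda>s. cnj (\<gamma> s))"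

text \<open>The dual group of a compact group is discrete, so vanishing at infinity refers to finite sets.\<close>
definition pseudofunctions :: "(('a::topological_ab_group_add \<Rightarrow> complex) \<Rightarrow> complex) set"
  where "pseudofunctions = {F \<in> pseudomeasures.
    \<forall>\<epsilon>>0. finite {\<gamma> \<in> dual_group. norm (pm_transform F \<gamma>) \<ge> \<epsilon>}}"

definition pm_mult ::
    "('a::topological_ab_group_add \<Rightarrow> complex) \<Rightarrow> (('a \<Rightarrow> complex) \<Rightarrow> complex) \<Rightarrow> (('a \<Rightarrow> complex) \<Rightarrow> complex)"
  where "pm_mult u F = (\<lambda>g\<in>fourier_algebra. F (\<lambda>s. u s * g s))"

definition pm_support :: "(('a::topological_ab_group_add \<Rightarrow> complex) \<Rightarrow> complex) \<Rightarrow> 'a set"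
  where "pm_support F = {x. \<forall>u\<in>fourier_algebra. u x \<noteq> 0 \<longrightarrow> pm_mult u F \<noteq> zero_pm}"

definition PM :: "'a::topological_ab_group_add set \<Rightarrow> (('a \<Rightarrow> complex) \<Rightarrow> complex) set"
  where "PM E = {F \<in> pseudomeasures. pm_support F \<subseteq> E}"

text \<open>
  A bounded (complex) Radon measure on a compact second countable group is a combination
  \<open>m1 - m2 + \<i> (m3 - m4)\<close> of finite positive Borel measures; by the Jordan decomposition,
  the \<open>mi\<close> can be chosen concentrated on the closed set \<open>E\<close> iff the complex measure is
  supported in \<open>E\<close>.  It acts on \<open>A(G)\<close> by integration.
\<close>
definition positive_measures_on :: "'a::topological_space set \<Rightarrow> 'a measure set"
  where "positive_measures_on E =
    {m. sets m = sets borel \<and> finite_measure m \<and> emeasure m (- E) = 0}"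

definition radon_pm :: "'a::topological_ab_group_add set \<Rightarrow> (('a \<Rightarrow> complex) \<Rightarrow> complex) set"
  where "radon_pm E = {(\<lambda>u\<in>fourier_algebra.
      ((LINT s|m1. u s) - (LINT s|m2. u s)) + \<i> * ((LINT s|m3. u s) - (LINT s|m4. u s))) | m1 m2 m3 m4.
      m1 \<in> positive_measures_on E \<and> m2 \<in> positive_measures_on E \<and>
      m3 \<in> positive_measures_on E \<and> m4 \<in> positive_measures_on E}"

definition pm_weak_topology :: "(('a::topological_ab_group_add \<Rightarrow> complex) \<Rightarrow> complex) topology"
  where "pm_weak_topology =
    subtopology (product_topology (\<lambda>_. euclidean) fourier_algebra) pseudomeasures"

definition N_set :: "'a::topological_ab_group_add set \<Rightarrow> (('a \<Rightarrow> complex) \<Rightarrow> complex) set"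
  where "N_set E = pm_weak_topology closure_of radon_pm E"

definition M_set :: "'a::topological_ab_group_add set \<Rightarrow> bool"
  where "M_set E \<longleftrightarrow> closed E \<and> (\<exists>F\<in>PM E. F \<in> pseudofunctions \<and> F \<noteq> zero_pm)"

definition M1_set :: "'a::topological_ab_group_add set \<Rightarrow> bool"
  where "M1_set E \<longleftrightarrow> closed E \<and> (\<exists>F\<in>N_set E. F \<in> pseudofunctions \<and> F \<noteq> zero_pm)"


section \<open>Closable multipliers\<close>

text \<open>
  Elements of \<open>L\<^sup>2\<close> are represented by square integrable functions, with equality almost
  everywhere.  Accordingly operators on \<open>L\<^sup>2\<close> are maps on such functions that are
  linear modulo null sets, and they are identified by \<open>op_eq\<close>.  That they respect equality
  almost everywhere follows from linearity and boundedness.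
\<close>
definition L2 :: "'b measure \<Rightarrow> ('b \<Rightarrow> complex) set"
  where "L2 M = {\<xi> \<in> borel_measurable M. integrable M (\<lambda>x. (norm (\<xi> x))\<^sup>2)}"

definition L2_nrm :: "'b measure \<Rightarrow> ('b \<Rightarrow> complex) \<Rightarrow> real"
  where "L2_nrm M \<xi> = sqrt (LINT x|M. (norm (\<xi> x))\<^sup>2)"

type_synonym 'b oper = "('b \<Rightarrow> complex) \<Rightarrow> ('b \<Rightarrow> complex)"

definition bounded_operators :: "'b measure \<Rightarrow> 'b oper set"
  where "bounded_operators M = {T.
    (\<forall>\<xi>\<in>L2 M. T \<xi> \<in> L2 M) \<and>
    (\<forall>\<xi>\<in>L2 M. \<forall>\<eta>\<in>L2 M. AE x in M. T (\<lambda>z. \<xi> z + \<eta> z) x = T \<xi> x + T \<eta> x) \<and>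
    (\<forall>c. \<forall>\<xi>\<in>L2 M. AE x in M. T (\<lambda>z. c * \<xi> z) x = c * T \<xi> x) \<and>
    (\<exists>C. \<forall>\<xi>\<in>L2 M. L2_nrm M (T \<xi>) \<le> C * L2_nrm M \<xi>)}"

definition compact_operators :: "'b measure \<Rightarrow> 'b oper set"
  where "compact_operators M = {T \<in> bounded_operators M.
    \<forall>\<xi>::nat \<Rightarrow> 'b \<Rightarrow> complex. (\<forall>n. \<xi> n \<in> L2 M \<and> L2_nrm M (\<xi> n) \<le> 1) \<longrightarrow>
      (\<exists>\<eta>\<in>L2 M. \<exists>r. strict_mono r \<and>
        (\<lambda>n. L2_nrm M (\<lambda>x. T (\<xi> (r n)) x - \<eta> x)) \<longlonglongrightarrow> 0)}"

definition op_eq :: "'b measure \<Rightarrow> 'b oper \<Rightarrow> 'b oper \<Rightarrow> bool"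
  where "op_eq M S T \<longleftrightarrow> (\<forall>\<xi>\<in>L2 M. AE x in M. S \<xi> x = T \<xi> x)"

definition op_dist :: "'b measure \<Rightarrow> 'b oper \<Rightarrow> 'b oper \<Rightarrow> real"
  where "op_dist M S T =
    (SUP \<xi>\<in>{\<xi> \<in> L2 M. L2_nrm M \<xi> \<le> 1}. L2_nrm M (\<lambda>x. S \<xi> x - T \<xi> x))"

definition integral_operator :: "'b measure \<Rightarrow> ('b \<times> 'b \<Rightarrow> complex) \<Rightarrow> 'b oper"
  where "integral_operator M k = (\<lambda>\<xi> y. LINT x|M. k (x, y) * \<xi> x)"

text \<open>
  \<open>k\<close> ranges over the domain \<open>D(\<phi>)\<close>, and \<open>g\<close> is any representative of \<open>\<phi>k\<close>.  Only the class
  of \<open>\<phi>\<close> modulo null sets matters, so \<open>\<phi>\<close> need not be Borel.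
\<close>
definition multiplier_graph :: "'b measure \<Rightarrow> ('b \<times> 'b \<Rightarrow> complex) \<Rightarrow> ('b oper \<times> 'b oper) set"
  where "multiplier_graph M \<phi> = {(integral_operator M k, integral_operator M g) | k g.
    k \<in> L2 (M \<Otimes>\<^sub>M M) \<and> g \<in> L2 (M \<Otimes>\<^sub>M M) \<and> (AE z in M \<Otimes>\<^sub>M M. g z = \<phi> z * k z)}"

definition graph_closure :: "'b measure \<Rightarrow> ('b oper \<times> 'b oper) set \<Rightarrow> ('b oper \<times> 'b oper) set"
  where "graph_closure M \<Gamma> = {(S, T). S \<in> compact_operators M \<and> T \<in> compact_operators M \<and>
    (\<forall>\<epsilon>>0. \<exists>(A, B)\<in>\<Gamma>. op_dist M S A < \<epsilon> \<and> op_dist M T B < \<epsilon>)}"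

text \<open>
  The closure of the graph is a linear subspace, so it is the graph of a (linear) operator
  iff it is single valued.
\<close>
definition closable_multiplier :: "'b measure \<Rightarrow> ('b \<times> 'b \<Rightarrow> complex) \<Rightarrow> bool"
  where "closable_multiplier M \<phi> \<longleftrightarrow>
    (\<forall>(S, T)\<in>graph_closure M (multiplier_graph M \<phi>).
     \<forall>(S', T')\<in>graph_closure M (multiplier_graph M \<phi>). op_eq M S S' \<longrightarrow> op_eq M T T')"

end

theory Submission
  imports Defs "HOL-Probability.Discrete_Topology" "HOL-Complex_Analysis.Great_Picard"
begin

text \<open>
  The symbol \<open>f (s - t)\<close> turns a kernel \<open>\<kappa> (x - y)\<close> into \<open>(f \<kappa>) (x - y)\<close>, so on such kernels,
  whose operators are convolutions diagonalised by the characters, the multiplier is multiplication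
  by \<open>f\<close>.  A failure of closability and a nonzero pseudofunction annihilating \<open>J_ideal\<close> are two forms
  of the same obstruction, and each part of the theorem passes from one form to the other.

  If \<open>E_set\<close> is not an \<open>M\<close>-set (\<open>closable_if_not_M_set\<close>): two elements of the closed graph with the same first
  component have second components that differ by an operator \<open>D\<close>, the norm limit of integral operators
  with kernels \<open>f (x - y) k (x, y)\<close> while the operators with kernels \<open>k\<close> tend to zero.  Fix bounded \<open>\<xi>\<close> and \<open>\<eta>\<close> and
  let \<open>d \<gamma>\<close> be the integral of \<open>D (cnj \<gamma> \<cdot> \<xi>) \<cdot> \<gamma> \<cdot> \<eta>\<close>.  If \<open>D\<close> has a square integrable kernel, \<open>d \<gamma>\<close> is a Fourier
  coefficient with respect to the orthogonal family \<open>\<gamma> (x - y)\<close>, so it vanishes at infinity by Bessel's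
  inequality, and this property survives norm limits.  Hence \<open>d\<close> is the transform of a pseudofunction \<open>F\<close>.
  For \<open>h\<close> in \<open>J_ideal\<close> the factor \<open>f\<close> can be moved from the kernel to \<open>h\<close>, where it gives the element \<open>f h\<close> of the
  Fourier algebra, and what is left is paired with \<open>k\<close>, which tends to zero; thus \<open>F h = 0\<close>.  Because \<open>J_ideal\<close>
  is an ideal, \<open>F\<close> is supported in \<open>E_set\<close>, so \<open>F = 0\<close>, and the coefficient of the trivial character says that
  \<open>D \<xi>\<close> is orthogonal to \<open>cnj \<eta>\<close> (\<open>limit_operator_zero\<close>).

  If \<open>E_set\<close> is an \<open>M\<^sub>1\<close>-set (\<open>not_closable_if_M1_set\<close>): a pseudofunction \<open>F \<noteq> 0\<close> in \<open>N_set\<close> annihilates \<open>J_ideal\<close>,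
  since measures on \<open>E_set\<close> do.  Its coefficients \<open>c\<close> vanish at infinity and are the eigenvalues of a nonzero
  compact operator \<open>T\<close> (\<open>character_multiplier_compact\<close>).  The pair \<open>(0, T)\<close> lies in the closed graph: by
  Hahn-Banach for null sequences, if \<open>(0, c)\<close> could not be approximated uniformly by the coefficients of pairs
  \<open>(\<kappa>, f \<kappa>)\<close>, there would be \<open>u\<close> and \<open>v\<close> in the Fourier algebra with \<open>u + f v = 0\<close> almost everywhere and \<open>F v \<noteq> 0\<close>;
  but then \<open>v\<close> is in \<open>J_ideal\<close> (\<open>kernel_approximation\<close>).

  To pass from uniform closeness of coefficients to closeness of operators one needs that the norm of convolution
  by \<open>\<kappa>\<close> is at most the supremum of its Fourier coefficients (\<open>convolution_norm_le\<close>).  This is where the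
  characters have to be plentiful.  With \<open>\<psi> = \<kappa> * star \<kappa>\<close>, the powers of \<open>\<psi>\<close>, normalised by the right
  \<open>lam\<close>, converge uniformly to an idempotent \<open>e\<close> spanning an eigenspace of \<open>\<psi>\<close> for the eigenvalue \<open>lam\<close>, and \<open>lam\<close> bounds
  the square of the norm (\<open>top_idempotent\<close>).  Idempotents in that eigenspace have \<open>e 0\<close> bounded away from zero, so one
  of them cannot be split any further.  Its translates are then multiples of it, so it is a multiple of a character
  \<open>\<gamma>\<close>, and \<open>lam = |hat \<kappa> \<gamma>|\<^sup>2\<close> (\<open>eigen_character\<close>).
\<close>

section \<open>The Hahn-Banach theorem and functionals on null sequences\<close>

definition sublinear :: "('v::real_vector \<Rightarrow> real) \<Rightarrow> bool"
  where "sublinear q \<longleftrightarrow> (\<forall>x y. q (x + y) \<le> q x + q y) \<and> (\<forall>t\<ge>0. \<forall>x. q (t *\<^sub>R x) = t * q x)"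

lemma sublinear_add: "sublinear q \<Longrightarrow> q (x + y) \<le> q x + q y"
  and sublinear_scale: "sublinear q \<Longrightarrow> t \<ge> 0 \<Longrightarrow> q (t *\<^sub>R x) = t * q x"
  by (auto simp: sublinear_def)

lemma sublinear_zero: "sublinear q \<Longrightarrow> q 0 = 0"
  using sublinear_scale[of q 0 0] by simp

lemma sublinear_minus: "sublinear q \<Longrightarrow> - q (- x) \<le> q x"
  using sublinear_add[of q x "- x"] sublinear_zero[of q] by simp

text \<open>
  The largest sublinear functional below \<open>q\<close> that is at most \<open>- q y\<close> at \<open>- y\<close>.  A linear functional below it
  takes the value \<open>q y\<close> at \<open>y\<close>, so \<open>push\<close> serves both to show that minimal sublinear functionals are
  linear and to prescribe the value of a linear functional at one vector.
\<close>
definition push :: "'v::real_vector \<Rightarrow> ('v \<Rightarrow> real) \<Rightarrow> 'v \<Rightarrow> real"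
  where "push y q x = (INF t\<in>{0..}. q (x + t *\<^sub>R y) - t * q y)"

lemma push:
  assumes q: "sublinear q"
  shows sublinear_push: "sublinear (push y q)"
    and push_le: "push y q x \<le> q x"
    and push_le_diff: "push y q x \<le> q (x + y) - q y"
proof -
  have lower: "- q (- x) \<le> q (x + t *\<^sub>R y) - t * q y" if "t \<ge> 0" for t x
    using sublinear_add[OF q, of "x + t *\<^sub>R y" "- x"] sublinear_scale[OF q that, of y] by simp
  have bdd: "bdd_below ((\<lambda>t. q (x + t *\<^sub>R y) - t * q y) ` {0..})" for x
    using lower by (intro bdd_belowI[of _ "- q (- x)"]) auto
  have le: "push y q x \<le> q (x + t *\<^sub>R y) - t * q y" if "t \<ge> 0" for t x
    unfolding push_def by (rule cINF_lower[OF bdd]) (use that in auto)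
  show "push y q x \<le> q x" using le[of 0 x] by simp
  show "push y q x \<le> q (x + y) - q y" using le[of 1 x] by simp
  have ge: "c \<le> push y q x" if "\<And>t. t \<ge> 0 \<Longrightarrow> c \<le> q (x + t *\<^sub>R y) - t * q y" for c x
    unfolding push_def using that by (intro cINF_greatest) auto
  have add: "push y q (u + v) \<le> push y q u + push y q v" for u v
  proof -
    have "push y q (u + v) - (q (u + t *\<^sub>R y) - t * q y) \<le> push y q v" if t: "t \<ge> 0" for t
    proof (rule ge)
      fix s :: real assume s: "s \<ge> 0"
      have "push y q (u + v) \<le> q ((u + v) + (t + s) *\<^sub>R y) - (t + s) * q y"
        by (rule le) (use s t in auto)
      also have "(u + v) + (t + s) *\<^sub>R y = (u + t *\<^sub>R y) + (v + s *\<^sub>R y)"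
        by (simp add: algebra_simps)
      also have "q \<dots> \<le> q (u + t *\<^sub>R y) + q (v + s *\<^sub>R y)" by (rule sublinear_add[OF q])
      finally show "push y q (u + v) - (q (u + t *\<^sub>R y) - t * q y) \<le> q (v + s *\<^sub>R y) - s * q y"
        by (simp add: algebra_simps)
    qed
    then have "push y q (u + v) - push y q v \<le> push y q u"
      by (intro ge) (simp add: algebra_simps)
    then show ?thesis by simp
  qed
  have scale_le: "r * push y q x \<le> push y q (r *\<^sub>R x)" if r: "r > 0" for r x
  proof (rule ge)
    fix t :: real assume t: "t \<ge> 0"
    have "r * push y q x \<le> r * (q (x + (t / r) *\<^sub>R y) - (t / r) * q y)"
      using le[of "t / r" x] r t by (intro mult_left_mono) auto
    also have "\<dots> = q (r *\<^sub>R (x + (t / r) *\<^sub>R y)) - t * q y"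
      using r sublinear_scale[OF q, of r "x + (t / r) *\<^sub>R y"] by (simp add: algebra_simps)
    also have "r *\<^sub>R (x + (t / r) *\<^sub>R y) = r *\<^sub>R x + t *\<^sub>R y"
      using r by (simp add: algebra_simps)
    finally show "r * push y q x \<le> q (r *\<^sub>R x + t *\<^sub>R y) - t * q y" .
  qed
  have scale: "push y q (r *\<^sub>R x) = r * push y q x" if r: "r > 0" for r x
  proof (rule antisym)
    have "push y q (r *\<^sub>R x) = r * (inverse r * push y q (r *\<^sub>R x))" using r by simp
    also have "\<dots> \<le> r * push y q (inverse r *\<^sub>R (r *\<^sub>R x))"
      using r scale_le[of "inverse r" "r *\<^sub>R x"] by (intro mult_left_mono) auto
    finally show "push y q (r *\<^sub>R x) \<le> r * push y q x" using r by simp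
  qed (rule scale_le[OF r])
  have "push y q 0 = 0"
    using le[of 0 0] ge[of 0 0] sublinear_scale[OF q] sublinear_zero[OF q] by (auto intro: antisym)
  then show "sublinear (push y q)"
    unfolding sublinear_def using add scale by (auto simp: le_less)
qed

text \<open>
  Minimality gives \<open>push y q = q\<close> for every \<open>y\<close>, which is the missing superadditivity.
\<close>
lemma minimal_sublinear_linear:
  assumes q: "sublinear q" and min: "\<And>r. sublinear r \<Longrightarrow> (\<And>x. r x \<le> q x) \<Longrightarrow> r = q"
  shows "linear q"
proof -
  have "q (x + y) = q x + q y" for x y
  proof (rule antisym)
    have "push y q = q" by (intro min sublinear_push push_le q)
    then show "q x + q y \<le> q (x + y)" using push_le_diff[OF q, of y x] by simp
  qed (rule sublinear_add[OF q])
  note add = this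
  have neg: "q (- x) = - q x" for x
    using add[of x "- x"] sublinear_zero[OF q] by simp
  have "q (r *\<^sub>R x) = r * q x" for r x
    using sublinear_scale[OF q, of r x] sublinear_scale[OF q, of "- r" "- x"] neg[of x]
    by (cases "r \<ge> 0") auto
  with add show ?thesis by (intro linearI) auto
qed

text \<open>
  By Zorn's lemma there is a minimal sublinear functional below \<open>p\<close>: the pointwise infimum of a chain is
  again sublinear.
\<close>
lemma linear_below_sublinear:
  assumes p: "sublinear (p :: 'v::real_vector \<Rightarrow> real)"
  obtains L where "linear L" "\<And>x. L x \<le> p x"
proof -
  define A where "A = {q. sublinear q \<and> (\<forall>x. q x \<le> p x)}"
  define R where "R = (\<lambda>a b :: 'v \<Rightarrow> real. \<forall>x. b x \<le> a x)"
  have "\<exists>m\<in>A. \<forall>a\<in>A. R m a \<longrightarrow> a = m"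
  proof (rule predicate_Zorn)
    show "partial_order_on A (relation_of R A)"
    proof (rule partial_order_on_relation_ofI)
      show "R a c" if "R a b" "R b c" for a b c using that by (auto simp: R_def intro: order_trans)
      show "a = b" if "R a b" "R b a" for a b using that by (simp add: R_def fun_eq_iff order_antisym)
    qed (auto simp: R_def)
  next
    fix C assume C: "C \<in> Chains (relation_of R A)"
    then have CA: "C \<subseteq> A" and tot: "\<And>a b. a \<in> C \<Longrightarrow> b \<in> C \<Longrightarrow> R a b \<or> R b a"
      by (auto simp: Chains_def relation_of_def)
    show "\<exists>u\<in>A. \<forall>a\<in>C. R a u"
    proof (cases "C = {}")
      case True then show ?thesis using p by (auto simp: A_def)
    next
      case False
      define u where "u x = (INF a\<in>C. a x)" for x
      have bdd: "bdd_below ((\<lambda>a. a x) ` C)" for x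
      proof (rule bdd_belowI2)
        fix a assume "a \<in> C"
        with CA have "sublinear a" "a (- x) \<le> p (- x)" by (auto simp: A_def)
        then show "- p (- x) \<le> a x" using sublinear_minus[of a x] by linarith
      qed
      have le: "u x \<le> a x" if "a \<in> C" for a x
        unfolding u_def by (rule cINF_lower[OF bdd that])
      have ge: "c \<le> u x" if "\<And>a. a \<in> C \<Longrightarrow> c \<le> a x" for c x
        unfolding u_def using False that by (intro cINF_greatest) auto
      have sl: "sublinear a" if "a \<in> C" for a using that CA by (auto simp: A_def)
      have add: "u (x + y) \<le> u x + u y" for x y
      proof -
        have *: "u (x + y) \<le> a x + b y" if ab: "a \<in> C" "b \<in> C" for a b
        proof -
          from tot[OF ab] obtain c where c: "c \<in> C" "c x \<le> a x" "c y \<le> b y"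
            using ab unfolding R_def by blast
          then show ?thesis using le[OF c(1), of "x + y"] sublinear_add[OF sl[OF c(1)], of x y] by linarith
        qed
        have "u (x + y) - a x \<le> u y" if "a \<in> C" for a
          by (rule ge) (use *[OF that] in \<open>simp add: algebra_simps\<close>)
        then have "u (x + y) - u y \<le> u x"
          by (intro ge) (simp add: algebra_simps)
        then show ?thesis by simp
      qed
      have scale_le: "r * u x \<le> u (r *\<^sub>R x)" if "r \<ge> 0" for r x
      proof (rule ge)
        fix a assume a: "a \<in> C"
        show "r * u x \<le> a (r *\<^sub>R x)"
          using mult_left_mono[OF le[OF a, of x] that] sublinear_scale[OF sl[OF a] that, of x] by simp
      qed
      have scale: "u (r *\<^sub>R x) = r * u x" if r: "r > 0" for r x
      proof (rule antisym)
        have "inverse r * u (r *\<^sub>R x) \<le> u x" using scale_le[of "inverse r" "r *\<^sub>R x"] r by simp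
        then show "u (r *\<^sub>R x) \<le> r * u x" using r by (simp add: field_simps)
      qed (use scale_le r in auto)
      have "u 0 = 0"
        using False le[of _ 0] ge[of 0 0] sublinear_zero[OF sl] by (metis all_not_in_conv antisym order_refl)
      then have "sublinear u" unfolding sublinear_def using add scale by (auto simp: le_less)
      moreover have "u x \<le> p x" for x
        using False le[of _ x] CA by (force simp: A_def intro: order_trans)
      ultimately show ?thesis using le by (auto simp: A_def R_def)
    qed
  qed
  then obtain m where m: "sublinear m" "\<And>x. m x \<le> p x"
    and min: "\<And>a. sublinear a \<Longrightarrow> (\<And>x. a x \<le> p x) \<Longrightarrow> (\<And>x. a x \<le> m x) \<Longrightarrow> a = m"
    by (auto simp: A_def R_def)
  have "linear m"
    by (rule minimal_sublinear_linear[OF m(1)]) (use min m(2) in \<open>blast intro: order_trans\<close>)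
  with m(2) show ?thesis by (intro that)
qed

text \<open>
  Every linear functional below the distance to \<open>V\<close> is bounded by the norm and vanishes on \<open>V\<close>; choosing it
  below \<open>push w\<close> of the distance makes it nonzero at \<open>w\<close>.
\<close>
theorem hahn_banach_separation:
  fixes V :: "'v::real_normed_vector set"
  assumes V: "subspace V" and \<delta>: "\<delta> > 0" and far: "\<And>v. v \<in> V \<Longrightarrow> \<delta> \<le> norm (w - v)"
  obtains L :: "'v \<Rightarrow> real" where "linear L" "\<And>x. \<bar>L x\<bar> \<le> norm x" "\<And>v. v \<in> V \<Longrightarrow> L v = 0" "L w \<noteq> 0"
proof -
  define p where "p x = (INF v\<in>V. norm (x - v))" for x
  have V0: "0 \<in> V" by (rule subspace_0[OF V])
  have bdd: "bdd_below ((\<lambda>v. norm (x - v)) ` V)" for x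
    by (intro bdd_belowI[of _ 0]) auto
  have le: "p x \<le> norm (x - v)" if "v \<in> V" for x v
    unfolding p_def by (rule cINF_lower[OF bdd that])
  have ge: "c \<le> p x" if "\<And>v. v \<in> V \<Longrightarrow> c \<le> norm (x - v)" for c x
    unfolding p_def using V0 that by (intro cINF_greatest) auto
  have p_add: "p (x + y) \<le> p x + p y" for x y
  proof -
    have *: "p (x + y) \<le> norm (x - a) + norm (y - b)" if "a \<in> V" "b \<in> V" for a b
    proof -
      have "p (x + y) \<le> norm ((x + y) - (a + b))" by (intro le subspace_add V that)
      also have "(x + y) - (a + b) = (x - a) + (y - b)" by simp
      also have "norm \<dots> \<le> norm (x - a) + norm (y - b)" by (rule norm_triangle_ineq)
      finally show ?thesis .
    qed
    have "p (x + y) - norm (x - a) \<le> p y" if "a \<in> V" for a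
      by (rule ge) (use *[OF that] in \<open>simp add: algebra_simps\<close>)
    then have "p (x + y) - p y \<le> p x"
      by (intro ge) (simp add: algebra_simps)
    then show ?thesis by simp
  qed
  have p_scale_le: "p (r *\<^sub>R x) \<le> r * p x" if r: "r > 0" for r x
  proof -
    have "inverse r * p (r *\<^sub>R x) \<le> p x"
    proof (rule ge)
      fix v assume "v \<in> V"
      then have "p (r *\<^sub>R x) \<le> norm (r *\<^sub>R x - r *\<^sub>R v)" by (intro le subspace_scale V)
      also have "\<dots> = r * norm (x - v)" using r by (simp flip: scaleR_diff_right)
      finally show "inverse r * p (r *\<^sub>R x) \<le> norm (x - v)" using r by (simp add: field_simps)
    qed
    then show ?thesis using r by (simp add: field_simps)
  qed
  have p_scale: "p (r *\<^sub>R x) = r * p x" if r: "r > 0" for r x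
    using p_scale_le[OF r, of x] p_scale_le[of "inverse r" "r *\<^sub>R x"] r
    by (intro antisym) (auto simp: field_simps)
  have p_V: "p v = 0" if "v \<in> V" for v
    using le[OF that, of v] ge[of 0 v] by (auto intro: antisym)
  have p: "sublinear p"
    unfolding sublinear_def using p_add p_scale p_V[OF V0] by (auto simp: le_less)
  obtain L where L: "linear L" and Lp: "\<And>x. L x \<le> push w p x"
    using linear_below_sublinear[OF sublinear_push[OF p, of w]] by metis
  have L_le: "L x \<le> p x" for x using Lp[of x] push_le[OF p, of w x] by simp
  show ?thesis
  proof (rule that[OF L])
    have p_norm: "p x \<le> norm x" for x using le[OF V0, of x] by simp
    show "\<bar>L x\<bar> \<le> norm x" for x
      using L_le[of x] L_le[of "- x"] p_norm[of x] p_norm[of "- x"] linear_neg[OF L, of x] by auto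
    show "L v = 0" if "v \<in> V" for v
      using L_le[of v] L_le[of "- v"] p_V[OF that] p_V[OF subspace_neg[OF V that]]
        linear_neg[OF L, of v] by auto
    have "\<delta> \<le> p w" by (rule ge) (rule far)
    moreover have "L (- w) \<le> p (- w + w) - p w"
      using Lp[of "- w"] push_le_diff[OF p, of w "- w"] by simp
    ultimately show "L w \<noteq> 0" using \<delta> linear_neg[OF L, of w] p_V[OF V0] by auto
  qed
qed


definition vanishing :: "('i \<Rightarrow> complex) \<Rightarrow> bool"
  where "vanishing x \<longleftrightarrow> (\<forall>\<epsilon>>0. finite {i. \<epsilon> \<le> norm (x i)})"

text \<open>
  Bounded continuous functions on the discrete index space form the normed space in which null sequences
  live.
\<close>
definition bc :: "('i \<Rightarrow> complex) \<Rightarrow> ('i discrete \<Rightarrow>\<^sub>C complex)"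
  where "bc x = Bcontfun (\<lambda>d. x (of_discrete d))"

lemma vanishing_bounded:
  assumes "vanishing x" shows "bounded (range x)"
proof -
  have "range x \<subseteq> x ` {i. 1 \<le> norm (x i)} \<union> ball 0 1" by auto
  moreover have "bounded (x ` {i. 1 \<le> norm (x i)} \<union> ball 0 1)"
    using assms by (auto simp: vanishing_def intro!: finite_imp_bounded)
  ultimately show ?thesis by (rule bounded_subset[rotated])
qed

lemma apply_bc: "bounded (range x) \<Longrightarrow> apply_bcontfun (bc x) d = x (of_discrete d)"
  unfolding bc_def
  by (subst Bcontfun_inverse)
     (auto simp: bcontfun_def image_def continuous_on_open_vimage open_discrete elim!: bounded_subset)

lemma bounded_finite_support: "finite F \<Longrightarrow> bounded (range (\<lambda>i. if i \<in> F then x i else (0::complex)))"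
  by (rule bounded_subset[of "insert 0 (x ` F)"]) (auto intro!: finite_imp_bounded)

lemma mult_cnj_sgn: "z * cnj (sgn z) = of_real (norm z)"
  by (cases "z = 0") (auto simp: sgn_eq field_simps complex_norm_square[symmetric] power2_eq_square)

lemma infsum_diff_complex:
  fixes f g :: "'i \<Rightarrow> complex"
  assumes "f summable_on A" "g summable_on A"
  shows "(\<Sum>\<^sub>\<infinity>i\<in>A. f i - g i) = infsum f A - infsum g A"
  using infsum_add[OF assms(1) summable_on_uminus[THEN iffD2, OF assms(2)]] by (simp add: infsum_uminus)

text \<open>
  The real functional \<open>L\<close> given by Hahn-Banach is the real part of pairing with the sequence \<open>a\<close> that is read off
  from the values of \<open>L\<close> on the unit vectors.  Testing \<open>L\<close> on finitely supported sequences of signs bounds the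
  partial sums of \<open>|a|\<close>, and null sequences are uniform limits of finitely supported ones.
\<close>
theorem c0_separation:
  fixes V :: "('i \<Rightarrow> complex) set"
  assumes ne: "(\<lambda>i. 0) \<in> V" and add: "\<And>x y. x \<in> V \<Longrightarrow> y \<in> V \<Longrightarrow> (\<lambda>i. x i + y i) \<in> V"
    and scale: "\<And>c x. x \<in> V \<Longrightarrow> (\<lambda>i. c * x i) \<in> V"
    and V: "\<And>x. x \<in> V \<Longrightarrow> vanishing x" and w: "vanishing w"
    and \<delta>: "\<delta> > 0" and far: "\<And>x. x \<in> V \<Longrightarrow> \<exists>i. \<delta> \<le> norm (w i - x i)"
  obtains a where "(\<lambda>i. norm (a i)) summable_on UNIV"
    "\<And>x. x \<in> V \<Longrightarrow> (\<Sum>\<^sub>\<infinity>i. a i * x i) = 0" "(\<Sum>\<^sub>\<infinity>i. a i * w i) \<noteq> 0"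
proof -
  note bV = vanishing_bounded[OF V] and bw = vanishing_bounded[OF w]
  have eqI: "f = g" if "\<And>i. apply_bcontfun f (discrete i) = apply_bcontfun g (discrete i)"
    for f g :: "'i discrete \<Rightarrow>\<^sub>C complex"
    by (rule bcontfun_eqI) (use that[of "of_discrete _"] in \<open>simp add: of_discrete_inverse\<close>)
  have sub: "subspace (bc ` V)"
    unfolding subspace_def
  proof (intro conjI ballI allI; (elim imageE)?; clarsimp?)
    have "bc (\<lambda>i. 0) = (0 :: 'i discrete \<Rightarrow>\<^sub>C complex)"
      by (rule eqI) (simp add: apply_bc)
    then show "0 \<in> bc ` V" using ne by (metis imageI)
    fix x assume x: "x \<in> V"
    show "bc x + bc y \<in> bc ` V" if y: "y \<in> V" for y
    proof -
      have "bc (\<lambda>i. x i + y i) = bc x + bc y"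
        by (rule eqI) (simp add: apply_bc bV x y add)
      then show ?thesis using add[OF x y] by (metis imageI)
    qed
    show "c *\<^sub>R bc x \<in> bc ` V" for c
    proof -
      have "bc (\<lambda>i. of_real c * x i) = c *\<^sub>R bc x"
        by (rule eqI) (simp add: apply_bc bV x scale scaleR_conv_of_real)
      then show ?thesis using scale[OF x, of "of_real c"] by (metis imageI)
    qed
  qed
  have far': "\<delta> \<le> norm (bc w - v)" if v: "v \<in> bc ` V" for v
  proof -
    obtain x where x: "x \<in> V" "v = bc x" using v by auto
    obtain i where i: "\<delta> \<le> norm (w i - x i)" using far[OF x(1)] by auto
    have "w i - x i = apply_bcontfun (bc w - v) (discrete i)"
      by (simp add: x apply_bc bw bV discrete_inverse)
    with i show ?thesis using norm_bounded[of "bc w - v" "discrete i"] by simp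
  qed
  obtain L where L: "linear L" and Ln: "\<And>x. \<bar>L x\<bar> \<le> norm x"
    and LV: "\<And>x. x \<in> V \<Longrightarrow> L (bc x) = 0" and Lw: "L (bc w) \<noteq> 0"
    using hahn_banach_separation[OF sub \<delta> far'] by (metis imageI)
  define e where "e i z = bc (\<lambda>j. if j \<in> {i} then z else 0)" for i :: 'i and z :: complex
  \<comment> \<open>chosen so that \<open>Re (a i * z) = L (e i z)\<close>\<close>
  define a where "a i = Complex (L (e i 1)) (- L (e i \<i>))" for i
  have ap: "apply_bcontfun (bc (\<lambda>j. if j \<in> F then x j else 0)) d = (if of_discrete d \<in> F then x (of_discrete d) else 0)"
    if "finite F" for F x d by (rule apply_bc[OF bounded_finite_support[OF that]])
  have Le: "L (e i z) = Re (a i * z)" for i z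
  proof -
    have "e i z = Re z *\<^sub>R e i 1 + Im z *\<^sub>R e i \<i>"
      unfolding e_def by (rule eqI) (use ap[of "{i}"] in \<open>auto simp: complex_eq_iff\<close>)
    then have "L (e i z) = Re z * L (e i 1) + Im z * L (e i \<i>)"
      by (simp add: linear_add[OF L] linear_scale[OF L])
    then show ?thesis by (simp add: a_def mult.commute)
  qed
  have LF: "L (bc (\<lambda>j. if j \<in> F then x j else 0)) = (\<Sum>i\<in>F. Re (a i * x i))" if F: "finite F" for F x
    using F
  proof (induction F)
    case empty
    have "bc (\<lambda>j. if j \<in> {} then x j else 0) = (0 :: 'i discrete \<Rightarrow>\<^sub>C complex)"
      by (rule eqI) (simp add: apply_bc)
    then show ?case by (simp add: linear_0[OF L])
  next
    case (insert k F)
    have "bc (\<lambda>j. if j \<in> insert k F then x j else 0) = e k (x k) + bc (\<lambda>j. if j \<in> F then x j else 0)"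
      unfolding e_def using insert(1,2) 
      by (intro eqI) (simp only: plus_bcontfun.rep_eq, subst (1 2 3) ap, auto simp: discrete_inverse)
    then show ?case using insert Le by (simp add: linear_add[OF L])
  qed
  have fin: "(\<Sum>i\<in>F. norm (a i)) \<le> 1" if F: "finite F" for F
  proof -
    have "(\<Sum>i\<in>F. norm (a i)) = (\<Sum>i\<in>F. Re (a i * cnj (sgn (a i))))"
      by (intro sum.cong refl) (simp add: mult_cnj_sgn)
    also have "\<dots> = L (bc (\<lambda>j. if j \<in> F then cnj (sgn (a j)) else 0))" by (rule LF[OF F, symmetric])
    also have "\<dots> \<le> norm (bc (\<lambda>j. if j \<in> F then cnj (sgn (a j)) else 0))" using Ln by (rule abs_le_D1)
    also have "\<dots> \<le> 1" by (rule norm_bound) (auto simp: ap[OF F] norm_sgn)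
    finally show ?thesis .
  qed
  have sm: "(\<lambda>i. norm (a i)) summable_on UNIV"
    by (rule nonneg_bdd_above_summable_on) (auto intro!: bdd_aboveI[of _ 1] fin)
  define A where "A = (\<Sum>\<^sub>\<infinity>i. norm (a i))"
  have A0: "A \<ge> 0" unfolding A_def by (rule infsum_nonneg) auto
  have smx: "(\<lambda>i. norm (a i * x i)) summable_on UNIV" and leC: "norm (\<Sum>\<^sub>\<infinity>i. a i * x i) \<le> A * C"
    if x: "\<And>i. norm (x i) \<le> C" for x C
  proof -
    have s: "(\<lambda>i. norm (a i) * C) summable_on UNIV" by (rule summable_on_cmult_left[OF sm])
    show s2: "(\<lambda>i. norm (a i * x i)) summable_on UNIV"
      by (rule summable_on_comparison_test[OF s]) (auto simp: norm_mult intro!: mult_left_mono x)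
    have "norm (\<Sum>\<^sub>\<infinity>i. a i * x i) \<le> (\<Sum>\<^sub>\<infinity>i. norm (a i * x i))" by (rule norm_infsum_bound[OF s2])
    also have "\<dots> \<le> (\<Sum>\<^sub>\<infinity>i. norm (a i) * C)"
      by (rule infsum_mono[OF s2 s]) (auto simp: norm_mult intro!: mult_left_mono x)
    also have "\<dots> = A * C" by (simp add: A_def infsum_cmult_left' )
    finally show "norm (\<Sum>\<^sub>\<infinity>i. a i * x i) \<le> A * C" .
  qed
  have rep: "L (bc x) = Re (\<Sum>\<^sub>\<infinity>i. a i * x i)" if x: "vanishing x" for x
  proof -
    obtain C where C: "\<And>i. norm (x i) \<le> C"
      using vanishing_bounded[OF x] by (auto simp: bounded_iff)
    have "\<bar>L (bc x) - Re (\<Sum>\<^sub>\<infinity>i. a i * x i)\<bar> \<le> \<epsilon> * (1 + A)" if \<epsilon>: "\<epsilon> > 0" for \<epsilon>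
    proof -
      define F where "F = {i. \<epsilon> \<le> norm (x i)}"
      define y where "y j = (if j \<in> F then x j else 0)" for j
      have F: "finite F" using x \<epsilon> by (auto simp: vanishing_def F_def)
      have by': "bounded (range y)" unfolding y_def by (rule bounded_finite_support[OF F])
      have xy: "norm (x i - y i) \<le> \<epsilon>" for i using \<epsilon> by (auto simp: y_def F_def)
      have yC: "norm (y i) \<le> C" for i using C[of i] by (auto simp: y_def intro: order_trans[OF norm_ge_zero])
      have "norm (bc x - bc y) \<le> \<epsilon>"
        by (rule norm_bound) (simp add: apply_bc vanishing_bounded[OF x] by' xy)
      then have 1: "\<bar>L (bc x) - L (bc y)\<bar> \<le> \<epsilon>"
        using Ln[of "bc x - bc y"] by (simp add: linear_diff[OF L])
      have "(\<Sum>\<^sub>\<infinity>i. a i * y i) = (\<Sum>\<^sub>\<infinity>i\<in>F. a i * y i)"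
        by (rule infsum_cong_neutral) (auto simp: y_def)
      then have "L (bc y) = Re (\<Sum>\<^sub>\<infinity>i. a i * y i)"
        unfolding y_def by (subst LF[OF F]) (simp add: F y_def)
      moreover have "(\<Sum>\<^sub>\<infinity>i. a i * x i) - (\<Sum>\<^sub>\<infinity>i. a i * y i) = (\<Sum>\<^sub>\<infinity>i. a i * (x i - y i))"
        by (simp add: right_diff_distrib infsum_diff_complex abs_summable_summable[OF smx[OF C]]
              abs_summable_summable[OF smx[OF yC]])
      moreover have "norm (\<Sum>\<^sub>\<infinity>i. a i * (x i - y i)) \<le> A * \<epsilon>" by (rule leC[OF xy])
      ultimately have "\<bar>Re (\<Sum>\<^sub>\<infinity>i. a i * x i) - L (bc y)\<bar> \<le> A * \<epsilon>"
        using abs_Re_le_cmod[of "(\<Sum>\<^sub>\<infinity>i. a i * x i) - (\<Sum>\<^sub>\<infinity>i. a i * y i)"] by (simp flip: minus_complex.simps(1))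
      with 1 show ?thesis by (simp add: algebra_simps)
    qed
    note bnd = this
    have "\<bar>L (bc x) - Re (\<Sum>\<^sub>\<infinity>i. a i * x i)\<bar> \<le> 0 + \<epsilon>" if "\<epsilon> > 0" for \<epsilon>
      using bnd[of "\<epsilon> / (1 + A)"] that A0 by simp
    then show ?thesis using field_le_epsilon[of "\<bar>L (bc x) - Re (\<Sum>\<^sub>\<infinity>i. a i * x i)\<bar>" 0] by simp
  qed
  show ?thesis
  proof (rule that[OF sm])
    fix x assume x: "x \<in> V"
    \<comment> \<open>\<open>L\<close> controls only real parts; multiplying by \<open>\<i>\<close> inside \<open>V\<close> gives the imaginary part\<close>
    have "(\<Sum>\<^sub>\<infinity>i. a i * (\<i> * x i)) = \<i> * (\<Sum>\<^sub>\<infinity>i. a i * x i)"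
      by (simp add: mult.left_commute[of _ \<i>] infsum_cmult_right')
    then show "(\<Sum>\<^sub>\<infinity>i. a i * x i) = 0"
      using rep[OF V[OF x]] rep[OF V[OF scale[OF x, of \<i>]]] LV[OF x] LV[OF scale[OF x, of \<i>]]
      by (simp add: complex_eq_iff)
  next
    show "(\<Sum>\<^sub>\<infinity>i. a i * w i) \<noteq> 0" using rep[OF w] Lw by auto
  qed
qed

section \<open>Square integrable functions\<close>

lemma borel_measurable_cnj_compose [measurable (raw)]:
  "\<xi> \<in> borel_measurable M \<Longrightarrow> (\<lambda>x. cnj (\<xi> x)) \<in> borel_measurable M"
  by (rule measurable_compose[OF _ borel_measurable_continuous_onI[OF continuous_on_cnj[OF continuous_on_id]]])

lemma L2_measurable: "\<xi> \<in> L2 M \<Longrightarrow> \<xi> \<in> borel_measurable M"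
  and L2_integrable_square: "\<xi> \<in> L2 M \<Longrightarrow> integrable M (\<lambda>x. (norm (\<xi> x))\<^sup>2)"
  by (auto simp: L2_def)

lemma L2_nrm_nonneg [simp]: "0 \<le> L2_nrm M \<xi>"
  by (simp add: L2_nrm_def)

lemma L2_nrm_square: "(L2_nrm M \<xi>)\<^sup>2 = (LINT x|M. (norm (\<xi> x))\<^sup>2)"
  by (simp add: L2_nrm_def)

lemma L2_dominated:
  assumes \<xi>: "\<xi> \<in> L2 M" and \<eta>: "\<eta> \<in> borel_measurable M" and C: "C \<ge> 0"
    and le: "AE x in M. norm (\<eta> x) \<le> C * norm (\<xi> x)"
  shows "\<eta> \<in> L2 M" and "L2_nrm M \<eta> \<le> C * L2_nrm M \<xi>"
proof -
  have i: "integrable M (\<lambda>x. C\<^sup>2 * (norm (\<xi> x))\<^sup>2)" using L2_integrable_square[OF \<xi>] by simp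
  have le2: "AE x in M. (norm (\<eta> x))\<^sup>2 \<le> C\<^sup>2 * (norm (\<xi> x))\<^sup>2"
    using le by eventually_elim (metis norm_ge_zero power_mono power_mult_distrib)
  have j: "integrable M (\<lambda>x. (norm (\<eta> x))\<^sup>2)"
    by (rule Bochner_Integration.integrable_bound[OF i]) (use \<eta> le2 in auto)
  then show "\<eta> \<in> L2 M" using \<eta> by (simp add: L2_def)
  have "(L2_nrm M \<eta>)\<^sup>2 \<le> (C * L2_nrm M \<xi>)\<^sup>2"
    unfolding L2_nrm_square power_mult_distrib
    using integral_mono_AE[OF j i le2] by simp
  then show "L2_nrm M \<eta> \<le> C * L2_nrm M \<xi>" by (rule power2_le_imp_le) (simp add: C)
qed

lemma L2_nrm_cong: 
  assumes "\<xi> \<in> L2 M" "\<eta> \<in> borel_measurable M" "AE x in M. \<xi> x = \<eta> x"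
  shows "\<eta> \<in> L2 M" "L2_nrm M \<eta> = L2_nrm M \<xi>"
proof -
  have 1: "AE x in M. norm (\<eta> x) \<le> 1 * norm (\<xi> x)" "AE x in M. norm (\<xi> x) \<le> 1 * norm (\<eta> x)"
    using assms(3) by auto
  show 2: "\<eta> \<in> L2 M" using L2_dominated(1)[OF assms(1,2) _ 1(1)] by simp
  show "L2_nrm M \<eta> = L2_nrm M \<xi>"
    using L2_dominated(2)[OF assms(1,2) _ 1(1)] L2_dominated(2)[OF 2 L2_measurable[OF assms(1)] _ 1(2)] by simp
qed

lemma L2_mult_bounded:
  assumes "\<xi> \<in> L2 M" "g \<in> borel_measurable M" "\<And>x. norm (g x) \<le> C"
  shows "(\<lambda>x. g x * \<xi> x) \<in> L2 M" "L2_nrm M (\<lambda>x. g x * \<xi> x) \<le> C * L2_nrm M \<xi>"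
proof -
  have C: "C \<ge> 0" using assms(3)[of undefined] norm_ge_zero order_trans by blast
  have m: "(\<lambda>x. g x * \<xi> x) \<in> borel_measurable M" using assms L2_measurable[OF assms(1)] by simp
  have le: "AE x in M. norm (g x * \<xi> x) \<le> C * norm (\<xi> x)"
    using assms(3) by (auto simp: norm_mult intro!: mult_right_mono)
  show "(\<lambda>x. g x * \<xi> x) \<in> L2 M" "L2_nrm M (\<lambda>x. g x * \<xi> x) \<le> C * L2_nrm M \<xi>"
    by (rule L2_dominated[OF assms(1) m C le])+
qed

lemma L2_scale: "\<xi> \<in> L2 M \<Longrightarrow> (\<lambda>x. c * \<xi> x) \<in> L2 M"
  using L2_mult_bounded(1)[of \<xi> M "\<lambda>_. c" "norm c"] by simp

lemma L2_nrm_scale: "L2_nrm M (\<lambda>x. c * \<xi> x) = norm c * L2_nrm M \<xi>"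
  by (simp add: L2_nrm_def norm_mult power_mult_distrib real_sqrt_mult)

lemma L2_cnj: "\<xi> \<in> L2 M \<Longrightarrow> (\<lambda>x. cnj (\<xi> x)) \<in> L2 M"
  by (rule L2_dominated(1)[of \<xi> M _ 1]) (auto intro: borel_measurable_cnj_compose L2_measurable)

lemma L2_nrm_cnj: "L2_nrm M (\<lambda>x. cnj (\<xi> x)) = L2_nrm M \<xi>"
  by (simp add: L2_nrm_def)

lemma L2_add: 
  assumes "\<xi> \<in> L2 M" "\<eta> \<in> L2 M" shows "(\<lambda>x. \<xi> x + \<eta> x) \<in> L2 M"
proof -
  have i: "integrable M (\<lambda>x. 2 * (norm (\<xi> x))\<^sup>2 + 2 * (norm (\<eta> x))\<^sup>2)"
    using assms by (auto dest!: L2_integrable_square)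
  have le: "norm ((norm (\<xi> x + \<eta> x))\<^sup>2) \<le> norm (2 * (norm (\<xi> x))\<^sup>2 + 2 * (norm (\<eta> x))\<^sup>2)" for x
  proof -
    have "(norm (\<xi> x + \<eta> x))\<^sup>2 \<le> (norm (\<xi> x) + norm (\<eta> x))\<^sup>2"
      by (intro power_mono norm_triangle_ineq) auto
    also have "\<dots> \<le> 2 * (norm (\<xi> x))\<^sup>2 + 2 * (norm (\<eta> x))\<^sup>2"
      using sum_squares_ge_zero[of "norm (\<xi> x) - norm (\<eta> x)" 0] by (simp add: power2_eq_square algebra_simps)
    finally show ?thesis by simp
  qed
  note [measurable] = assms[THEN L2_measurable]
  have "integrable M (\<lambda>x. (norm (\<xi> x + \<eta> x))\<^sup>2)"
    by (rule Bochner_Integration.integrable_bound[OF i _ AE_I2[OF le]]) measurable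
  then show ?thesis by (simp add: L2_def)
qed

lemma L2_diff: "\<xi> \<in> L2 M \<Longrightarrow> \<eta> \<in> L2 M \<Longrightarrow> (\<lambda>x. \<xi> x - \<eta> x) \<in> L2 M"
  using L2_add[of \<xi> M "\<lambda>x. (-1) * \<eta> x"] L2_scale[of \<eta> M "-1"] by simp

lemma L2_zero: "(\<lambda>x. 0) \<in> L2 M"
  by (simp add: L2_def)

lemma L2_nrm_zero [simp]: "L2_nrm M (\<lambda>x. 0) = 0"
  by (simp add: L2_nrm_def)

lemma L2_nrm_eq_0: 
  assumes "\<xi> \<in> L2 M" shows "L2_nrm M \<xi> = 0 \<longleftrightarrow> (AE x in M. \<xi> x = 0)"
  using integral_nonneg_eq_0_iff_AE[OF L2_integrable_square[OF assms]] by (simp add: L2_nrm_def)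

lemma L2_integrable_mult:
  assumes "\<xi> \<in> L2 M" "\<eta> \<in> L2 M" shows "integrable M (\<lambda>x. \<xi> x * \<eta> x)"
proof -
  have "integrable M (\<lambda>x. (norm (\<xi> x))\<^sup>2 + (norm (\<eta> x))\<^sup>2)"
    using assms by (auto dest!: L2_integrable_square)
  then show ?thesis
  proof (rule Bochner_Integration.integrable_bound)
    show "AE x in M. norm (\<xi> x * \<eta> x) \<le> norm ((norm (\<xi> x))\<^sup>2 + (norm (\<eta> x))\<^sup>2)"
    proof (rule AE_I2)
      fix x
      have "2 * (norm (\<xi> x) * norm (\<eta> x)) \<le> (norm (\<xi> x))\<^sup>2 + (norm (\<eta> x))\<^sup>2"
        using sum_squares_bound[of "norm (\<xi> x)" "norm (\<eta> x)"] by simp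
      moreover have "0 \<le> norm (\<xi> x) * norm (\<eta> x)" by simp
      ultimately show "norm (\<xi> x * \<eta> x) \<le> norm ((norm (\<xi> x))\<^sup>2 + (norm (\<eta> x))\<^sup>2)"
        unfolding norm_mult real_norm_def by linarith
    qed
  qed (intro borel_measurable_times L2_measurable assms)
qed

lemma L2_Cauchy_Schwarz_norm:
  assumes \<xi>: "\<xi> \<in> L2 M" and \<eta>: "\<eta> \<in> L2 M"
  shows "(LINT x|M. norm (\<xi> x * \<eta> x)) \<le> L2_nrm M \<xi> * L2_nrm M \<eta>"
proof -
  define a b where "a = L2_nrm M \<xi>" and "b = L2_nrm M \<eta>"
  have i: "integrable M (\<lambda>x. norm (\<xi> x * \<eta> x))" using L2_integrable_mult[OF assms] by simp
  show ?thesis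
  proof (cases "a = 0 \<or> b = 0")
    case True
    then have "AE x in M. norm (\<xi> x * \<eta> x) = 0"
      using L2_nrm_eq_0[OF \<xi>] L2_nrm_eq_0[OF \<eta>] by (auto simp: a_def b_def)
    then have "(LINT x|M. norm (\<xi> x * \<eta> x)) = (LINT x|M. 0)"
      using i by (intro integral_cong_AE) auto
    then show ?thesis by simp
  next
    case False
    then have ab: "a > 0" "b > 0" by (auto simp: a_def b_def less_le)
    have j: "integrable M (\<lambda>x. (b / (2 * a)) * (norm (\<xi> x))\<^sup>2 + (a / (2 * b)) * (norm (\<eta> x))\<^sup>2)"
      using assms by (auto dest!: L2_integrable_square)
    have "(LINT x|M. norm (\<xi> x * \<eta> x))
      \<le> (LINT x|M. (b / (2 * a)) * (norm (\<xi> x))\<^sup>2 + (a / (2 * b)) * (norm (\<eta> x))\<^sup>2)"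
    proof (rule integral_mono[OF i j])
      fix x
      have "0 \<le> (b * norm (\<xi> x) - a * norm (\<eta> x))\<^sup>2 / (2 * a * b)" using ab by simp
      also have "\<dots> = (b / (2 * a)) * (norm (\<xi> x))\<^sup>2 + (a / (2 * b)) * (norm (\<eta> x))\<^sup>2 - norm (\<xi> x * \<eta> x)"
        using ab by (simp add: norm_mult field_simps power2_eq_square)
      finally show "norm (\<xi> x * \<eta> x) \<le> (b / (2 * a)) * (norm (\<xi> x))\<^sup>2 + (a / (2 * b)) * (norm (\<eta> x))\<^sup>2"
        by simp
    qed
    also have "\<dots> = (b / (2 * a)) * a\<^sup>2 + (a / (2 * b)) * b\<^sup>2"
      using assms by (simp add: a_def b_def L2_nrm_square L2_integrable_square)
    also have "\<dots> = a * b" using ab by (simp add: field_simps power2_eq_square)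
    finally show ?thesis by (simp add: a_def b_def)
  qed
qed

lemma L2_Cauchy_Schwarz:
  assumes "\<xi> \<in> L2 M" "\<eta> \<in> L2 M"
  shows "norm (LINT x|M. \<xi> x * \<eta> x) \<le> L2_nrm M \<xi> * L2_nrm M \<eta>"
  using integral_norm_bound[of M "\<lambda>x. \<xi> x * \<eta> x"] L2_Cauchy_Schwarz_norm[OF assms] by linarith

lemma L2_triangle:
  assumes \<xi>: "\<xi> \<in> L2 M" and \<eta>: "\<eta> \<in> L2 M"
  shows "L2_nrm M (\<lambda>x. \<xi> x + \<eta> x) \<le> L2_nrm M \<xi> + L2_nrm M \<eta>"
proof (rule power2_le_imp_le)
  have i: "integrable M (\<lambda>x. norm (\<xi> x * \<eta> x))" using L2_integrable_mult[OF assms] by simp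
  have "(L2_nrm M (\<lambda>x. \<xi> x + \<eta> x))\<^sup>2 \<le> (LINT x|M. (norm (\<xi> x))\<^sup>2 + (norm (\<eta> x))\<^sup>2 + 2 * norm (\<xi> x * \<eta> x))"
    unfolding L2_nrm_square
  proof (rule integral_mono)
    show "(norm (\<xi> x + \<eta> x))\<^sup>2 \<le> (norm (\<xi> x))\<^sup>2 + (norm (\<eta> x))\<^sup>2 + 2 * norm (\<xi> x * \<eta> x)" for x
      using power_mono[OF norm_triangle_ineq[of "\<xi> x" "\<eta> x"], of 2]
      by (simp add: power2_sum norm_mult mult.assoc)
  qed (use i L2_integrable_square[OF L2_add[OF assms]] assms[THEN L2_integrable_square] in auto)
  also have "\<dots> = (L2_nrm M \<xi>)\<^sup>2 + (L2_nrm M \<eta>)\<^sup>2 + 2 * (LINT x|M. norm (\<xi> x * \<eta> x))"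
    using i assms[THEN L2_integrable_square] by (simp add: L2_nrm_square)
  also have "\<dots> \<le> (L2_nrm M \<xi> + L2_nrm M \<eta>)\<^sup>2"
    using L2_Cauchy_Schwarz_norm[OF assms] by (simp add: power2_sum)
  finally show "(L2_nrm M (\<lambda>x. \<xi> x + \<eta> x))\<^sup>2 \<le> (L2_nrm M \<xi> + L2_nrm M \<eta>)\<^sup>2" .
qed simp

lemma L2_nrm_diff_commute: "L2_nrm M (\<lambda>x. \<xi> x - \<eta> x) = L2_nrm M (\<lambda>x. \<eta> x - \<xi> x)"
  by (simp add: L2_nrm_def norm_minus_commute)

lemma L2_triangle_diff:
  assumes "\<xi> \<in> L2 M" "\<eta> \<in> L2 M" "\<zeta> \<in> L2 M"
  shows "L2_nrm M (\<lambda>x. \<xi> x - \<zeta> x) \<le> L2_nrm M (\<lambda>x. \<xi> x - \<eta> x) + L2_nrm M (\<lambda>x. \<eta> x - \<zeta> x)"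
  using L2_triangle[OF L2_diff[OF assms(1,2)] L2_diff[OF assms(2,3)]] by simp

lemma L2_bounded:
  assumes "finite_measure M" "\<xi> \<in> borel_measurable M" "\<And>x. norm (\<xi> x) \<le> C"
  shows "\<xi> \<in> L2 M" "L2_nrm M \<xi> \<le> C * sqrt (measure M (space M))"
proof -
  interpret finite_measure M by fact
  have 1: "(\<lambda>x. 1) \<in> L2 M" by (simp add: L2_def)
  have "L2_nrm M (\<lambda>x. 1) = sqrt (measure M (space M))" by (simp add: L2_nrm_def)
  then show "\<xi> \<in> L2 M" "L2_nrm M \<xi> \<le> C * sqrt (measure M (space M))"
    using L2_mult_bounded[OF 1 assms(2,3)] by simp_all
qed

text \<open>
  Along a subsequence whose increments are at most \<open>2^(-k)\<close> the sum of the increments is integrable, so the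
  subsequence converges almost everywhere, and Fatou's lemma transfers the Cauchy estimates to the limit.
\<close>
theorem L2_complete:
  assumes M: "finite_measure M" and \<xi>: "\<And>n. \<xi> n \<in> L2 M"
    and cauchy: "\<And>\<epsilon>. \<epsilon> > 0 \<Longrightarrow> \<exists>N. \<forall>m\<ge>N. \<forall>n\<ge>N. L2_nrm M (\<lambda>x. \<xi> m x - \<xi> n x) < \<epsilon>"
  obtains \<eta> where "\<eta> \<in> L2 M" "(\<lambda>n. L2_nrm M (\<lambda>x. \<xi> n x - \<eta> x)) \<longlonglongrightarrow> 0"
proof -
  interpret finite_measure M by fact
  have [measurable]: "\<And>n. \<xi> n \<in> borel_measurable M" by (rule L2_measurable[OF \<xi>])
  have "\<exists>N. \<forall>k. (\<forall>m\<ge>N k. \<forall>n\<ge>N k. L2_nrm M (\<lambda>x. \<xi> m x - \<xi> n x) < (1 / 2) ^ k)"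
    using cauchy by (intro choice allI) simp
  then obtain N where N: "\<And>k m n. m \<ge> N k \<Longrightarrow> n \<ge> N k \<Longrightarrow> L2_nrm M (\<lambda>x. \<xi> m x - \<xi> n x) < (1 / 2) ^ k"
    by blast
  \<comment> \<open>summing makes the indices monotone while keeping \<open>r k \<ge> N k\<close>\<close>
  define r where "r k = (\<Sum>j\<le>k. N j)" for k
  have rN: "r j \<ge> N k" if "j \<ge> k" for j k
    unfolding r_def using that by (intro member_le_sum) auto
  define D where "D k x = norm (\<xi> (r (Suc k)) x - \<xi> (r k) x)" for k x
  have [measurable]: "D k \<in> borel_measurable M" for k unfolding D_def by measurable
  have d2: "(\<lambda>x. \<xi> m x - \<xi> n x) \<in> L2 M" for m n by (intro L2_diff \<xi>)
  have one: "(\<lambda>x. 1) \<in> L2 M" by (simp add: L2_def)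
  define C where "C = L2_nrm M (\<lambda>x. 1)"
  have C: "C \<ge> 0" by (simp add: C_def)
  have iD: "integrable M (D k)" for k
    using L2_integrable_mult[OF d2 one, of "r (Suc k)" "r k"] unfolding D_def by simp
  have D_le: "(LINT x|M. D k x) \<le> C * (1 / 2) ^ k" for k
  proof -
    have "(LINT x|M. D k x) \<le> L2_nrm M (\<lambda>x. \<xi> (r (Suc k)) x - \<xi> (r k) x) * C"
      using L2_Cauchy_Schwarz_norm[OF d2 one, of "r (Suc k)" "r k"] unfolding D_def C_def by simp
    also have "\<dots> \<le> (1 / 2) ^ k * C"
      by (intro mult_right_mono less_imp_le[OF N] rN C) auto
    finally show ?thesis by (simp add: mult.commute)
  qed
  have "(\<integral>\<^sup>+x. (\<Sum>k. ennreal (D k x)) \<partial>M) = (\<Sum>k. \<integral>\<^sup>+x. ennreal (D k x) \<partial>M)"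
    by (rule nn_integral_suminf) measurable
  also have "\<dots> = (\<Sum>k. ennreal (LINT x|M. D k x))"
    by (intro suminf_cong nn_integral_eq_integral iD) (simp add: D_def)
  also have "\<dots> \<le> (\<Sum>k. ennreal (C * (1 / 2) ^ k))"
    by (intro suminf_le ennreal_leI D_le) auto
  also have "\<dots> = ennreal (\<Sum>k. C * (1 / 2) ^ k)"
    using C by (intro suminf_ennreal2) (auto intro!: summable_mult summable_geometric)
  also have "\<dots> < \<infinity>" by simp
  finally have "AE x in M. (\<Sum>k. ennreal (D k x)) \<noteq> \<infinity>"
    by (intro nn_integral_PInf_AE) auto
  then have conv: "AE x in M. convergent (\<lambda>k. \<xi> (r k) x)"
  proof eventually_elim
    case (elim x)
    have "summable (\<lambda>k. D k x)" using elim by (intro summable_suminf_not_top) (auto simp: D_def)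
    then have "summable (\<lambda>k. \<xi> (r (Suc k)) x - \<xi> (r k) x)"
      unfolding D_def by (rule summable_norm_cancel)
    from summable_LIMSEQ[OF this]
    have "convergent (\<lambda>n. \<xi> (r n) x - \<xi> (r 0) x)"
      by (auto simp: sum_lessThan_telescope[of "\<lambda>k. \<xi> (r k) x"] convergent_def)
    from convergent_add[OF this convergent_const[of "\<xi> (r 0) x"]] show ?case by simp
  qed
  define \<eta> where "\<eta> x = lim (\<lambda>k. \<xi> (r k) x)" for x
  have [measurable]: "\<eta> \<in> borel_measurable M" unfolding \<eta>_def by measurable
  have lim: "AE x in M. (\<lambda>k. \<xi> (r k) x) \<longlonglongrightarrow> \<eta> x"
    using conv by eventually_elim (simp add: \<eta>_def convergent_LIMSEQ_iff)
  have bound: "(\<lambda>x. \<xi> m x - \<eta> x) \<in> L2 M \<and> L2_nrm M (\<lambda>x. \<xi> m x - \<eta> x) \<le> (1 / 2) ^ k" if m: "m \<ge> N k" for m k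
  proof -
    have "(\<integral>\<^sup>+x. ennreal ((norm (\<xi> m x - \<eta> x))\<^sup>2) \<partial>M)
      = (\<integral>\<^sup>+x. liminf (\<lambda>j. ennreal ((norm (\<xi> m x - \<xi> (r j) x))\<^sup>2)) \<partial>M)"
    proof (rule nn_integral_cong_AE, use lim in eventually_elim)
      fix x assume "(\<lambda>k. \<xi> (r k) x) \<longlonglongrightarrow> \<eta> x"
      then have "(\<lambda>j. ennreal ((norm (\<xi> m x - \<xi> (r j) x))\<^sup>2)) \<longlonglongrightarrow> ennreal ((norm (\<xi> m x - \<eta> x))\<^sup>2)"
        by (intro tendsto_intros)
      then show "ennreal ((norm (\<xi> m x - \<eta> x))\<^sup>2) = liminf (\<lambda>j. ennreal ((norm (\<xi> m x - \<xi> (r j) x))\<^sup>2))"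
        by (rule lim_imp_Liminf[OF sequentially_bot, symmetric])
    qed
    also have "\<dots> \<le> liminf (\<lambda>j. \<integral>\<^sup>+x. ennreal ((norm (\<xi> m x - \<xi> (r j) x))\<^sup>2) \<partial>M)"
      by (rule nn_integral_liminf) measurable
    also have "\<dots> \<le> liminf (\<lambda>j. ennreal (((1 / 2) ^ k)\<^sup>2))"
    proof (rule Liminf_mono, rule eventually_sequentiallyI)
      fix j assume j: "k \<le> j"
      have "(\<integral>\<^sup>+x. ennreal ((norm (\<xi> m x - \<xi> (r j) x))\<^sup>2) \<partial>M) = ennreal ((L2_nrm M (\<lambda>x. \<xi> m x - \<xi> (r j) x))\<^sup>2)"
        unfolding L2_nrm_square by (intro nn_integral_eq_integral L2_integrable_square d2) auto
      also have "\<dots> \<le> ennreal (((1 / 2) ^ k)\<^sup>2)"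
        by (intro ennreal_leI power_mono less_imp_le[OF N] m rN j) auto
      finally show "(\<integral>\<^sup>+x. ennreal ((norm (\<xi> m x - \<xi> (r j) x))\<^sup>2) \<partial>M) \<le> ennreal (((1 / 2) ^ k)\<^sup>2)" .
    qed
    also have "\<dots> = ennreal (((1 / 2) ^ k)\<^sup>2)" by (simp add: Liminf_const)
    finally have le: "(\<integral>\<^sup>+x. ennreal ((norm (\<xi> m x - \<eta> x))\<^sup>2) \<partial>M) \<le> ennreal (((1 / 2) ^ k)\<^sup>2)" .
    have i: "integrable M (\<lambda>x. (norm (\<xi> m x - \<eta> x))\<^sup>2)"
      using le by (intro integrableI_nonneg) (auto simp: le_less_trans ennreal_less_top)
    have "(L2_nrm M (\<lambda>x. \<xi> m x - \<eta> x))\<^sup>2 \<le> ((1 / 2) ^ k)\<^sup>2"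
      using le unfolding L2_nrm_square by (subst (asm) nn_integral_eq_integral[OF i]) (auto simp: ennreal_le_iff)
    then show ?thesis using i by (auto simp: L2_def intro: power2_le_imp_le)
  qed
  have "\<eta> \<in> L2 M"
    using L2_diff[OF \<xi>[of "N 0"] conjunct1[OF bound[of 0 "N 0"]]] by simp
  moreover have "(\<lambda>n. L2_nrm M (\<lambda>x. \<xi> n x - \<eta> x)) \<longlonglongrightarrow> 0"
  proof (rule LIMSEQ_I)
    fix e :: real assume "e > 0"
    then obtain k where "(1 / 2) ^ k < e" using real_arch_pow_inv[of e "1/2"] by auto
    then show "\<exists>no. \<forall>n\<ge>no. norm (L2_nrm M (\<lambda>x. \<xi> n x - \<eta> x) - 0) < e"
      using bound by (intro exI[of _ "N k"]) (auto intro: le_less_trans)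
  qed
  ultimately show ?thesis by (rule that)
qed

text \<open>
  The family need not be normalised: bounded by \<open>1\<close> on a finite measure space, its members have square norm at
  most \<open>m\<close>, and the usual argument bounds the sum of the squared coefficients by \<open>m\<close> times the square norm of \<open>G\<close>.
\<close>
lemma Bessel:
  assumes M: "finite_measure M" and G: "G \<in> L2 M"
    and e: "\<And>i. i \<in> I \<Longrightarrow> e i \<in> borel_measurable M" "\<And>i x. i \<in> I \<Longrightarrow> norm (e i x) \<le> 1"
    and orth: "\<And>i j. i \<in> I \<Longrightarrow> j \<in> I \<Longrightarrow> i \<noteq> j \<Longrightarrow> (LINT x|M. e i x * cnj (e j x)) = 0"
    and \<epsilon>: "\<epsilon> > 0"
  shows "finite {i \<in> I. \<epsilon> \<le> norm (LINT x|M. G x * cnj (e i x))}"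
proof -
  interpret finite_measure M by fact
  define a where "a i = (LINT x|M. G x * cnj (e i x))" for i
  define m where "m = measure M (space M)"
  have eL2: "e i \<in> L2 M" if "i \<in> I" for i using L2_bounded[OF M e[OF that]] by simp
  have m0: "m \<ge> 0" by (simp add: m_def)
  define B where "B = m * (L2_nrm M G)\<^sup>2"
  have fin: "(\<Sum>i\<in>F. (norm (a i))\<^sup>2) \<le> B" if F: "finite F" "F \<subseteq> I" for F
  proof -
    define S where "S = (\<Sum>i\<in>F. (norm (a i))\<^sup>2)"
    define P where "P x = (\<Sum>i\<in>F. a i * e i x)" for x
    have PL2: "P \<in> L2 M" unfolding P_def using F
    proof (induction F rule: finite_induct)
      case (insert j F)
      have "(\<lambda>x. a j * e j x) \<in> L2 M" using insert by (intro L2_scale eL2) auto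
      from L2_add[OF this, of "\<lambda>x. \<Sum>i\<in>F. a i * e i x"] show ?case using insert by simp
    qed (simp add: L2_zero)
    have ie: "integrable M (\<lambda>x. e i x * cnj (e j x))" if "i \<in> F" "j \<in> F" for i j
      using that F by (intro L2_integrable_mult L2_cnj eL2) auto
    have "complex_of_real ((L2_nrm M P)\<^sup>2) = (LINT x|M. P x * cnj (P x))"
      by (simp only: L2_nrm_square complex_norm_square[symmetric] integral_complex_of_real)
    also have "\<dots> = (LINT x|M. (\<Sum>i\<in>F. \<Sum>j\<in>F. (a i * cnj (a j)) * (e i x * cnj (e j x))))"
      by (simp add: P_def sum_product mult_ac)
    also have "\<dots> = (\<Sum>i\<in>F. \<Sum>j\<in>F. (a i * cnj (a j)) * (LINT x|M. e i x * cnj (e j x)))"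
      by (subst Bochner_Integration.integral_sum)
         (auto intro!: Bochner_Integration.integrable_sum ie sum.cong integrable_mult_right simp: Bochner_Integration.integral_sum ie)
    also have "\<dots> = (\<Sum>i\<in>F. \<Sum>j\<in>F. if j = i then (a i * cnj (a i)) * (LINT x|M. e i x * cnj (e i x)) else 0)"
      using F orth by (intro sum.cong refl) auto
    also have "\<dots> = (\<Sum>i\<in>F. (a i * cnj (a i)) * (LINT x|M. e i x * cnj (e i x)))"
      using F by simp
    finally have "(L2_nrm M P)\<^sup>2 = norm (\<Sum>i\<in>F. (a i * cnj (a i)) * (LINT x|M. e i x * cnj (e i x)))"
      by (metis abs_norm_cancel abs_of_nonneg norm_of_real zero_le_power2)
    also have "\<dots> \<le> (\<Sum>i\<in>F. (norm (a i))\<^sup>2 * m)"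
    proof (rule sum_norm_le)
      fix i assume i: "i \<in> F"
      have "norm (LINT x|M. e i x * cnj (e i x)) \<le> (LINT x|M. norm (e i x * cnj (e i x)))"
        by (rule integral_norm_bound)
      also have "\<dots> \<le> (LINT x|M. 1)"
        using i F e(2) by (intro integral_mono integrable_norm ie) (auto simp: norm_mult intro!: mult_le_one)
      also have "\<dots> = m" by (simp add: m_def)
      finally show "norm ((a i * cnj (a i)) * (LINT x|M. e i x * cnj (e i x))) \<le> (norm (a i))\<^sup>2 * m"
        by (simp add: norm_mult power2_eq_square mult_left_mono)
    qed
    also have "\<dots> = m * S" by (simp add: S_def sum_distrib_left mult.commute)
    finally have P_le: "(L2_nrm M P)\<^sup>2 \<le> m * S" .
    have "complex_of_real S = (\<Sum>i\<in>F. cnj (a i) * a i)"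
      unfolding S_def of_real_sum complex_norm_square by (simp add: mult.commute)
    also have "\<dots> = (LINT x|M. (\<Sum>i\<in>F. cnj (a i) * (G x * cnj (e i x))))"
      unfolding a_def using F
      by (subst Bochner_Integration.integral_sum) (auto intro!: integrable_mult_right L2_integrable_mult G L2_cnj eL2)
    also have "\<dots> = (LINT x|M. G x * cnj (P x))"
      by (simp add: P_def sum_distrib_left mult_ac)
    finally have "S \<le> norm (LINT x|M. G x * cnj (P x))"
      by (metis norm_of_real abs_ge_self)
    also have "\<dots> \<le> L2_nrm M G * L2_nrm M (\<lambda>x. cnj (P x))"
      by (rule L2_Cauchy_Schwarz[OF G L2_cnj[OF PL2]])
    finally have "S \<le> L2_nrm M G * L2_nrm M P" by (simp add: L2_nrm_cnj)
    moreover have S0: "S \<ge> 0" unfolding S_def by (intro sum_nonneg) auto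
    ultimately have "S\<^sup>2 \<le> (L2_nrm M G)\<^sup>2 * (L2_nrm M P)\<^sup>2"
      by (metis power_mono power_mult_distrib)
    also have "\<dots> \<le> (L2_nrm M G)\<^sup>2 * (m * S)" by (intro mult_left_mono P_le) auto
    finally have "S * S \<le> B * S" by (simp add: B_def power2_eq_square mult_ac)
    moreover have "B \<ge> 0" using m0 by (simp add: B_def)
    ultimately show ?thesis using S0 by (cases "S = 0") (auto simp: S_def[symmetric])
  qed
  show ?thesis
  proof (rule ccontr)
    assume "infinite {i \<in> I. \<epsilon> \<le> norm (LINT x|M. G x * cnj (e i x))}"
    moreover obtain n :: nat where n: "B < real n * \<epsilon>\<^sup>2" using reals_Archimedean3[of "\<epsilon>\<^sup>2"] \<epsilon> by auto
    ultimately obtain F where F: "finite F" "card F = n" "F \<subseteq> {i \<in> I. \<epsilon> \<le> norm (a i)}"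
      unfolding a_def[symmetric] by (meson infinite_arbitrarily_large)
    have "real n * \<epsilon>\<^sup>2 = (\<Sum>i\<in>F. \<epsilon>\<^sup>2)" using F by simp
    also have "\<dots> \<le> (\<Sum>i\<in>F. (norm (a i))\<^sup>2)"
      using F(3) \<epsilon> by (intro sum_mono power_mono) auto
    also have "\<dots> \<le> B" using F by (intro fin) auto
    finally show False using n by simp
  qed
qed

section \<open>Haar measure and convolution\<close>

lemma measurable_group_diff [measurable (raw)]:
  fixes f g :: "'b \<Rightarrow> 'a::{topological_ab_group_add, second_countable_topology}"
  assumes "f \<in> borel_measurable N" "g \<in> borel_measurable N"
  shows "(\<lambda>x. f x - g x) \<in> borel_measurable N"
  by (rule borel_measurable_continuous_Pair[OF assms]) (intro continuous_intros)

lemma measurable_group_add [measurable (raw)]: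
  fixes f g :: "'b \<Rightarrow> 'a::{topological_ab_group_add, second_countable_topology}"
  assumes "f \<in> borel_measurable N" "g \<in> borel_measurable N"
  shows "(\<lambda>x. f x + g x) \<in> borel_measurable N"
  by (rule borel_measurable_continuous_Pair[OF assms]) (intro continuous_intros)

lemma measurable_group_uminus [measurable (raw)]:
  fixes f :: "'b \<Rightarrow> 'a::{topological_ab_group_add, second_countable_topology}"
  assumes "f \<in> borel_measurable N"
  shows "(\<lambda>x. - f x) \<in> borel_measurable N"
  using measurable_group_diff[of "\<lambda>_. 0" N f] assms by simp

locale compact_haar =
  fixes \<mu> :: "'a::{topological_ab_group_add, t2_space, second_countable_topology} measure"
  assumes compact_UNIV: "compact (UNIV :: 'a set)" and haar: "haar_measure \<mu>"
begin

lemma sets_mu [simp, measurable_cong]: "sets \<mu> = sets borel"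
  using haar by (simp add: haar_measure_def)

lemma measurable_mu [simp]: "measurable \<mu> N = measurable borel N"
  by (rule measurable_cong_sets) simp_all

lemma space_mu [simp]: "space \<mu> = UNIV"
  using sets_eq_imp_space_eq[OF sets_mu] by simp

sublocale finite_measure \<mu>
proof
  show "emeasure \<mu> (space \<mu>) \<noteq> \<infinity>"
    using haar compact_UNIV by (auto simp: haar_measure_def)
qed

sublocale square: pair_sigma_finite \<mu> \<mu> ..

sublocale square: finite_measure "\<mu> \<Otimes>\<^sub>M \<mu>"
  by (rule finite_measure_pair_measure) unfold_locales

definition total :: real where "total = measure \<mu> UNIV"

lemma total_pos: "total > 0"
proof -
  have "emeasure \<mu> UNIV \<noteq> 0" using haar by (simp add: haar_measure_def)
  then have "measure \<mu> UNIV \<noteq> 0" by (simp add: emeasure_eq_measure)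
  then show ?thesis by (simp add: total_def less_le)
qed

lemma distr_translate: "distr \<mu> borel (\<lambda>x. a + x) = \<mu>"
proof (rule measure_eqI)
  fix A assume "A \<in> sets (distr \<mu> borel (\<lambda>x. a + x))"
  then have A: "A \<in> sets borel" by simp
  have "(\<lambda>x. a + x) -` A = (+) (- a) ` A"
  proof (intro set_eqI iffI)
    fix x assume "x \<in> (\<lambda>x. a + x) -` A"
    then have "- a + (a + x) \<in> (+) (- a) ` A" by (intro imageI) simp
    then show "x \<in> (+) (- a) ` A" by (simp flip: add.assoc)
  qed (auto simp flip: add.assoc)
  note vimage = this
  have "emeasure (distr \<mu> borel (\<lambda>x. a + x)) A = emeasure \<mu> ((\<lambda>x. a + x) -` A \<inter> space \<mu>)"
    by (rule emeasure_distr) (use A in auto)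
  also have "\<dots> = emeasure \<mu> ((+) (- a) ` A)" by (simp only: vimage space_mu Int_UNIV_right)
  also have "\<dots> = emeasure \<mu> A" using haar A unfolding haar_measure_def by blast
  finally show "emeasure (distr \<mu> borel (\<lambda>x. a + x)) A = emeasure \<mu> A" .
qed simp

lemma nn_integral_translate:
  "f \<in> borel_measurable borel \<Longrightarrow> (\<integral>\<^sup>+x. f (a + x) \<partial>\<mu>) = (\<integral>\<^sup>+x. f x \<partial>\<mu>)"
  by (subst (2) distr_translate[symmetric, of a]) (simp add: nn_integral_distr)

text \<open>
  Integrating \<open>f (y - x)\<close> over both variables in either order gives the total mass times the integral of \<open>f\<close>
  respectively of its reflection.
\<close>
lemma nn_integral_reflect:
  assumes [measurable]: "f \<in> borel_measurable borel"
  shows "(\<integral>\<^sup>+x. f (- x) \<partial>\<mu>) = (\<integral>\<^sup>+x. f x \<partial>\<mu>)"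
proof -
  have "(\<integral>\<^sup>+x. (\<integral>\<^sup>+y. f (y - x) \<partial>\<mu>) \<partial>\<mu>) = (\<integral>\<^sup>+y. (\<integral>\<^sup>+x. f (y - x) \<partial>\<mu>) \<partial>\<mu>)"
    by (rule square.Fubini') simp
  moreover have "(\<integral>\<^sup>+y. f (y - x) \<partial>\<mu>) = (\<integral>\<^sup>+x. f x \<partial>\<mu>)" for x
    using nn_integral_translate[of f "- x"] by simp
  moreover have "(\<integral>\<^sup>+x. f (y - x) \<partial>\<mu>) = (\<integral>\<^sup>+x. f (- x) \<partial>\<mu>)" for y
    using nn_integral_translate[of "\<lambda>x. f (- x)" "- y"] by (simp add: algebra_simps)
  moreover have "emeasure \<mu> UNIV \<noteq> 0" "emeasure \<mu> UNIV \<noteq> \<infinity>"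
    using haar by (auto simp: haar_measure_def emeasure_eq_measure)
  ultimately show ?thesis
    by (simp add: mult.commute[of _ "emeasure \<mu> UNIV"] ennreal_mult_cancel_left)
qed

lemma distr_reflect: "distr \<mu> borel (\<lambda>x. a - x) = \<mu>"
proof (rule measure_eqI)
  fix A assume "A \<in> sets (distr \<mu> borel (\<lambda>x. a - x))"
  then have A[measurable]: "A \<in> sets borel" by simp
  have "emeasure (distr \<mu> borel (\<lambda>x. a - x)) A = (\<integral>\<^sup>+x. indicator A (a - x) \<partial>\<mu>)"
    using nn_integral_distr[of "\<lambda>x. a - x" \<mu> borel "indicator A :: 'a \<Rightarrow> ennreal"] by simp
  also have "\<dots> = (\<integral>\<^sup>+x. indicator A (a + x) \<partial>\<mu>)"
    using nn_integral_reflect[of "\<lambda>x. indicator A (a + x)"] by simp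
  also have "\<dots> = (\<integral>\<^sup>+x. indicator A x \<partial>\<mu>)"
    by (rule nn_integral_translate) simp
  finally show "emeasure (distr \<mu> borel (\<lambda>x. a - x)) A = emeasure \<mu> A" by simp
qed simp

lemma integral_translate:
  fixes f :: "'a \<Rightarrow> 'b::{banach, second_countable_topology}"
  assumes "f \<in> borel_measurable borel" 
  shows "(LINT x|\<mu>. f (a + x)) = (LINT x|\<mu>. f x)"
    and "(LINT x|\<mu>. f (x + a)) = (LINT x|\<mu>. f x)"
    and "(LINT x|\<mu>. f (x - a)) = (LINT x|\<mu>. f x)"
proof -
  show *: "(LINT x|\<mu>. f (a + x)) = (LINT x|\<mu>. f x)" for a
    using assms by (subst (2) distr_translate[symmetric, of a]) (simp add: integral_distr)
  show "(LINT x|\<mu>. f (x + a)) = (LINT x|\<mu>. f x)" using *[of a] by (simp add: add.commute)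
  show "(LINT x|\<mu>. f (x - a)) = (LINT x|\<mu>. f x)" using *[of "- a"] by simp
qed

lemma integral_reflect:
  fixes f :: "'a \<Rightarrow> 'b::{banach, second_countable_topology}"
  assumes "f \<in> borel_measurable borel" 
  shows "(LINT x|\<mu>. f (a - x)) = (LINT x|\<mu>. f x)"
  using assms by (subst (2) distr_reflect[symmetric, of a]) (simp add: integral_distr)

lemma integrable_translate:
  fixes f :: "'a \<Rightarrow> 'b::{banach, second_countable_topology}"
  assumes "integrable \<mu> f" shows "integrable \<mu> (\<lambda>x. f (x + a))"
proof -
  have "integrable \<mu> (\<lambda>x. f (a + x))"
    by (rule integrable_distr[of _ \<mu> borel]) (simp_all add: distr_translate assms)
  then show ?thesis by (simp add: add.commute)
qed

lemma AE_reflect: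
  assumes "AE x in \<mu>. P x" shows "AE x in \<mu>. P (a - x)"
proof -
  have "AE x in distr \<mu> borel (\<lambda>x. a - x). P x" using assms by (simp only: distr_reflect)
  then show ?thesis by (rule AE_distrD[rotated]) measurable
qed

text \<open>
  Lets relations modulo null sets on the group be used for kernels depending on \<open>x - y\<close>.
\<close>
lemma AE_square_diff:
  assumes "AE s in \<mu>. P s" shows "AE z in \<mu> \<Otimes>\<^sub>M \<mu>. P (fst z - snd z)"
proof -
  obtain N where N: "{x \<in> space \<mu>. \<not> P x} \<subseteq> N" "emeasure \<mu> N = 0" "N \<in> sets \<mu>"
    using AE_E[OF assms] by metis
  then have [measurable]: "N \<in> sets borel" by simp
  have "AE x in \<mu>. x \<notin> N" using N by (intro AE_not_in) auto
  then have "AE y in \<mu>. x - y \<notin> N" for x by (rule AE_reflect)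
  moreover have "{z \<in> space (\<mu> \<Otimes>\<^sub>M \<mu>). fst z - snd z \<notin> N} \<in> sets (\<mu> \<Otimes>\<^sub>M \<mu>)"
    by measurable
  ultimately have "AE z in \<mu> \<Otimes>\<^sub>M \<mu>. fst z - snd z \<notin> N"
    by (intro square.AE_pair_measure) auto
  then show ?thesis by eventually_elim (use N in auto)
qed

text \<open>
  A class of actual functions that is closed under the pointwise operations, translation and convolution,
  so that convolution identities hold everywhere rather than almost everywhere.
\<close>
definition bounded_borel :: "('a \<Rightarrow> complex) set"
  where "bounded_borel = {g \<in> borel_measurable borel. \<exists>C. \<forall>x. norm (g x) \<le> C}"

lemma bounded_borelI: "g \<in> borel_measurable borel \<Longrightarrow> (\<And>x. norm (g x) \<le> C) \<Longrightarrow> g \<in> bounded_borel"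
  by (auto simp: bounded_borel_def)

lemma bounded_borel_measurable [measurable_dest]: "g \<in> bounded_borel \<Longrightarrow> g \<in> borel_measurable borel"
  by (simp add: bounded_borel_def)

lemma bounded_borelE:
  assumes "g \<in> bounded_borel" obtains C where "C \<ge> 0" "\<And>x. norm (g x) \<le> C"
  using assms norm_ge_zero order_trans unfolding bounded_borel_def by blast

lemma bounded_borel_const: "(\<lambda>_. c) \<in> bounded_borel"
  by (rule bounded_borelI[where C = "norm c"]) auto

lemma bounded_borel_add: assumes "g \<in> bounded_borel" "h \<in> bounded_borel" shows "(\<lambda>x. g x + h x) \<in> bounded_borel"
proof -
  obtain C D where "\<And>x. norm (g x) \<le> C" "\<And>x. norm (h x) \<le> D" using assms by (metis bounded_borelE)
  then show ?thesis using assms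
    by (intro bounded_borelI[where C = "C + D"]) (auto simp: bounded_borel_measurable intro: norm_triangle_mono)
qed

lemma bounded_borel_mult: assumes "g \<in> bounded_borel" "h \<in> bounded_borel" shows "(\<lambda>x. g x * h x) \<in> bounded_borel"
proof -
  obtain C D where C: "C \<ge> 0" "\<And>x. norm (g x) \<le> C" and D: "\<And>x. norm (h x) \<le> D"
    using assms by (metis bounded_borelE)
  show ?thesis
    by (rule bounded_borelI[where C = "C * D"]) (use assms C D in \<open>auto simp: norm_mult bounded_borel_measurable intro!: mult_mono\<close>)
qed

lemma bounded_borel_scale: "g \<in> bounded_borel \<Longrightarrow> (\<lambda>x. c * g x) \<in> bounded_borel"
  by (rule bounded_borel_mult[OF bounded_borel_const])

lemma bounded_borel_diff: "g \<in> bounded_borel \<Longrightarrow> h \<in> bounded_borel \<Longrightarrow> (\<lambda>x. g x - h x) \<in> bounded_borel"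
  using bounded_borel_add[of g "\<lambda>x. (-1) * h x"] bounded_borel_scale[of h "-1"] by simp

lemma bounded_borel_cnj: "g \<in> bounded_borel \<Longrightarrow> (\<lambda>x. cnj (g x)) \<in> bounded_borel"
  unfolding bounded_borel_def by (auto intro: borel_measurable_cnj_compose)

lemma bounded_borel_compose: "g \<in> bounded_borel \<Longrightarrow> s \<in> borel_measurable borel \<Longrightarrow> (\<lambda>x. g (s x)) \<in> bounded_borel"
  unfolding bounded_borel_def by (auto intro: measurable_compose)

lemma bounded_borel_translate: "g \<in> bounded_borel \<Longrightarrow> (\<lambda>x. g (x + a)) \<in> bounded_borel"
  and bounded_borel_reflect: "g \<in> bounded_borel \<Longrightarrow> (\<lambda>x. g (a - x)) \<in> bounded_borel"
  and bounded_borel_uminus: "g \<in> bounded_borel \<Longrightarrow> (\<lambda>x. g (- x)) \<in> bounded_borel"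
  by (auto intro: bounded_borel_compose)

lemma bounded_borel_sum: "(\<And>i. i \<in> I \<Longrightarrow> g i \<in> bounded_borel) \<Longrightarrow> (\<lambda>x. \<Sum>i\<in>I. g i x) \<in> bounded_borel"
  by (induction I rule: infinite_finite_induct) (auto intro: bounded_borel_const bounded_borel_add)

lemma bounded_borel_continuous: assumes "continuous_on UNIV g" shows "g \<in> bounded_borel"
proof -
  have "bounded (range g)"
    by (rule compact_imp_bounded) (rule compact_continuous_image[OF assms compact_UNIV])
  then show ?thesis using assms
    by (auto simp: bounded_iff intro!: bounded_borelI borel_measurable_continuous_onI)
qed

lemma bounded_borel_L2: assumes "g \<in> bounded_borel" shows "g \<in> L2 \<mu>"
  using bounded_borelE[OF assms] L2_bounded(1)[OF finite_measure_axioms, of g] bounded_borel_measurable[OF assms]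
  by (metis measurable_mu)

lemma bounded_borel_integrable: assumes "g \<in> bounded_borel" shows "integrable \<mu> g"
  using assms by (auto simp: bounded_borel_def intro!: integrable_const_bound)

definition star :: "('a \<Rightarrow> complex) \<Rightarrow> 'a \<Rightarrow> complex"
  where "star g x = cnj (g (- x))"

definition conv :: "('a \<Rightarrow> complex) \<Rightarrow> ('a \<Rightarrow> complex) \<Rightarrow> 'a \<Rightarrow> complex"
  where "conv g h x = (LINT y|\<mu>. g (x - y) * h y)"

lemma star_star [simp]: "star (star g) = g"
  by (simp add: star_def fun_eq_iff)

lemma bounded_borel_star: "g \<in> bounded_borel \<Longrightarrow> star g \<in> bounded_borel"
  unfolding star_def by (intro bounded_borel_cnj bounded_borel_uminus)

lemma L2_nrm_reflect: "g \<in> bounded_borel \<Longrightarrow> L2_nrm \<mu> (\<lambda>y. g (a - y)) = L2_nrm \<mu> g"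
  unfolding L2_nrm_def by (subst integral_reflect) (auto simp: bounded_borel_measurable)

lemma L2_nrm_star: "g \<in> bounded_borel \<Longrightarrow> L2_nrm \<mu> (star g) = L2_nrm \<mu> g"
  using L2_nrm_reflect[of g 0] L2_nrm_cnj[of \<mu> "\<lambda>y. g (- y)"] by (simp add: star_def[abs_def])

lemma conv_integrable: "g \<in> bounded_borel \<Longrightarrow> h \<in> bounded_borel \<Longrightarrow> integrable \<mu> (\<lambda>y. g (x - y) * h y)"
  by (intro bounded_borel_integrable bounded_borel_mult bounded_borel_reflect)

lemma conv_le_L2: 
  assumes "g \<in> bounded_borel" "h \<in> bounded_borel" shows "norm (conv g h x) \<le> L2_nrm \<mu> g * L2_nrm \<mu> h"
  unfolding conv_def using L2_Cauchy_Schwarz[of "\<lambda>y. g (x - y)" \<mu> h] assms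
  by (simp add: bounded_borel_L2 bounded_borel_reflect L2_nrm_reflect)

lemma conv_le_sup:
  assumes g: "g \<in> bounded_borel" and h: "h \<in> bounded_borel" and C: "\<And>x. norm (g x) \<le> C"
  shows "norm (conv g h x) \<le> C * (LINT y|\<mu>. norm (h y))"
proof -
  have "norm (conv g h x) \<le> (LINT y|\<mu>. norm (g (x - y) * h y))"
    unfolding conv_def by (rule integral_norm_bound)
  also have "\<dots> \<le> (LINT y|\<mu>. C * norm (h y))"
    using C by (intro integral_mono integrable_norm conv_integrable g h integrable_mult_right)
      (auto simp: norm_mult bounded_borel_integrable h intro!: mult_right_mono)
  finally show ?thesis by simp
qed

lemma conv_bounded_borel: assumes "g \<in> bounded_borel" "h \<in> bounded_borel" shows "conv g h \<in> bounded_borel"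
proof (rule bounded_borelI[OF _ conv_le_L2[OF assms]])
  note [measurable] = assms[THEN bounded_borel_measurable]
  show "conv g h \<in> borel_measurable borel"
    unfolding conv_def by measurable
qed

lemma conv_commute: assumes "g \<in> bounded_borel" "h \<in> bounded_borel" shows "conv g h = conv h g"
proof
  fix x
  have "conv g h x = (LINT y|\<mu>. g (x - (x - y)) * h (x - y))"
    unfolding conv_def
    by (rule integral_reflect[symmetric]) (intro bounded_borel_measurable bounded_borel_mult bounded_borel_reflect assms)
  also have "\<dots> = conv h g x" by (simp add: conv_def mult.commute)
  finally show "conv g h x = conv h g x" .
qed

lemma conv_assoc:
  assumes g: "g \<in> bounded_borel" and h: "h \<in> bounded_borel" and k: "k \<in> bounded_borel"
  shows "conv (conv g h) k = conv g (conv h k)"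
proof
  fix x
  note [measurable] = assms[THEN bounded_borel_measurable]
  obtain C D E where b: "C \<ge> 0" "D \<ge> 0" "E \<ge> 0" "\<And>x. norm (g x) \<le> C" "\<And>x. norm (h x) \<le> D" "\<And>x. norm (k x) \<le> E"
    using assms by (metis bounded_borelE)
  have "integrable (\<mu> \<Otimes>\<^sub>M \<mu>) (\<lambda>(w, y). g (x - w) * (h (w - y) * k y))"
  proof (rule square.integrable_const_bound)
    show "AE z in \<mu> \<Otimes>\<^sub>M \<mu>. norm (case z of (w, y) \<Rightarrow> g (x - w) * (h (w - y) * k y)) \<le> C * (D * E)"
      using b by (auto simp: norm_mult split: prod.split intro!: mult_mono)
  qed measurable
  from square.Fubini_integral[OF this]
  have "(LINT y|\<mu>. LINT w|\<mu>. g (x - w) * (h (w - y) * k y)) = (LINT w|\<mu>. LINT y|\<mu>. g (x - w) * (h (w - y) * k y))" .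
  moreover have "(LINT w|\<mu>. g (x - w) * (h (w - y) * k y)) = conv g h (x - y) * k y" for y
  proof -
    have "(LINT w|\<mu>. g (x - w) * (h (w - y) * k y)) = (LINT w|\<mu>. g (x - (w + y)) * (h ((w + y) - y) * k y))"
      by (rule integral_translate(2)[symmetric]) measurable
    also have "\<dots> = (LINT w|\<mu>. (g ((x - y) - w) * h w) * k y)" by (simp add: algebra_simps)
    finally show ?thesis by (simp add: conv_def)
  qed
  moreover have "(LINT y|\<mu>. g (x - w) * (h (w - y) * k y)) = g (x - w) * conv h k w" for w
    unfolding conv_def by (rule integral_mult_right_zero)
  ultimately show "conv (conv g h) k x = conv g (conv h k) x"
    by (simp only: conv_def[of "conv g h"] conv_def[of g "conv h k"])
qed

lemma conv_add_left:
  "g \<in> bounded_borel \<Longrightarrow> g' \<in> bounded_borel \<Longrightarrow> h \<in> bounded_borel \<Longrightarrow> conv (\<lambda>x. g x + g' x) h x = conv g h x + conv g' h x"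
  by (simp add: conv_def distrib_right conv_integrable)

lemma conv_diff_left:
  "g \<in> bounded_borel \<Longrightarrow> g' \<in> bounded_borel \<Longrightarrow> h \<in> bounded_borel \<Longrightarrow> conv (\<lambda>x. g x - g' x) h x = conv g h x - conv g' h x"
  by (simp add: conv_def left_diff_distrib conv_integrable)

lemma conv_scale_left: "conv (\<lambda>x. c * g x) h x = c * conv g h x"
  by (simp add: conv_def mult.assoc)

lemma conv_scale_right: "conv g (\<lambda>x. c * h x) x = c * conv g h x"
  by (simp add: conv_def mult.left_commute)

lemma conv_translate_left: "conv (\<lambda>x. g (x + a)) h x = conv g h (x + a)"
  by (simp add: conv_def algebra_simps)

lemma conv_star: 
  assumes "g \<in> bounded_borel" "h \<in> bounded_borel" shows "star (conv g h) = conv (star g) (star h)"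
proof
  fix x
  note [measurable] = assms[THEN bounded_borel_measurable]
  have "conv (star g) (star h) x = (LINT y|\<mu>. star g (x - (0 - y)) * star h (0 - y))"
    unfolding conv_def by (rule integral_reflect[symmetric]) (intro bounded_borel_measurable bounded_borel_mult bounded_borel_reflect bounded_borel_star assms)
  also have "\<dots> = (LINT y|\<mu>. cnj (g (- x - y) * h y))" by (simp add: star_def)
  also have "\<dots> = star (conv g h) x" unfolding star_def conv_def by (rule Bochner_Integration.integral_cnj)
  finally show "star (conv g h) x = conv (star g) (star h) x" ..
qed

text \<open>
  Expresses square norms as values of convolutions at the identity; together with commutativity this
  replaces computations with adjoint operators.
\<close>
lemma conv_self_0: 
  assumes "g \<in> bounded_borel" shows "conv g (star g) 0 = of_real ((L2_nrm \<mu> g)\<^sup>2)"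
proof -
  have "conv g (star g) 0 = (LINT y|\<mu>. of_real ((norm (g (0 - y)))\<^sup>2))"
    by (simp only: conv_def star_def complex_norm_square diff_0)
  also have "\<dots> = of_real (LINT y|\<mu>. (norm (g (0 - y)))\<^sup>2)" by (rule integral_complex_of_real)
  also have "\<dots> = of_real ((L2_nrm \<mu> g)\<^sup>2)"
    by (simp only: L2_nrm_square[symmetric] L2_nrm_reflect[OF assms])
  finally show ?thesis .
qed


end

section \<open>Continuity of translation in the mean\<close>

lemma indicator_diff_le:
  assumes "p \<in> K \<Longrightarrow> q \<in> U"
  shows "norm (indicator U q - indicator U p :: complex) \<le> (indicator U q - indicator U p) + 2 * indicator (U - K) p"
proof (cases "p \<in> U")
  case True
  then show ?thesis using assms by (cases "q \<in> U"; cases "p \<in> K") simp_all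
next
  case False
  then show ?thesis using assms by (cases "q \<in> U") simp_all
qed

context compact_haar begin

lemma integrable_indicator:
  "A \<in> sets borel \<Longrightarrow> integrable \<mu> (indicator A :: 'a \<Rightarrow> 'b::{banach, second_countable_topology, real_normed_algebra_1})"
  by (rule integrable_const_bound[where B = 1]) (auto simp: indicator_def)

definition L1_translation :: "('a \<Rightarrow> complex) \<Rightarrow> bool"
  where "L1_translation g \<longleftrightarrow> integrable \<mu> g \<and>
    ((\<lambda>a. LINT x|\<mu>. norm (g (x + a) - g x)) \<longlongrightarrow> 0) (nhds 0)"

lemma L1_translation_integrable: "L1_translation g \<Longrightarrow> integrable \<mu> g"
  by (simp add: L1_translation_def)

lemma integrable_translation_diff:
  fixes g :: "'a \<Rightarrow> complex"
  assumes "integrable \<mu> g" shows "integrable \<mu> (\<lambda>x. norm (g (x + a) - g x))"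
  by (intro integrable_norm Bochner_Integration.integrable_diff integrable_translate[OF assms] assms)

lemma L1_translationI:
  assumes g: "integrable \<mu> g"
    and small: "\<And>e. e > 0 \<Longrightarrow> eventually (\<lambda>a. (LINT x|\<mu>. norm (g (x + a) - g x)) < e) (nhds 0)"
  shows "L1_translation g"
  unfolding L1_translation_def
proof (intro conjI g tendstoI)
  fix e :: real assume "e > 0"
  then show "\<forall>\<^sub>F a in nhds 0. dist (LINT x|\<mu>. norm (g (x + a) - g x)) 0 < e"
    using small by (simp add: dist_real_def)
qed

lemma L1_translationD:
  assumes "L1_translation g" "e > 0"
  shows "eventually (\<lambda>a. (LINT x|\<mu>. norm (g (x + a) - g x)) < e) (nhds 0)"
proof -
  have "\<forall>\<^sub>F a in nhds 0. dist (LINT x|\<mu>. norm (g (x + a) - g x)) 0 < e"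
    using assms by (intro tendstoD) (auto simp: L1_translation_def)
  then show ?thesis by (simp add: dist_real_def)
qed

text \<open>
  An \<open>\<epsilon>/3\<close> argument: by translation invariance, \<open>g\<close> and \<open>h\<close> stay equally close after translating both.
\<close>
lemma L1_translation_approx:
  assumes g: "integrable \<mu> g"
    and approx: "\<And>e. e > 0 \<Longrightarrow> \<exists>h. L1_translation h \<and> (LINT x|\<mu>. norm (g x - h x)) < e"
  shows "L1_translation g"
proof (rule L1_translationI[OF g])
  fix e :: real assume e: "e > 0"
  then obtain h where h: "L1_translation h" and gh: "(LINT x|\<mu>. norm (g x - h x)) < e / 3"
    using approx[of "e / 3"] by auto
  note hi = L1_translation_integrable[OF h]
  have igh: "integrable \<mu> (\<lambda>x. norm (g x - h x))"
    by (intro integrable_norm Bochner_Integration.integrable_diff g hi)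
  have "eventually (\<lambda>a. (LINT x|\<mu>. norm (h (x + a) - h x)) < e / 3) (nhds 0)"
    using e by (intro L1_translationD h) auto
  then show "eventually (\<lambda>a. (LINT x|\<mu>. norm (g (x + a) - g x)) < e) (nhds 0)"
  proof eventually_elim
    case (elim a)
    have "(LINT x|\<mu>. norm (g (x + a) - g x))
      \<le> (LINT x|\<mu>. norm (g (x + a) - h (x + a)) + norm (h (x + a) - h x) + norm (g x - h x))"
    proof (rule integral_mono)
      fix x
      have "g (x + a) - g x = (g (x + a) - h (x + a)) + (h (x + a) - h x) - (g x - h x)" by simp
      then show "norm (g (x + a) - g x) \<le> norm (g (x + a) - h (x + a)) + norm (h (x + a) - h x) + norm (g x - h x)"
        using norm_triangle_ineq4[of "(g (x + a) - h (x + a)) + (h (x + a) - h x)" "g x - h x"]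
          norm_triangle_ineq[of "g (x + a) - h (x + a)" "h (x + a) - h x"] by simp
    qed (intro integrable_translation_diff[OF g] integrable_translation_diff[OF hi] igh
          Bochner_Integration.integrable_add integrable_translate[OF igh])+
    also have "\<dots> = (LINT x|\<mu>. norm (g (x + a) - h (x + a))) + (LINT x|\<mu>. norm (h (x + a) - h x))
        + (LINT x|\<mu>. norm (g x - h x))"
      using integrable_translate[OF igh, of a] integrable_translation_diff[OF hi, of a] igh by simp
    also have "(LINT x|\<mu>. norm (g (x + a) - h (x + a))) = (LINT x|\<mu>. norm (g x - h x))"
      using borel_measurable_integrable[OF igh] by (intro integral_translate(2)) simp
    finally show ?case using elim gh by simp
  qed
qed

lemma L1_translation_add:
  assumes g: "L1_translation g" and h: "L1_translation h" shows "L1_translation (\<lambda>x. g x + h x)"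
proof (rule L1_translationI)
  note gi = L1_translation_integrable[OF g] and hi = L1_translation_integrable[OF h]
  show "integrable \<mu> (\<lambda>x. g x + h x)" by (intro Bochner_Integration.integrable_add gi hi)
  fix e :: real assume e: "e > 0"
  then have "e / 2 > 0" by simp
  from L1_translationD[OF g this] L1_translationD[OF h this] show "eventually (\<lambda>a. (LINT x|\<mu>. norm (g (x + a) + h (x + a) - (g x + h x))) < e) (nhds 0)"
  proof eventually_elim
    case (elim a)
    have "(LINT x|\<mu>. norm (g (x + a) + h (x + a) - (g x + h x)))
      \<le> (LINT x|\<mu>. norm (g (x + a) - g x) + norm (h (x + a) - h x))"
    proof (rule integral_mono)
      show "norm (g (x + a) + h (x + a) - (g x + h x)) \<le> norm (g (x + a) - g x) + norm (h (x + a) - h x)" for x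
        using norm_triangle_ineq[of "g (x + a) - g x" "h (x + a) - h x"] by (simp add: algebra_simps)
    next
      have "integrable \<mu> (\<lambda>x. g x + h x)" by (intro Bochner_Integration.integrable_add gi hi)
      from integrable_translation_diff[OF this]
      show "integrable \<mu> (\<lambda>x. norm (g (x + a) + h (x + a) - (g x + h x)))" .
    qed (intro Bochner_Integration.integrable_add integrable_translation_diff[OF gi] integrable_translation_diff[OF hi])
    also have "\<dots> = (LINT x|\<mu>. norm (g (x + a) - g x)) + (LINT x|\<mu>. norm (h (x + a) - h x))"
      by (intro Bochner_Integration.integral_add integrable_translation_diff[OF gi] integrable_translation_diff[OF hi])
    finally show ?case using elim by simp
  qed
qed

lemma L1_translation_scale:
  assumes "L1_translation g" shows "L1_translation (\<lambda>x. c * g x)"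
proof -
  have "norm (c * g (x + a) - c * g x) = norm c * norm (g (x + a) - g x)" for x a
    by (simp only: right_diff_distrib[symmetric] norm_mult)
  moreover have "((\<lambda>a. norm c * (LINT x|\<mu>. norm (g (x + a) - g x))) \<longlongrightarrow> 0) (nhds 0)"
    using assms by (intro tendsto_mult_right_zero) (simp add: L1_translation_def)
  ultimately show ?thesis using assms by (simp add: L1_translation_def)
qed

lemma L1_translation_const: "L1_translation (\<lambda>x. c)"
  by (simp add: L1_translation_def)

text \<open>
  A substitute for inner regularity: \<open>U\<close> is a countable union of open sets \<open>V\<close> each of which stays in \<open>U\<close> under
  translation by some neighbourhood of the identity, and finitely many of them exhaust \<open>U\<close> up to measure \<open>e\<close>.
\<close>
lemma open_inner_approx:
  assumes U: "open (U :: 'a set)" and e: "e > 0"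
  obtains K W where "open K" "K \<subseteq> U" "measure \<mu> (U - K) < e"
    "open W" "0 \<in> W" "\<And>x w. x \<in> K \<Longrightarrow> w \<in> W \<Longrightarrow> x + w \<in> U"
proof -
  define P where "P V W \<longleftrightarrow> open V \<and> open W \<and> 0 \<in> W \<and> (\<forall>v\<in>V. \<forall>w\<in>W. v + w \<in> U)" for V W :: "'a set"
  define F where "F = {V. \<exists>W. P V W}"
  have "\<exists>V\<in>F. x \<in> V" if x: "x \<in> U" for x
  proof -
    have "open ((\<lambda>p::'a \<times> 'a. fst p + snd p) -` U)"
      by (rule open_vimage[OF U]) (intro continuous_intros)
    moreover have "(x, 0) \<in> (\<lambda>p. fst p + snd p) -` U" using x by simp
    ultimately obtain V W where VW: "open V" "open W" "(x, 0) \<in> V \<times> W"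
        "V \<times> W \<subseteq> (\<lambda>p. fst p + snd p) -` U"
      by (rule open_prod_elim)
    have "v + w \<in> U" if "v \<in> V" "w \<in> W" for v w
      using subsetD[OF VW(4), of "(v, w)"] that by simp
    with VW have "P V W" "x \<in> V" unfolding P_def by simp_all
    then show ?thesis unfolding F_def by blast
  qed
  moreover have FU: "V \<subseteq> U" if V: "V \<in> F" for V
  proof
    fix x assume x: "x \<in> V"
    obtain W where "P V W" using V unfolding F_def by blast
    then have "x + 0 \<in> U" using x unfolding P_def by blast
    then show "x \<in> U" by simp
  qed
  ultimately have UF: "\<Union>F = U" by blast
  have "open V" if "V \<in> F" for V using that unfolding F_def P_def by blast
  then obtain F' where F': "F' \<subseteq> F" "countable F'" "\<Union>F' = \<Union>F"
    by (rule Lindelof)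
  have "P {} UNIV" unfolding P_def by simp
  then have empty: "{} \<in> F" unfolding F_def by blast
  define V where "V = from_nat_into (insert {} F')"
  have rV: "range V = insert {} F'" unfolding V_def by (rule range_from_nat_into) (simp_all add: F'(2))
  have VF: "V n \<in> F" for n
  proof -
    have "V n \<in> range V" by simp
    then have "V n = {} \<or> V n \<in> F'" by (simp only: rV insert_iff)
    then show ?thesis
    proof
      assume "V n = {}" then show ?thesis using empty by simp
    next
      assume "V n \<in> F'" then show ?thesis by (rule subsetD[OF F'(1)])
    qed
  qed
  then have "\<forall>n. \<exists>W. P (V n) W" unfolding F_def by blast
  then obtain W where W: "\<And>n. P (V n) (W n)" using choice[of "\<lambda>n W. P (V n) W"] by blast
  define K where "K n = (\<Union>i<n. V i)" for n
  have Kop: "open (K n)" for n using W by (auto simp: K_def P_def)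
  have UK: "(\<Union>n. K n) = U"
  proof -
    have "(\<Union>n. K n) = \<Union>(range V)" by (auto simp: K_def) 
    also have "\<dots> = U" using rV F' UF by simp
    finally show ?thesis .
  qed
  have "(\<lambda>n. measure \<mu> (K n)) \<longlonglongrightarrow> measure \<mu> (\<Union>n. K n)"
  proof (rule finite_Lim_measure_incseq)
    show "range K \<subseteq> sets \<mu>" using Kop by auto
    show "incseq K" by (rule incseq_SucI) (auto simp: K_def less_Suc_eq)
  qed
  then have "eventually (\<lambda>n. measure \<mu> U - e < measure \<mu> (K n)) sequentially"
    using e by (intro order_tendstoD) (auto simp: UK)
  then obtain n where n: "measure \<mu> U - e < measure \<mu> (K n)" by (auto simp: eventually_sequentially)
  have sub: "K n \<subseteq> U" using UK by blast
  show ?thesis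
  proof (rule that[OF Kop sub])
    have "measure \<mu> (U - K n) = measure \<mu> U - measure \<mu> (K n)"
      by (rule finite_measure_Diff) (simp_all add: U Kop sub)
    then show "measure \<mu> (U - K n) < e" using n by simp
    show "open (\<Inter>i<n. W i)" using W by (intro open_INT) (simp_all add: P_def)
    show "0 \<in> (\<Inter>i<n. W i)" using W by (simp add: P_def)
    show "x + w \<in> U" if x: "x \<in> K n" and w: "w \<in> (\<Inter>i<n. W i)" for x w
    proof -
      obtain i where "i < n" "x \<in> V i" using x by (auto simp: K_def)
      then show ?thesis using W[of i] w by (simp add: P_def)
    qed
  qed
qed

lemma L1_translation_open:
  assumes U: "open U" shows "L1_translation (indicator U)"
proof (rule L1_translationI)
  have [measurable]: "U \<in> sets borel" using U by simp
  show "integrable \<mu> (indicator U :: 'a \<Rightarrow> complex)" by (rule integrable_indicator) simp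
  fix e :: real assume e: "e > 0"
  obtain K W where K: "open K" "K \<subseteq> U" "measure \<mu> (U - K) < e / 2"
    and W: "open W" "0 \<in> W" "\<And>x w. x \<in> K \<Longrightarrow> w \<in> W \<Longrightarrow> x + w \<in> U"
    using e by (auto intro: open_inner_approx[OF U, of "e / 2"])
  have [measurable]: "K \<in> sets borel" using K by simp
  have "eventually (\<lambda>a. a \<in> W) (nhds 0)" by (rule eventually_nhds_in_open[OF W(1,2)])
  then show "\<forall>\<^sub>F a in nhds 0. (LINT x|\<mu>. norm (indicator U (x + a) - indicator U x :: complex)) < e"
  proof eventually_elim
    case (elim a)
    \<comment> \<open>translation preserves the mass of \<open>U\<close>, so only the part of \<open>U\<close> that is moved out of \<open>U\<close> matters\<close>
    have "(LINT x|\<mu>. norm (indicator U (x + a) - indicator U x :: complex))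
      \<le> (LINT x|\<mu>. (indicator U (x + a) - indicator U x) + 2 * indicator (U - K) x)"
    proof (rule integral_mono)
      show "norm (indicator U (x + a) - indicator U x :: complex)
        \<le> (indicator U (x + a) - indicator U x) + 2 * indicator (U - K) x" for x
        by (rule indicator_diff_le) (rule W(3)[OF _ elim])
      show "integrable \<mu> (\<lambda>x. norm (indicator U (x + a) - indicator U x :: complex))"
        by (rule integrable_translation_diff[OF integrable_indicator]) simp
      show "integrable \<mu> (\<lambda>x. indicator U (x + a) - indicator U x + 2 * indicator (U - K) x :: real)"
      proof -
        have "integrable \<mu> (\<lambda>x. indicator U (x + a) :: real)"
          by (rule integrable_translate[OF integrable_indicator[of U]]) simp
        moreover have "integrable \<mu> (indicator U :: 'a \<Rightarrow> real)" "integrable \<mu> (indicator (U - K) :: 'a \<Rightarrow> real)"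
          by (rule integrable_indicator, simp)+
        ultimately show ?thesis by simp
      qed
    qed
    also have "\<dots> = ((LINT x|\<mu>. indicator U (x + a)) - (LINT x|\<mu>. indicator U x)) + 2 * measure \<mu> (U - K)"
    proof -
      have i: "integrable \<mu> (indicator U :: 'a \<Rightarrow> real)" "integrable \<mu> (indicator (U - K) :: 'a \<Rightarrow> real)"
        by (rule integrable_indicator, simp)+
      show ?thesis
        using integrable_translate[OF i(1), of a] i by simp
    qed
    also have "(LINT x|\<mu>. indicator U (x + a)) = (LINT x|\<mu>. (indicator U x :: real))"
      by (rule integral_translate(2)[of "indicator U"]) simp
    finally show ?case using K(3) by simp
  qed
qed

text \<open>
  Open sets generate the Borel sets and are stable under intersection, so it suffices to pass to complements
  and countable disjoint unions.
\<close>
lemma L1_translation_borel: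
  assumes A: "A \<in> sets borel" shows "L1_translation (indicator A)"
proof -
  have 1: "Int_stable {S :: 'a set. open S}" by (auto simp: Int_stable_def)
  have 2: "{S :: 'a set. open S} \<subseteq> Pow UNIV" by simp
  have 3: "A \<in> sigma_sets UNIV {S :: 'a set. open S}" using A by (simp add: borel_def)
  from 1 2 3 have "A \<in> sets borel \<and> L1_translation (indicator A)"
  proof (induction rule: sigma_sets_induct_disjoint)
    case (basic A) then show ?case by (simp add: L1_translation_open)
  next
    case empty then show ?case by (simp add: L1_translation_const)
  next
    case (compl A)
    have "indicator (UNIV - A) = (\<lambda>x. 1 + (-1) * indicator A x :: complex)"
      by (simp add: indicator_def fun_eq_iff)
    moreover have "L1_translation (\<lambda>x. 1 + (-1) * indicator A x)"
      by (intro L1_translation_add L1_translation_const L1_translation_scale) (use compl in simp)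
    moreover have "UNIV - A \<in> sets borel" using compl by (intro sets.Diff) auto
    ultimately show ?case by metis
  next
    case (union A)
    then have [measurable]: "\<And>i. A i \<in> sets borel" by auto
    have s: "L1_translation (indicator (\<Union>i<n. A i))" for n
    proof (induction n)
      case 0 show ?case by (simp add: L1_translation_const)
    next
      case (Suc n)
      have "indicator (\<Union>i<Suc n. A i) = (\<lambda>x. indicator (\<Union>i<n. A i) x + indicator (A n) x :: complex)"
      proof -
        have "(\<Union>i<Suc n. A i) = (\<Union>i<n. A i) \<union> A n" by (auto simp: less_Suc_eq)
        moreover have "A i \<inter> A n = {}" if "i < n" for i
          using disjoint_family_onD[OF union(1), of i n] that by simp
        then have "(\<Union>i<n. A i) \<inter> A n = {}" by blast
        ultimately show ?thesis by (simp add: indicator_add fun_eq_iff)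
      qed
      then show ?case using Suc union by (auto intro!: L1_translation_add)
    qed
    have "L1_translation (indicator (\<Union>i. A i))"
    proof (rule L1_translation_approx)
      show "integrable \<mu> (indicator (\<Union>i. A i) :: 'a \<Rightarrow> complex)"
        by (rule integrable_indicator) simp
      fix e :: real assume e: "e > 0"
      have "(\<lambda>n. measure \<mu> (\<Union>i<n. A i)) \<longlonglongrightarrow> measure \<mu> (\<Union>n. \<Union>i<n. A i)"
        by (rule finite_Lim_measure_incseq) (auto intro!: incseq_SucI simp: less_Suc_eq)
      moreover have UA: "(\<Union>n. \<Union>i<n. A i) = (\<Union>i. A i)" by auto
      ultimately have "eventually (\<lambda>n. measure \<mu> (\<Union>i. A i) - e < measure \<mu> (\<Union>i<n. A i)) sequentially"
        using e by (intro order_tendstoD) auto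
      then obtain n where n: "measure \<mu> (\<Union>i. A i) - e < measure \<mu> (\<Union>i<n. A i)"
        by (auto simp: eventually_sequentially)
      have "(LINT x|\<mu>. norm (indicator (\<Union>i. A i) x - indicator (\<Union>i<n. A i) x :: complex))
        = (LINT x|\<mu>. indicator ((\<Union>i. A i) - (\<Union>i<n. A i)) x)"
        by (intro Bochner_Integration.integral_cong) (auto simp: indicator_def)
      also have "\<dots> = measure \<mu> ((\<Union>i. A i) - (\<Union>i<n. A i))" by simp
      also have "\<dots> = measure \<mu> (\<Union>i. A i) - measure \<mu> (\<Union>i<n. A i)"
        by (rule finite_measure_Diff) auto
      also have "\<dots> < e" using n by simp
      finally show "\<exists>h. L1_translation h \<and> (LINT x|\<mu>. norm (indicator (\<Union>i. A i) x - h x)) < e"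
        using s by blast
    qed
    then show ?case by simp
  qed
  then show ?thesis by simp
qed

lemma L1_translation: "integrable \<mu> g \<Longrightarrow> L1_translation g"
proof (induction rule: integrable_induct)
  case (base A c)
  then have "L1_translation (\<lambda>x. c * indicator A x)" by (intro L1_translation_scale L1_translation_borel) auto
  moreover have "(\<lambda>x. indicator A x *\<^sub>R c) = (\<lambda>x. c * indicator A x)"
    by (simp add: fun_eq_iff indicator_def)
  ultimately show ?case by simp
next
  case (add f g) show ?case by (rule L1_translation_add[OF add.IH])
next
  case (lim f s)
  show ?case
  proof (rule L1_translation_approx[OF lim.hyps(4)])
    fix e :: real assume e: "e > 0"
    have "(\<lambda>i. LINT x|\<mu>. norm (f x - s i x)) \<longlonglongrightarrow> (LINT x|\<mu>. 0)"
    proof (rule integral_dominated_convergence[where w = "\<lambda>x. 3 * norm (f x)"])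
      show "AE x in \<mu>. (\<lambda>i. norm (f x - s i x)) \<longlonglongrightarrow> 0"
      proof (rule AE_I2)
        fix x assume "x \<in> space \<mu>"
        from tendsto_norm[OF tendsto_diff[OF tendsto_const lim.hyps(2)[OF this], of "f x"]]
        show "(\<lambda>i. norm (f x - s i x)) \<longlonglongrightarrow> 0" by simp
      qed
      show "AE x in \<mu>. norm (norm (f x - s i x)) \<le> 3 * norm (f x)" for i
      proof (rule AE_I2)
        fix x assume "x \<in> space \<mu>"
        from lim.hyps(3)[OF this, of i] norm_triangle_ineq4[of "f x" "s i x"]
        show "norm (norm (f x - s i x)) \<le> 3 * norm (f x)" by simp
      qed
    qed (use lim.hyps(1,4) in auto)
    then have "eventually (\<lambda>i. (LINT x|\<mu>. norm (f x - s i x)) < e) sequentially"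
      using e by (intro order_tendstoD) auto
    then show "\<exists>h. L1_translation h \<and> (LINT x|\<mu>. norm (f x - h x)) < e"
      using lim.IH by (auto simp: eventually_sequentially)
  qed
qed

text \<open>
  The difference of two values of \<open>conv g h\<close> is bounded by the sup norm of \<open>h\<close> times the mean displacement
  of \<open>g\<close> under translation.
\<close>
lemma conv_continuous:
  assumes g: "g \<in> bounded_borel" and h: "h \<in> bounded_borel" shows "continuous_on UNIV (conv g h)"
  unfolding continuous_on_def
proof (intro ballI, simp)
  fix x :: 'a
  obtain C where C: "C \<ge> 0" "\<And>y. norm (h y) \<le> C" using h by (metis bounded_borelE)
  define \<delta> where "\<delta> a = (LINT z|\<mu>. norm (g (z + a) - g z))" for a
  have \<delta>0: "(\<delta> \<longlongrightarrow> 0) (nhds 0)"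
    using L1_translation[OF bounded_borel_integrable[OF g]] by (simp add: L1_translation_def \<delta>_def[abs_def])
  have shift: "filterlim (\<lambda>x'. x' - x) (nhds 0) (at x)"
  proof -
    have "((\<lambda>x'. x' - x) \<longlongrightarrow> x - x) (at x)" by (intro tendsto_intros)
    then show ?thesis by simp
  qed
  have lim: "((\<lambda>x'. C * \<delta> (x' - x)) \<longlongrightarrow> 0) (at x)"
    by (rule tendsto_mult_right_zero[OF filterlim_compose[OF \<delta>0 shift]])
  have le: "norm (conv g h x' - conv g h x) \<le> C * \<delta> (x' - x)" for x'
  proof -
    have "conv g h x' - conv g h x = (LINT y|\<mu>. (g (x' - y) - g (x - y)) * h y)"
      using g h by (simp add: conv_def left_diff_distrib conv_integrable)
    also have "norm \<dots> \<le> (LINT y|\<mu>. norm ((g (x' - y) - g (x - y)) * h y))"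
      by (rule integral_norm_bound)
    also have "\<dots> \<le> (LINT y|\<mu>. C * norm (g (x' - y) - g (x - y)))"
    proof (rule integral_mono)
      show "norm ((g (x' - y) - g (x - y)) * h y) \<le> C * norm (g (x' - y) - g (x - y))" for y
        using mult_right_mono[OF C(2)[of y] norm_ge_zero[of "g (x' - y) - g (x - y)"]]
        by (simp only: norm_mult mult.commute[of _ "norm (h y)"])
    qed (intro integrable_norm integrable_mult_right bounded_borel_integrable bounded_borel_mult bounded_borel_diff bounded_borel_reflect g h)+
    also have "\<dots> = C * (LINT y|\<mu>. norm (g (x' - y) - g (x - y)))" by simp
    also have "(LINT y|\<mu>. norm (g (x' - y) - g (x - y))) = (LINT z|\<mu>. norm (g (z + (x' - x)) - g z))"
    proof -
      have "(\<lambda>z. g (z + (x' - x)) - g z) \<in> bounded_borel" by (intro bounded_borel_diff bounded_borel_translate g)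
      from integral_reflect[OF measurable_compose[OF bounded_borel_measurable[OF this] borel_measurable_norm], of x] show ?thesis by (simp add: algebra_simps)
    qed
    finally show ?thesis by (simp add: \<delta>_def)
  qed
  have "((\<lambda>x'. conv g h x' - conv g h x) \<longlongrightarrow> 0) (at x)"
    by (rule Lim_null_comparison[OF always_eventually[OF allI[OF le]] lim])
  then show "(conv g h \<longlongrightarrow> conv g h x) (at x)" by (simp add: LIM_zero_iff)
qed

end

section \<open>The top eigenspace of a convolution operator\<close>

text \<open>
  The ratios \<open>s (Suc n) / s n\<close> increase, by log-convexity, and are bounded, by submultiplicativity; \<open>lam\<close> is their
  limit.  The lower bound on \<open>s n\<close> comes from products of \<open>Suc n\<close> consecutive ratios far out in the sequence.
\<close>
lemma log_convex_submultiplicative: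
  fixes s :: "nat \<Rightarrow> real"
  assumes pos: "\<And>n. s n > 0" and convex: "\<And>n. (s (Suc n))\<^sup>2 \<le> s n * s (Suc (Suc n))"
    and sub: "\<And>m n. s (Suc (m + n)) \<le> M * s m * s n"
  obtains lam where "lam > 0" "\<And>n. s (Suc n) \<le> lam * s n" "\<And>n. lam ^ Suc n \<le> M * s n"
proof -
  define r where "r n = s (Suc n) / s n" for n
  have r_pos: "r n > 0" for n using pos by (simp add: r_def)
  have inc: "incseq r"
  proof (rule incseq_SucI)
    fix n show "r n \<le> r (Suc n)"
      using convex[of n] pos[of n] pos[of "Suc n"] by (simp add: r_def field_simps power2_eq_square)
  qed
  have bdd: "r n \<le> M * s 0" for n
    using sub[of n 0] pos[of n] by (simp add: r_def field_simps)
  obtain lam where lim: "r \<longlonglongrightarrow> lam" and le: "\<And>n. r n \<le> lam"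
    using incseq_convergent[OF inc, of "M * s 0"] bdd by blast
  show ?thesis
  proof (rule that)
    show "lam > 0" using le[of 0] r_pos[of 0] by linarith
    show "s (Suc n) \<le> lam * s n" for n
      using le[of n] pos[of n] by (simp add: r_def field_simps)
    show "lam ^ Suc n \<le> M * s n" for n
    proof -
      have quotient: "(\<Prod>i<k. r (m + i)) = s (m + k) / s m" for m k
        using pos by (induction k) (auto simp: r_def less_imp_neq[symmetric])
      have "(\<lambda>m. \<Prod>i<Suc n. r (m + i)) \<longlonglongrightarrow> (\<Prod>i<Suc n. lam)"
        by (intro tendsto_prod LIMSEQ_ignore_initial_segment lim)
      then have "(\<lambda>m. \<Prod>i<Suc n. r (m + i)) \<longlonglongrightarrow> lam ^ Suc n" by simp
      moreover have "(\<Prod>i<Suc n. r (m + i)) \<le> M * s n" for m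
        unfolding quotient using sub[of m n] pos[of m] by (simp add: field_simps)
      ultimately show ?thesis by (intro LIMSEQ_le_const2) auto
    qed
  qed
qed

text \<open>
  If the first ratio exceeded \<open>lam\<close>, all later ones would be at least as large and the sequence would outgrow
  \<open>C * lam ^ n\<close>.
\<close>
lemma log_convex_growth:
  fixes b :: "nat \<Rightarrow> real"
  assumes nonneg: "\<And>n. b n \<ge> 0" and convex: "\<And>n. (b (Suc n))\<^sup>2 \<le> b n * b (Suc (Suc n))"
    and lam: "lam > 0" and bound: "\<And>n. b n \<le> C * lam ^ n"
  shows "b 1 \<le> lam * b 0"
proof (rule ccontr)
  assume "\<not> b 1 \<le> lam * b 0"
  then have gt: "b 1 > lam * b 0" by simp
  then have b1: "b 1 > 0" using nonneg[of 0] lam by (meson le_less_trans mult_nonneg_nonneg less_imp_le)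
  have b0: "b 0 > 0"
  proof (rule ccontr)
    assume "\<not> b 0 > 0"
    then have "b 0 = 0" using nonneg[of 0] by simp
    then show False using convex[of 0] b1 by simp
  qed
  define \<rho> where "\<rho> = b 1 / b 0"
  have \<rho>: "\<rho> > lam" using gt b0 by (simp add: \<rho>_def field_simps)
  have \<rho>0: "\<rho> > 0" using \<rho> lam by simp
  have step: "b n > 0 \<and> \<rho> * b n \<le> b (Suc n)" for n
  proof (induction n)
    case 0 show ?case using b0 by (simp add: \<rho>_def)
  next
    case (Suc n)
    then have p: "b n > 0" "b (Suc n) \<ge> \<rho> * b n" by auto
    then have p2: "b (Suc n) > 0" using \<rho>0 by (meson less_le_trans mult_pos_pos)
    have "\<rho> * b (Suc n) * b n \<le> b (Suc n) * b (Suc n)"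
      using mult_right_mono[OF p(2), of "b (Suc n)"] p2 by (simp add: mult_ac)
    also have "\<dots> \<le> b (Suc (Suc n)) * b n" using convex[of n] by (simp add: power2_eq_square mult_ac)
    finally show ?case using p p2 by simp
  qed
  have grow: "b 0 * \<rho> ^ n \<le> b n" for n
  proof (induction n)
    case (Suc n)
    then have "\<rho> * (b 0 * \<rho> ^ n) \<le> \<rho> * b n" using \<rho>0 by simp
    then show ?case using step[of n] by (simp add: mult_ac)
  qed simp
  have "(\<rho> / lam) ^ n \<le> C / b 0" for n
    using order_trans[OF grow[of n] bound[of n]] b0 lam by (simp add: field_simps power_divide)
  moreover have "\<rho> / lam > 1" using \<rho> lam by simp
  then obtain n where "(\<rho> / lam) ^ n > C / b 0" using real_arch_pow by blast
  ultimately show False by (meson not_le)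
qed

context compact_haar begin

lemma conv_left_commute:
  "g \<in> bounded_borel \<Longrightarrow> h \<in> bounded_borel \<Longrightarrow> k \<in> bounded_borel \<Longrightarrow> conv g (conv h k) = conv h (conv g k)"
  by (metis conv_assoc conv_commute)

lemmas conv_ac = conv_assoc conv_commute conv_left_commute

text \<open>
  Nonempty open sets have positive measure, as finitely many translates of them cover the compact group.
\<close>
lemma continuous_AE_zero:
  fixes g :: "'a \<Rightarrow> complex"
  assumes g: "continuous_on UNIV g" and ae: "AE x in \<mu>. g x = 0" shows "g x = 0"
proof (rule ccontr)
  assume nz: "g x \<noteq> 0"
  define U where "U a = (\<lambda>y. a + y) -` {y. g y \<noteq> 0}" for a
  have op: "open {y. g y \<noteq> 0}" using g by (intro open_Collect_neq continuous_intros)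
  then have U: "open (U a)" for a unfolding U_def by (rule open_vimage) (intro continuous_intros)
  have null: "emeasure \<mu> (U a) = 0" for a
  proof -
    have "emeasure \<mu> (U a) = emeasure (distr \<mu> borel (\<lambda>x. a + x)) {y. g y \<noteq> 0}"
      unfolding U_def using op by (subst emeasure_distr) auto
    also have "\<dots> = emeasure \<mu> {y. g y \<noteq> 0}" by (simp only: distr_translate)
    also have "\<dots> = 0" using ae op by (subst (asm) AE_iff_measurable[OF _ refl]) auto
    finally show ?thesis .
  qed
  have "y \<in> U (x - y)" for y using nz by (simp add: U_def)
  then have "UNIV \<subseteq> (\<Union>a. U a)" by blast
  then obtain T where T: "finite T" "UNIV \<subseteq> (\<Union>a\<in>T. U a)"
    using compactE_image[OF compact_UNIV, of UNIV U] U by metis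
  have "(\<Union>a\<in>T. U a) \<in> null_sets \<mu>"
    using T(1) U null by (intro null_sets_UN' countable_finite) (auto simp: null_sets_def)
  then have "emeasure \<mu> UNIV = 0" using T(2) by (simp add: top.extremum_unique null_setsD1 null_sets_subset)
  then show False using haar by (simp add: haar_measure_def)
qed

lemma L2_nrm_continuous_eq_0:
  assumes "continuous_on UNIV g" "L2_nrm \<mu> g = 0" shows "g x = 0"
  using L2_nrm_eq_0[OF bounded_borel_L2[OF bounded_borel_continuous[OF assms(1)]]] assms continuous_AE_zero by blast

text \<open>
  Indexed so that \<open>conv_power g n\<close> is the convolution of \<open>Suc n\<close> copies of \<open>g\<close>: convolution has no unit among
  functions.
\<close>
fun conv_power :: "('a \<Rightarrow> complex) \<Rightarrow> nat \<Rightarrow> 'a \<Rightarrow> complex" where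
  "conv_power g 0 = g"
| "conv_power g (Suc n) = conv g (conv_power g n)"

lemma conv_power_bounded_borel: "g \<in> bounded_borel \<Longrightarrow> conv_power g n \<in> bounded_borel"
  by (induction n) (auto intro: conv_bounded_borel)

lemma conv_power_add: "g \<in> bounded_borel \<Longrightarrow> conv (conv_power g m) (conv_power g n) = conv_power g (Suc (m + n))"
  by (induction m) (auto simp: conv_assoc conv_power_bounded_borel conv_bounded_borel)

lemma conv_power_star: "g \<in> bounded_borel \<Longrightarrow> star (conv_power g n) = conv_power (star g) n"
  by (induction n) (auto simp: conv_star conv_power_bounded_borel)

lemma conv_power_conv: "g \<in> bounded_borel \<Longrightarrow> h \<in> bounded_borel \<Longrightarrow> conv_power (conv g h) n = conv (conv_power g n) (conv_power h n)"
  by (induction n) (auto simp: conv_ac conv_power_bounded_borel conv_bounded_borel)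

lemma conv_star_self: "g \<in> bounded_borel \<Longrightarrow> star (conv g (star g)) = conv g (star g)"
  by (simp add: conv_star bounded_borel_star conv_commute)

lemma conv_star_le: "g \<in> bounded_borel \<Longrightarrow> norm (conv g (star g) x) \<le> (L2_nrm \<mu> g)\<^sup>2"
  using conv_le_L2[of g "star g" x] by (simp add: bounded_borel_star L2_nrm_star power2_eq_square)

text \<open>
  The Cauchy-Schwarz inequality for the operator \<open>K\<close> of convolution by \<open>\<kappa>\<close>: the square norm of \<open>K A\<close> is the inner
  product of \<open>A\<close> and \<open>K\<^sup>* K A\<close>, and \<open>K\<^sup>* K A\<close> has the same norm as \<open>K K A\<close> because \<open>K\<close> is normal.  The inner
  products are written as values of convolutions at the identity.
\<close>
lemma iterate_log_convex:
  assumes \<kappa>: "\<kappa> \<in> bounded_borel" and A: "A \<in> bounded_borel"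
  shows "((L2_nrm \<mu> (conv \<kappa> A))\<^sup>2)\<^sup>2 \<le> (L2_nrm \<mu> A)\<^sup>2 * (L2_nrm \<mu> (conv \<kappa> (conv \<kappa> A)))\<^sup>2"
proof -
  define \<psi> where "\<psi> = conv \<kappa> (star \<kappa>)"
  have \<psi>: "\<psi> \<in> bounded_borel" "star \<psi> = \<psi>" using \<kappa> by (auto simp: \<psi>_def conv_bounded_borel bounded_borel_star conv_star_self)
  define B where "B = conv A \<psi>"
  have B: "B \<in> bounded_borel" using A \<psi> by (simp add: B_def conv_bounded_borel)
  have 1: "conv (conv \<kappa> A) (star (conv \<kappa> A)) = conv A (star B)"
    using \<kappa> A \<psi> by (simp add: B_def conv_star) (simp add: \<psi>_def conv_ac conv_bounded_borel bounded_borel_star)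
  have 2: "conv B (star B) = conv (conv \<kappa> (conv \<kappa> A)) (star (conv \<kappa> (conv \<kappa> A)))"
    using \<kappa> A \<psi> by (simp add: B_def conv_star conv_bounded_borel) (simp add: \<psi>_def conv_ac conv_bounded_borel bounded_borel_star)
  have "(L2_nrm \<mu> B)\<^sup>2 = (L2_nrm \<mu> (conv \<kappa> (conv \<kappa> A)))\<^sup>2"
    using conv_self_0[OF B] conv_self_0[of "conv \<kappa> (conv \<kappa> A)"] \<kappa> A
    by (simp only: 2 conv_bounded_borel of_real_eq_iff)
  moreover have "(L2_nrm \<mu> (conv \<kappa> A))\<^sup>2 \<le> L2_nrm \<mu> A * L2_nrm \<mu> B"
  proof -
    have "(L2_nrm \<mu> (conv \<kappa> A))\<^sup>2 = norm (complex_of_real ((L2_nrm \<mu> (conv \<kappa> A))\<^sup>2))"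
      by (simp only: norm_of_real abs_of_nonneg zero_le_power2)
    also have "\<dots> = norm (conv A (star B) 0)"
      by (simp only: conv_self_0[symmetric] conv_bounded_borel \<kappa> A 1)
    also have "\<dots> \<le> L2_nrm \<mu> A * L2_nrm \<mu> B"
      using conv_le_L2[OF A bounded_borel_star[OF B], of 0] by (simp add: L2_nrm_star B)
    finally show ?thesis .
  qed
  then have "((L2_nrm \<mu> (conv \<kappa> A))\<^sup>2)\<^sup>2 \<le> (L2_nrm \<mu> A * L2_nrm \<mu> B)\<^sup>2" by (intro power_mono) auto
  ultimately show ?thesis by (simp add: power_mult_distrib)
qed

lemma conv_uniform_limit:
  assumes lim: "uniform_limit UNIV g e sequentially" and g: "\<And>n. g n \<in> bounded_borel" and e: "e \<in> bounded_borel" and h: "h \<in> bounded_borel"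
  shows "(\<lambda>n. conv (g n) h x) \<longlonglongrightarrow> conv e h x"
proof (rule LIMSEQ_I)
  fix r :: real assume r: "r > 0"
  define I where "I = (LINT y|\<mu>. norm (h y))"
  have I: "I \<ge> 0" unfolding I_def by (rule Bochner_Integration.integral_nonneg) auto
  have "eventually (\<lambda>n. \<forall>x\<in>UNIV. dist (g n x) (e x) < r / (I + 1)) sequentially"
    using lim r I by (intro uniform_limitD) auto
  then obtain N where N: "\<And>n x. n \<ge> N \<Longrightarrow> norm (g n x - e x) \<le> r / (I + 1)"
    by (auto simp: eventually_sequentially dist_norm intro: less_imp_le)
  show "\<exists>N. \<forall>n\<ge>N. norm (conv (g n) h x - conv e h x) < r"
  proof (intro exI allI impI)
    fix n assume n: "n \<ge> N"
    have "norm (conv (g n) h x - conv e h x) = norm (conv (\<lambda>x. g n x - e x) h x)"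
      by (simp add: conv_diff_left g e h)
    also have "\<dots> \<le> r / (I + 1) * I"
      unfolding I_def using N[OF n] by (intro conv_le_sup bounded_borel_diff g e h) (simp add: I_def)
    also have "\<dots> < r" using r I by (simp add: field_simps)
    finally show "norm (conv (g n) h x - conv e h x) < r" .
  qed
qed

text \<open>
  Convolution by \<open>e\<close> is then a nonzero orthogonal projection onto a space of eigenvectors of \<open>\<psi>\<close> for the eigenvalue
  \<open>lam\<close>.
\<close>
definition eigen_idempotent :: "real \<Rightarrow> ('a \<Rightarrow> complex) \<Rightarrow> ('a \<Rightarrow> complex) \<Rightarrow> bool"
  where "eigen_idempotent lam \<psi> e \<longleftrightarrow> continuous_on UNIV e \<and> star e = e \<and> conv e e = e \<and>
    conv e \<psi> = (\<lambda>x. lam * e x) \<and> e 0 \<noteq> 0"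

text \<open>
  The power method.  Let \<open>\<psi> = \<kappa> * star \<kappa>\<close> and let \<open>s n\<close> be the value of the \<open>n\<close>-th power of \<open>\<psi>\<close> at the identity, which
  dominates that power everywhere and is the square norm of \<open>conv_power \<kappa> n\<close>.  The sequence \<open>s\<close> is log-convex and
  submultiplicative up to the factor \<open>total\<close>, so its ratios increase to some \<open>lam\<close>, and \<open>s n / lam ^ Suc n\<close>
  decreases to a positive limit.  Hence the powers of \<open>\<psi>\<close> divided by \<open>lam ^ Suc n\<close> form a Cauchy sequence in
  \<open>L\<^sup>2\<close>, and, after one more convolution, uniformly; the limit \<open>e\<close> absorbs \<open>\<psi> / lam\<close> and itself.  The norm estimate
  holds since the square norms of the iterates of \<open>\<kappa>\<close> on \<open>\<xi>\<close> are log-convex and grow at most like \<open>lam ^ n\<close>.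
\<close>
theorem top_idempotent:
  assumes \<kappa>: "\<kappa> \<in> bounded_borel" and nz: "L2_nrm \<mu> \<kappa> \<noteq> 0"
  obtains lam e where "lam > 0" "eigen_idempotent lam (conv \<kappa> (star \<kappa>)) e"
    "\<And>\<xi>. \<xi> \<in> bounded_borel \<Longrightarrow> (L2_nrm \<mu> (conv \<kappa> \<xi>))\<^sup>2 \<le> lam * (L2_nrm \<mu> \<xi>)\<^sup>2"
proof -
  define \<psi> where "\<psi> = conv \<kappa> (star \<kappa>)"
  have \<psi>: "\<psi> \<in> bounded_borel" "star \<psi> = \<psi>" using \<kappa> by (auto simp: \<psi>_def conv_bounded_borel bounded_borel_star conv_star_self)
  define s where "s n = (L2_nrm \<mu> (conv_power \<kappa> n))\<^sup>2" for n
  have \<kappa>n: "conv_power \<kappa> n \<in> bounded_borel" for n by (rule conv_power_bounded_borel[OF \<kappa>])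
  have \<psi>n: "conv_power \<psi> n = conv (conv_power \<kappa> n) (star (conv_power \<kappa> n))" for n
    unfolding \<psi>_def using \<kappa> by (simp add: conv_power_conv bounded_borel_star conv_power_star)
  have \<psi>Bd: "conv_power \<psi> n \<in> bounded_borel" for n by (rule conv_power_bounded_borel[OF \<psi>(1)])
  have \<psi>0: "conv_power \<psi> n 0 = of_real (s n)" for n
    unfolding \<psi>n s_def by (rule conv_self_0[OF \<kappa>n])
  have \<psi>le: "norm (conv_power \<psi> n x) \<le> s n" for n x
    unfolding \<psi>n s_def by (rule conv_star_le[OF \<kappa>n])
  have cont: "continuous_on UNIV (conv_power \<psi> n)" for n
    unfolding \<psi>n by (intro conv_continuous \<kappa>n bounded_borel_star)
  have convex: "(s (Suc n))\<^sup>2 \<le> s n * s (Suc (Suc n))" for n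
    unfolding s_def using iterate_log_convex[OF \<kappa> \<kappa>n] by simp
  have s0: "s 0 > 0" using nz by (simp add: s_def)
  \<comment> \<open>otherwise \<open>\<psi> * star \<psi>\<close> vanishes at the identity, hence \<open>\<psi> = 0\<close>\<close>
  have s1: "s 1 > 0"
  proof (rule ccontr)
    assume "\<not> s 1 > 0"
    then have "s 1 = 0" by (simp add: s_def)
    then have "conv \<psi> (star \<psi>) 0 = 0" using \<psi>0[of 1] \<psi> by simp
    then have "L2_nrm \<mu> \<psi> = 0" using conv_self_0[OF \<psi>(1)] by simp
    then have "\<psi> 0 = 0" using L2_nrm_continuous_eq_0[of \<psi>] cont[of 0] by simp
    then show False using \<psi>0[of 0] s0 by simp
  qed
  have pos2: "s n > 0 \<and> s (Suc n) > 0" for n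
  proof (induction n)
    case (Suc n)
    then have "s n * s (Suc (Suc n)) > 0" using convex[of n] by (smt (verit) zero_less_power)
    then show ?case using Suc by (simp add: zero_less_mult_iff)
  qed (use s0 s1 in simp)
  have sub: "s (Suc (m + n)) \<le> total * s m * s n" for m n
  proof -
    have "s (Suc (m + n)) = norm (conv_power \<psi> (Suc (m + n)) 0)"
      unfolding \<psi>0 norm_of_real by (simp add: s_def)
    also have "\<dots> = norm (conv (conv_power \<psi> m) (conv_power \<psi> n) 0)" by (simp only: conv_power_add[OF \<psi>(1)])
    also have "\<dots> \<le> s m * (LINT y|\<mu>. norm (conv_power \<psi> n y))"
      by (intro conv_le_sup \<psi>Bd \<psi>le)
    also have "\<dots> \<le> s m * (LINT y|\<mu>. s n)"
      using \<psi>le pos2 by (intro mult_left_mono integral_mono integrable_norm bounded_borel_integrable \<psi>Bd) (auto intro: less_imp_le)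
    finally show ?thesis by (simp add: total_def mult_ac)
  qed
  obtain lam where lam: "lam > 0" and ratio: "\<And>n. s (Suc n) \<le> lam * s n"
    and lower: "\<And>n. lam ^ Suc n \<le> total * s n"
    using log_convex_submultiplicative[of s total, OF _ convex sub] pos2 by metis
  have s_le: "s n \<le> s 0 * lam ^ n" for n
  proof (induction n)
    case (Suc n)
    have "s (Suc n) \<le> lam * s n" by (rule ratio)
    also have "\<dots> \<le> lam * (s 0 * lam ^ n)" using Suc lam by simp
    finally show ?case by (simp add: mult_ac)
  qed simp
  have estimate: "(L2_nrm \<mu> (conv \<kappa> \<xi>))\<^sup>2 \<le> lam * (L2_nrm \<mu> \<xi>)\<^sup>2" if \<xi>: "\<xi> \<in> bounded_borel" for \<xi>
  proof -
    define A where "A n = (conv \<kappa> ^^ n) \<xi>" for n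
    have ABd: "A n \<in> bounded_borel" for n unfolding A_def by (induction n) (auto intro: \<xi> conv_bounded_borel \<kappa>)
    have Asuc: "A (Suc n) = conv \<kappa> (A n)" for n by (simp add: A_def)
    have A': "A (Suc n) = conv (conv_power \<kappa> n) \<xi>" for n
      by (induction n) (auto simp: A_def conv_assoc \<kappa> \<kappa>n \<xi>)
    define X where "X = conv \<xi> (star \<xi>)"
    have X: "X \<in> bounded_borel" by (simp add: X_def conv_bounded_borel bounded_borel_star \<xi>)
    define I where "I = (LINT y|\<mu>. norm (X y))"
    have I: "I \<ge> 0" unfolding I_def by (rule Bochner_Integration.integral_nonneg) auto
    define b where "b n = (L2_nrm \<mu> (A n))\<^sup>2" for n
    define C where "C = b 0 + s 0 * I / lam"
    have bSuc: "b (Suc n) \<le> s n * I" for n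
    proof -
      have "complex_of_real (b (Suc n)) = conv (A (Suc n)) (star (A (Suc n))) 0"
        unfolding b_def by (rule conv_self_0[symmetric, OF ABd])
      also have "conv (A (Suc n)) (star (A (Suc n))) = conv (conv_power \<psi> n) X"
        unfolding A' \<psi>n X_def using \<kappa>n[of n] \<xi> by (simp add: conv_star) (simp add: conv_ac conv_bounded_borel bounded_borel_star)
      finally have "b (Suc n) = norm (conv (conv_power \<psi> n) X 0)"
        by (metis abs_of_nonneg b_def norm_of_real zero_le_power2)
      also have "\<dots> \<le> s n * I" unfolding I_def by (intro conv_le_sup \<psi>Bd X \<psi>le)
      finally show ?thesis .
    qed
    have "b 1 \<le> lam * b 0"
    proof (rule log_convex_growth[OF _ _ lam])
      show "b n \<ge> 0" for n by (simp add: b_def)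
      show "(b (Suc n))\<^sup>2 \<le> b n * b (Suc (Suc n))" for n
        unfolding b_def Asuc by (rule iterate_log_convex[OF \<kappa> ABd])
      show "b n \<le> C * lam ^ n" for n
      proof (cases n)
        case 0 then show ?thesis using s0 I lam by (simp add: C_def)
      next
        case (Suc m)
        have "b n \<le> s m * I" using bSuc Suc by simp
        also have "\<dots> \<le> (s 0 * lam ^ m) * I" by (intro mult_right_mono s_le I)
        also have "\<dots> = (s 0 * I / lam) * lam ^ n" using lam Suc by simp
        also have "\<dots> \<le> C * lam ^ n" using lam by (intro mult_right_mono) (auto simp: C_def b_def)
        finally show ?thesis .
      qed
    qed
    then show ?thesis by (simp add: b_def A_def)
  qed
  define t where "t n = s n / lam ^ Suc n" for n
  define p where "p n x = of_real (1 / lam ^ Suc n) * conv_power \<psi> n x" for n x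
  have pBd: "p n \<in> bounded_borel" for n unfolding p_def[abs_def] by (intro bounded_borel_scale \<psi>Bd)
  have p0: "p n 0 = of_real (t n)" for n by (simp add: p_def t_def \<psi>0)
  have pstar: "star (p n) = p n" for n
  proof
    fix x
    have "cnj (conv_power \<psi> n (- x)) = star (conv_power \<psi> n) x" by (simp add: star_def)
    also have "\<dots> = conv_power \<psi> n x" by (simp only: conv_power_star[OF \<psi>(1)] \<psi>(2))
    finally show "star (p n) x = p n x" by (simp add: star_def p_def)
  qed
  have pp: "conv (p m) (p n) = p (Suc (m + n))" for m n
  proof
    fix x
    have "conv (p m) (p n) x = of_real (1 / lam ^ Suc m) * (of_real (1 / lam ^ Suc n) * conv (conv_power \<psi> m) (conv_power \<psi> n) x)"
      unfolding p_def[abs_def] by (simp only: conv_scale_left conv_scale_right)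
    then show "conv (p m) (p n) x = p (Suc (m + n)) x"
      by (simp add: p_def conv_power_add[OF \<psi>(1)] power_add)
  qed
  have dec: "decseq t"
  proof (rule decseq_SucI)
    show "t (Suc n) \<le> t n" for n using ratio[of n] lam by (simp add: t_def field_simps)
  qed
  have t_ge: "1 / total \<le> t n" for n
    using lower[of n] lam total_pos by (simp add: t_def field_simps)
  obtain T where T: "t \<longlonglongrightarrow> T" using decseq_convergent[OF dec, of "1 / total"] t_ge by blast
  \<comment> \<open>all inner products of the normalised powers are values of \<open>t\<close>\<close>
  have dist: "(L2_nrm \<mu> (\<lambda>x. p j x - p k x))\<^sup>2 = t (Suc (j + j)) - 2 * t (Suc (j + k)) + t (Suc (k + k))" for j k
  proof -
    define d where "d = (\<lambda>x. p j x - p k x)"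
    have d: "d \<in> bounded_borel" unfolding d_def by (intro bounded_borel_diff pBd)
    have pd: "conv (p i) d 0 = of_real (t (Suc (i + j)) - t (Suc (i + k)))" for i
    proof -
      have "conv (p i) d 0 = conv d (p i) 0" by (simp add: conv_commute pBd d)
      also have "\<dots> = conv (p j) (p i) 0 - conv (p k) (p i) 0"
        unfolding d_def by (intro conv_diff_left pBd)
      finally show ?thesis by (simp add: pp p0 add.commute)
    qed
    have "star d = d" using pstar by (simp add: d_def star_def fun_eq_iff)
    then have "complex_of_real ((L2_nrm \<mu> d)\<^sup>2) = conv d d 0" using conv_self_0[OF d] by simp
    also have "\<dots> = conv (p j) d 0 - conv (p k) d 0"
      by (subst (1) d_def) (intro conv_diff_left pBd d)
    finally have "complex_of_real ((L2_nrm \<mu> d)\<^sup>2) = of_real (t (Suc (j + j)) - 2 * t (Suc (j + k)) + t (Suc (k + k)))"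
      by (simp add: pd add.commute)
    then show ?thesis unfolding d_def by (simp only: of_real_eq_iff)
  qed
  \<comment> \<open>convolving with \<open>p 0\<close> turns convergence in \<open>L\<^sup>2\<close> into uniform convergence\<close>
  have unif: "norm (p (Suc j) x - p (Suc k) x) \<le> L2_nrm \<mu> (\<lambda>x. p j x - p k x) * L2_nrm \<mu> (p 0)" for j k x
  proof -
    have "p (Suc j) x - p (Suc k) x = conv (\<lambda>x. p j x - p k x) (p 0) x"
      by (simp add: conv_diff_left pBd pp)
    then show ?thesis using conv_le_L2[OF bounded_borel_diff[OF pBd pBd] pBd] by simp
  qed
  have "uniformly_Cauchy_on UNIV (\<lambda>n. p (Suc n))"
  proof (rule uniformly_Cauchy_onI)
    fix r :: real assume r: "r > 0"
    define c where "c = L2_nrm \<mu> (p 0)"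
    have c: "c \<ge> 0" by (simp add: c_def)
    define r' where "r' = (r / (c + 1))\<^sup>2"
    have r': "r' > 0" using r c by (simp add: r'_def)
    then obtain N where N: "\<And>n. n \<ge> N \<Longrightarrow> \<bar>t n - T\<bar> < r' / 4"
      using LIMSEQ_D[OF T, of "r' / 4"] by auto
    show "\<exists>M. \<forall>x\<in>UNIV. \<forall>m\<ge>M. \<forall>n\<ge>M. dist (p (Suc m) x) (p (Suc n) x) < r"
    proof (intro exI ballI allI impI)
      fix x m n assume "m \<ge> N" "n \<ge> N"
      then have "(L2_nrm \<mu> (\<lambda>x. p m x - p n x))\<^sup>2 < r'"
        unfolding dist using N[of "Suc (m + m)"] N[of "Suc (m + n)"] N[of "Suc (n + n)"]
        by (simp add: abs_if split: if_splits)
      then have "L2_nrm \<mu> (\<lambda>x. p m x - p n x) < r / (c + 1)"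
        unfolding r'_def by (rule power2_less_imp_less) (use r c in simp)
      then have "L2_nrm \<mu> (\<lambda>x. p m x - p n x) * c \<le> r / (c + 1) * c"
        using c by (intro mult_right_mono) auto
      also have "\<dots> < r" using r c by (simp add: field_simps)
      finally show "dist (p (Suc m) x) (p (Suc n) x) < r"
        using unif[of m x n] by (simp add: dist_norm c_def)
    qed
  qed
  then obtain e where lim: "uniform_limit UNIV (\<lambda>n. p (Suc n)) e sequentially"
    using Cauchy_uniformly_convergent uniformly_convergent_on_def by blast
  have pcont: "continuous_on UNIV (p (Suc n))" for n
    unfolding p_def[abs_def] by (intro continuous_on_mult continuous_on_const cont)
  have e_cont: "continuous_on UNIV e"
    by (rule uniform_limit_theorem[OF always_eventually[OF allI[OF pcont]] lim]) simp
  have eBd: "e \<in> bounded_borel" by (rule bounded_borel_continuous[OF e_cont])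
  have ptw: "(\<lambda>n. p (Suc n) x) \<longlonglongrightarrow> e x" for x
    using tendsto_uniform_limitI[OF lim] by simp
  have ep: "conv e (p k) = e" for k
  proof
    fix x
    have "(\<lambda>n. conv (p (Suc n)) (p k) x) \<longlonglongrightarrow> conv e (p k) x"
      by (rule conv_uniform_limit[OF lim pBd eBd pBd])
    moreover have "(\<lambda>n. conv (p (Suc n)) (p k) x) \<longlonglongrightarrow> e x"
      using LIMSEQ_ignore_initial_segment[OF ptw[of x], of "Suc k"] by (simp add: pp)
    ultimately show "conv e (p k) x = e x" by (rule LIMSEQ_unique)
  qed
  have ee: "conv e e = e"
  proof
    fix x
    have "(\<lambda>n. conv (p (Suc n)) e x) \<longlonglongrightarrow> conv e e x"
      by (rule conv_uniform_limit[OF lim pBd eBd eBd])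
    moreover have "conv (p (Suc n)) e = e" for n using ep[of "Suc n"] by (simp add: conv_commute pBd eBd)
    ultimately have "(\<lambda>n. e x) \<longlonglongrightarrow> conv e e x" by simp
    then show "conv e e x = e x" by (simp add: LIMSEQ_const_iff)
  qed
  have "conv e \<psi> = (\<lambda>x. lam * e x)"
  proof
    fix x
    have "\<psi> = (\<lambda>x. of_real lam * p 0 x)" using lam by (simp add: p_def)
    then have "conv e \<psi> x = of_real lam * conv e (p 0) x" by (simp add: conv_scale_right)
    then show "conv e \<psi> x = lam * e x" by (simp add: ep)
  qed
  moreover have "star e = e"
  proof
    fix x
    have "(\<lambda>n. star (p (Suc n)) x) \<longlonglongrightarrow> star e x"
      unfolding star_def by (intro tendsto_cnj ptw)
    then show "star e x = e x" using LIMSEQ_unique[OF ptw] pstar by simp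
  qed
  moreover have "e 0 \<noteq> 0"
  proof -
    have "(\<lambda>n. t (Suc n)) \<longlonglongrightarrow> T" using T by (rule LIMSEQ_Suc)
    then have "(\<lambda>n. p (Suc n) 0) \<longlonglongrightarrow> of_real T" unfolding p0 by (rule tendsto_of_real)
    then have "e 0 = of_real T" using LIMSEQ_unique[OF ptw] by blast
    moreover have "1 / total \<le> T" using T by (rule LIMSEQ_le_const) (use t_ge in blast)
    ultimately show ?thesis using total_pos by auto
  qed
  ultimately show ?thesis
    using that[OF lam _ estimate] e_cont ee by (simp add: eigen_idempotent_def \<psi>_def)
qed

end

section \<open>Characters as minimal idempotents\<close>

context compact_haar begin

text \<open>
  For a function \<open>g\<close> this is the transform, in the sense of \<open>pm_transform\<close>, of the measure with density \<open>g\<close>.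
\<close>
definition hat :: "('a \<Rightarrow> complex) \<Rightarrow> ('a \<Rightarrow> complex) \<Rightarrow> complex"
  where "hat g \<gamma> = (LINT y|\<mu>. g y * cnj (\<gamma> y))"

lemma dual_groupD:
  assumes "\<gamma> \<in> dual_group"
  shows "continuous_on UNIV \<gamma>" "\<gamma> (x + y) = \<gamma> x * \<gamma> y" "norm (\<gamma> x) = 1"
    "\<gamma> 0 = 1" "\<gamma> (- x) = cnj (\<gamma> x)" "\<gamma> (x - y) = \<gamma> x * cnj (\<gamma> y)" "\<gamma> x * cnj (\<gamma> x) = 1"
    "cnj (\<gamma> x) * \<gamma> x = 1" "\<gamma> \<in> bounded_borel"
proof -
  show cont: "continuous_on UNIV \<gamma>" and add: "\<gamma> (x + y) = \<gamma> x * \<gamma> y" for x y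
    using assms by (auto simp: dual_group_def)
  show n: "norm (\<gamma> x) = 1" for x using assms by (auto simp: dual_group_def)
  have "\<gamma> 0 * \<gamma> 0 = \<gamma> 0" using add[of 0 0] by simp
  moreover have "\<gamma> 0 \<noteq> 0" using n[of 0] by auto
  ultimately show zero: "\<gamma> 0 = 1" by simp
  show c: "\<gamma> x * cnj (\<gamma> x) = 1" for x
    using complex_norm_square[of "\<gamma> x"] n[of x] by simp
  then show "cnj (\<gamma> x) * \<gamma> x = 1" for x by (simp add: mult.commute)
  show neg: "\<gamma> (- x) = cnj (\<gamma> x)" for x
  proof -
    have "\<gamma> x * \<gamma> (- x) = \<gamma> x * cnj (\<gamma> x)" using add[of x "- x"] zero c[of x] by simp
    moreover have "\<gamma> x \<noteq> 0" using n[of x] by auto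
    ultimately show ?thesis by simp
  qed
  show "\<gamma> (x - y) = \<gamma> x * cnj (\<gamma> y)" using add[of x "- y"] neg[of y] by simp
  show "\<gamma> \<in> bounded_borel" by (rule bounded_borel_continuous[OF cont])
qed

lemma conv_character:
  assumes \<gamma>: "\<gamma> \<in> dual_group" shows "conv \<gamma> g x = \<gamma> x * hat g \<gamma>"
proof -
  have "conv \<gamma> g x = (LINT y|\<mu>. \<gamma> x * (g y * cnj (\<gamma> y)))"
    by (simp add: conv_def dual_groupD(6)[OF \<gamma>] mult_ac)
  then show ?thesis by (simp add: hat_def)
qed

lemma hat_star:
  assumes \<gamma>: "\<gamma> \<in> dual_group" and g: "g \<in> bounded_borel" shows "hat (star g) \<gamma> = cnj (hat g \<gamma>)"
proof -
  have "(\<lambda>y. cnj (g y) * \<gamma> y) \<in> borel_measurable borel"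
    by (intro bounded_borel_measurable bounded_borel_mult bounded_borel_cnj g dual_groupD(9)[OF \<gamma>])
  from integral_reflect[OF this, of 0]
  have "hat (star g) \<gamma> = (LINT y|\<mu>. cnj (g y) * \<gamma> y)"
    by (simp add: hat_def star_def dual_groupD(5)[OF \<gamma>])
  also have "\<dots> = (LINT y|\<mu>. cnj (g y * cnj (\<gamma> y)))"
    by (rule Bochner_Integration.integral_cong) simp_all
  also have "\<dots> = cnj (hat g \<gamma>)" unfolding hat_def by (rule Bochner_Integration.integral_cnj)
  finally show ?thesis .
qed

lemma hat_conv_star:
  assumes \<gamma>: "\<gamma> \<in> dual_group" and g: "g \<in> bounded_borel"
  shows "conv \<gamma> (conv g (star g)) x = of_real ((norm (hat g \<gamma>))\<^sup>2) * \<gamma> x"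
proof -
  have "conv \<gamma> (conv g (star g)) = conv (conv \<gamma> g) (star g)"
    by (simp add: conv_assoc g bounded_borel_star dual_groupD(9)[OF \<gamma>])
  also have "conv \<gamma> g = (\<lambda>x. hat g \<gamma> * \<gamma> x)" by (simp add: fun_eq_iff conv_character[OF \<gamma>])
  finally have "conv \<gamma> (conv g (star g)) x = conv (\<lambda>x. hat g \<gamma> * \<gamma> x) (star g) x" by simp
  also have "\<dots> = hat g \<gamma> * (\<gamma> x * cnj (hat g \<gamma>))"
    by (simp only: conv_scale_left conv_character[OF \<gamma>] hat_star[OF \<gamma> g])
  also have "\<dots> = of_real ((norm (hat g \<gamma>))\<^sup>2) * \<gamma> x" by (simp only: complex_norm_square mult_ac)
  finally show ?thesis .
qed

text \<open>
  For a self-adjoint idempotent, \<open>e 0\<close> is both the square norm and the maximum of \<open>|e|\<close>, and comparing the two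
  bounds it from below by a constant that does not depend on \<open>e\<close>.
\<close>
lemma idempotent_facts:
  assumes cont: "continuous_on UNIV e" and star: "star e = e" and idem: "conv e e = e" and nz: "e 0 \<noteq> 0"
  shows "e \<in> bounded_borel" "e 0 = of_real ((L2_nrm \<mu> e)\<^sup>2)" "1 / total \<le> (L2_nrm \<mu> e)\<^sup>2"
proof -
  show e: "e \<in> bounded_borel" by (rule bounded_borel_continuous[OF cont])
  show e0: "e 0 = of_real ((L2_nrm \<mu> e)\<^sup>2)" using conv_self_0[OF e] star idem by simp
  define N where "N = (L2_nrm \<mu> e)\<^sup>2"
  have N: "N > 0" using nz e0 by (auto simp: N_def)
  have le: "norm (e x) \<le> N" for x using conv_star_le[OF e, of x] star idem by (simp add: N_def)
  have "N = (LINT x|\<mu>. (norm (e x))\<^sup>2)" unfolding N_def by (rule L2_nrm_square)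
  also have "\<dots> \<le> (LINT x|\<mu>. N\<^sup>2)"
    using le by (intro integral_mono L2_integrable_square bounded_borel_L2 e power_mono) auto
  also have "\<dots> = total * N\<^sup>2" by (simp add: total_def)
  finally have "1 / total \<le> N"
    using N total_pos by (simp add: field_simps power2_eq_square)
  then show "1 / total \<le> (L2_nrm \<mu> e)\<^sup>2" by (simp only: N_def)
qed

lemma translation_eigenvector_character:
  assumes cont: "continuous_on UNIV e" and star: "star e = e" and e0: "e 0 = of_real r" and r: "r \<noteq> 0"
    and eig: "\<And>a. \<exists>c. \<forall>x. e (x + a) = c * e x"
  shows "(\<lambda>x. e x / e 0) \<in> dual_group"
proof -
  define \<gamma> where "\<gamma> x = e x / e 0" for x
  have nz: "e 0 \<noteq> 0" using e0 r by simp
  have add: "\<gamma> (x + y) = \<gamma> x * \<gamma> y" for x y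
  proof -
    obtain c where c: "\<And>x. e (x + y) = c * e x" using eig[of y] by blast
    have "e y = c * e 0" using c[of 0] by simp
    then show ?thesis using c[of x] nz by (simp add: \<gamma>_def)
  qed
  have "cnj (\<gamma> x) = \<gamma> (- x)" for x
    using fun_cong[OF star, of "- x"] by (simp add: \<gamma>_def star_def e0)
  then have "\<gamma> x * cnj (\<gamma> x) = 1" for x using add[of x "- x"] nz by (simp add: \<gamma>_def)
  then have "complex_of_real ((norm (\<gamma> x))\<^sup>2) = of_real 1" for x by (simp only: complex_norm_square of_real_1)
  then have "(norm (\<gamma> x))\<^sup>2 = 1" for x by (simp only: of_real_eq_iff)
  then have "norm (\<gamma> x) = 1" for x by (simp add: power2_eq_1_iff) (smt (verit) norm_ge_zero)
  moreover have "continuous_on UNIV \<gamma>" unfolding \<gamma>_def using nz by (intro continuous_intros cont) auto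
  ultimately show ?thesis using add by (simp add: dual_group_def \<gamma>_def[symmetric])
qed

text \<open>
  Choose an idempotent \<open>e\<close> in the eigenspace whose square norm is within \<open>1 / total\<close> of the infimum.  It is
  indecomposable: if \<open>e = e' + e''\<close> with both summands idempotents in the eigenspace, their square norms add up, and one
  is at least the infimum, the other at least \<open>1 / total\<close>.  For \<open>\<alpha> x = e x + c * e (x + a)\<close> the function \<open>\<alpha> * star \<alpha>\<close> lies in the ideal generated by \<open>e\<close>.
  Its top idempotent is a part of \<open>e\<close>, hence equal to \<open>e\<close>, and therefore \<open>\<alpha> * star \<alpha>\<close> is a multiple of \<open>e\<close>.  Expanding it for
  \<open>c = 1\<close> and \<open>c = \<i>\<close> shows that every translate of \<open>e\<close> is a multiple of \<open>e\<close>.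
\<close>
theorem eigen_character:
  assumes \<psi>: "\<psi> \<in> bounded_borel" and e0: "eigen_idempotent lam \<psi> e0"
  obtains \<gamma> where "\<gamma> \<in> dual_group" "conv \<gamma> \<psi> = (\<lambda>x. lam * \<gamma> x)"
proof -
  define S where "S = {e. eigen_idempotent lam \<psi> e}"
  define N where "N e = (L2_nrm \<mu> e)\<^sup>2" for e :: "'a \<Rightarrow> complex"
  have SD: "continuous_on UNIV e" "star e = e" "conv e e = e" "conv e \<psi> = (\<lambda>x. lam * e x)" "e 0 \<noteq> 0"
    "e \<in> bounded_borel" "e 0 = of_real (N e)" "1 / total \<le> N e" if "e \<in> S" for e :: "'a \<Rightarrow> complex"
    using that idempotent_facts[of e] by (auto simp: S_def eigen_idempotent_def N_def)
  have ne: "S \<noteq> {}" using e0 by (auto simp: S_def)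
  have bdd: "bdd_below (N ` S)" by (rule bdd_belowI2[of _ "1 / total"]) (rule SD(8))
  have "\<exists>e\<in>S. N e < Inf (N ` S) + 1 / total"
    using cInf_lessD[of "N ` S" "Inf (N ` S) + 1 / total"] ne total_pos by auto
  then obtain e where e: "e \<in> S" and small: "N e < Inf (N ` S) + 1 / total" by blast
  note eD = SD[OF e]
  have min: "Inf (N ` S) \<le> N e'" if "e' \<in> S" for e' by (rule cINF_lower[OF bdd that])
  have \<theta>: "\<exists>m. \<forall>x. c * e (x + a) + cnj c * e (x - a) = m * e x" if c: "norm c = 1" for c a
  proof -
    define \<alpha> where "\<alpha> x = e x + c * e (x + a)" for x
    have \<alpha>: "\<alpha> \<in> bounded_borel" unfolding \<alpha>_def[abs_def] by (intro bounded_borel_add bounded_borel_scale bounded_borel_translate eD)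
    have \<alpha>cont: "continuous_on UNIV \<alpha>"
    proof -
      have "continuous_on UNIV (\<lambda>x. e (x + a))"
        by (rule continuous_on_compose2[OF eD(1)]) (auto intro: continuous_intros)
      then show ?thesis unfolding \<alpha>_def[abs_def] by (intro continuous_on_add continuous_on_mult continuous_on_const eD(1))
    qed
    have cc: "c * cnj c = 1" using complex_norm_square[of c] c by simp
    have star\<alpha>: "star \<alpha> = (\<lambda>x. e x + cnj c * e (x - a))"
    proof
      fix x
      have "cnj (e (- y)) = e y" for y using fun_cong[OF eD(2), of y] by (simp add: star_def)
      from this[of x] this[of "x - a"] show "star \<alpha> x = e x + cnj c * e (x - a)"
        by (simp add: star_def \<alpha>_def)
    qed
    have e\<alpha>: "conv e \<alpha> = \<alpha>"
    proof
      fix x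
      have "conv e \<alpha> x = conv \<alpha> e x" by (simp add: conv_commute eD(6) \<alpha>)
      also have "\<dots> = conv e e x + c * conv e e (x + a)"
        unfolding \<alpha>_def[abs_def]
        by (simp add: conv_add_left bounded_borel_scale bounded_borel_translate eD(6) conv_scale_left conv_translate_left)
      finally show "conv e \<alpha> x = \<alpha> x" by (simp add: eD(3) \<alpha>_def)
    qed
    define \<psi>' where "\<psi>' = conv \<alpha> (star \<alpha>)"
    have \<psi>': "\<psi>' \<in> bounded_borel" by (simp add: \<psi>'_def conv_bounded_borel \<alpha> bounded_borel_star)
    have e\<psi>': "conv e \<psi>' = \<psi>'"
      unfolding \<psi>'_def using conv_assoc[OF eD(6) \<alpha> bounded_borel_star[OF \<alpha>]] e\<alpha> by simp
    have expand: "\<psi>' x = 2 * e x + (c * e (x + a) + cnj c * e (x - a))" for x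
    proof -
      have es: "conv e (star \<alpha>) y = e y + cnj c * e (y - a)" for y
      proof -
        have "conv e (star \<alpha>) y = conv (star \<alpha>) e y" by (simp add: conv_commute eD(6) \<alpha> bounded_borel_star)
        also have "\<dots> = conv e e y + cnj c * conv e e (y - a)"
          unfolding star\<alpha> using conv_translate_left[of e "- a" e y] bounded_borel_translate[OF eD(6), of "- a"]
          by (simp add: conv_add_left bounded_borel_scale eD(6) conv_scale_left)
        finally show ?thesis by (simp add: eD(3))
      qed
      have "\<psi>' x = conv e (star \<alpha>) x + c * conv e (star \<alpha>) (x + a)"
        unfolding \<psi>'_def by (subst \<alpha>_def[abs_def])
          (simp add: conv_add_left bounded_borel_scale bounded_borel_translate eD(6) conv_scale_left conv_translate_left \<alpha> bounded_borel_star)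
      also have "\<dots> = e x + cnj c * e (x - a) + (c * e (x + a) + (c * cnj c) * e x)"
        by (simp add: es algebra_simps)
      finally show ?thesis by (simp add: cc)
    qed
    have "\<exists>m'. \<forall>x. \<psi>' x = m' * e x"
    proof (cases "L2_nrm \<mu> \<alpha> = 0")
      case True
      then have "\<psi>' x = 0" for x
        using conv_le_L2[OF \<alpha> bounded_borel_star[OF \<alpha>], of x] by (simp add: \<psi>'_def)
      then show ?thesis by (intro exI[of _ 0]) simp
    next
      case False
      then obtain lam' e' where lam': "lam' > 0" and e': "eigen_idempotent lam' \<psi>' e'"
        using top_idempotent[OF \<alpha>] unfolding \<psi>'_def by metis
      then have e'D: "continuous_on UNIV e'" "star e' = e'" "conv e' e' = e'" "conv e' \<psi>' = (\<lambda>x. lam' * e' x)" "e' 0 \<noteq> 0"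
        by (auto simp: eigen_idempotent_def)
      have e'Bd: "e' \<in> bounded_borel" by (rule bounded_borel_continuous[OF e'D(1)])
      have scaled: "e' = (\<lambda>x. of_real (1 / lam') * conv e' \<psi>' x)" using lam' by (simp add: e'D(4))
      have e'e: "conv e' e = e'"
      proof
        fix x
        have "conv e' e x = of_real (1 / lam') * conv (conv e' \<psi>') e x"
          by (subst scaled) (rule conv_scale_left)
        also have "conv (conv e' \<psi>') e = conv e' (conv e \<psi>')"
          by (simp add: conv_ac e'Bd \<psi>' eD(6) conv_bounded_borel)
        also have "of_real (1 / lam') * conv e' (conv e \<psi>') x = e' x" by (simp add: e\<psi>' e'D(4)) (use lam' in simp)
        finally show "conv e' e x = e' x" .
      qed
      have e'\<psi>: "conv e' \<psi> = (\<lambda>x. lam * e' x)"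
      proof
        fix x
        have "conv e' \<psi> = conv e' (conv e \<psi>)" using conv_assoc[OF e'Bd eD(6) \<psi>] e'e by simp
        then have "conv e' \<psi> x = lam * conv e' e x" by (simp add: eD(4) conv_scale_right)
        then show "conv e' \<psi> x = lam * e' x" by (simp add: e'e)
      qed
      have e'S: "e' \<in> S" using e'D e'\<psi> by (simp add: S_def eigen_idempotent_def)
      \<comment> \<open>the complementary part of \<open>e\<close>; if it did not vanish, \<open>e\<close> would be decomposable\<close>
      define e'' where "e'' x = e x - e' x" for x
      have e''Bd: "e'' \<in> bounded_borel" unfolding e''_def[abs_def] by (intro bounded_borel_diff eD(6) e'Bd)
      have e''cont: "continuous_on UNIV e''"
        unfolding e''_def[abs_def] by (intro continuous_on_diff eD(1) e'D(1))
      have e''star: "star e'' = e''"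
        using eD(2) e'D(2) by (simp add: e''_def[abs_def] star_def[abs_def] fun_eq_iff)
      have ee': "conv e e' = e'" using e'e conv_commute[OF eD(6) e'Bd] by simp
      have ce'': "conv e'' h x = conv e h x - conv e' h x" if "h \<in> bounded_borel" for h x
        unfolding e''_def[abs_def] by (intro conv_diff_left eD(6) e'Bd that)
      have e''idem: "conv e'' e'' = e''"
      proof
        fix x
        have "conv e'' e = e''" "conv e'' e' = (\<lambda>x. 0)"
          by (auto simp: fun_eq_iff ce'' eD(6) e'Bd eD(3) e'e ee' e'D(3) e''_def)
        then have "conv e e'' = e''" "conv e' e'' = (\<lambda>x. 0)"
          by (simp_all add: conv_commute eD(6) e'Bd e''Bd)
        then show "conv e'' e'' x = e'' x" by (simp add: ce'' e''Bd)
      qed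
      have e''\<psi>: "conv e'' \<psi> = (\<lambda>x. lam * e'' x)"
        by (simp add: fun_eq_iff ce'' \<psi> eD(4) e'\<psi> e''_def right_diff_distrib)
      have "e'' 0 = 0"
      proof (rule ccontr)
        assume "e'' 0 \<noteq> 0"
        then have e''S: "e'' \<in> S"
          using e''cont e''star e''idem e''\<psi> by (simp add: S_def eigen_idempotent_def)
        have "e 0 = e' 0 + e'' 0" by (simp add: e''_def)
        then have "complex_of_real (N e) = of_real (N e' + N e'')"
          by (simp only: SD(7)[OF e] SD(7)[OF e'S] SD(7)[OF e''S] of_real_add)
        then have "N e = N e' + N e''" by (simp only: of_real_eq_iff)
        then show False using SD(8)[OF e''S] min[OF e'S] small by linarith
      qed
      then have "(L2_nrm \<mu> e'')\<^sup>2 = 0"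
        using conv_self_0[OF e''Bd] by (simp add: e''star e''idem)
      then have "e'' x = 0" for x using L2_nrm_continuous_eq_0[OF e''cont] by simp
      then have e'_eq: "e' = e" by (simp add: e''_def fun_eq_iff)
      have "\<psi>' = (\<lambda>x. lam' * e x)" using e'D(4) unfolding e'_eq e\<psi>' .
      then have "\<psi>' x = lam' * e x" for x by simp
      then show ?thesis by blast
    qed
    then obtain m' where m': "\<And>x. \<psi>' x = m' * e x" by blast
    have "c * e (x + a) + cnj c * e (x - a) = (m' - 2) * e x" for x
      using expand[of x] m'[of x] by (simp add: algebra_simps)
    then show ?thesis by blast
  qed
  \<comment> \<open>polarisation: the combinations for \<open>c = 1\<close> and \<open>c = \<i>\<close> determine the translate by \<open>a\<close>\<close>
  have "\<exists>m. \<forall>x. e (x + a) = m * e x" for a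
  proof -
    obtain m n where m: "\<And>x. 1 * e (x + a) + cnj 1 * e (x - a) = m * e x"
      and n: "\<And>x. \<i> * e (x + a) + cnj \<i> * e (x - a) = n * e x"
      using \<theta>[of 1 a] \<theta>[of \<i> a] by auto
    have "e (x + a) = ((m - \<i> * n) / 2) * e x" for x
    proof -
      have "2 * e (x + a) = (1 * e (x + a) + cnj 1 * e (x - a)) - \<i> * (\<i> * e (x + a) + cnj \<i> * e (x - a))"
        by (simp add: algebra_simps)
      also have "\<dots> = (m - \<i> * n) * e x" unfolding m n by (simp add: algebra_simps)
      finally show ?thesis by (simp add: field_simps)
    qed
    then show ?thesis by blast
  qed
  then have "(\<lambda>x. e x / e 0) \<in> dual_group"
    by (intro translation_eigenvector_character[OF eD(1,2,7)]) (use eD(5,7) in auto)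
  moreover have "conv (\<lambda>x. e x / e 0) \<psi> = (\<lambda>x. lam * (e x / e 0))"
    using conv_scale_left[of "inverse (e 0)" e \<psi>] by (simp add: fun_eq_iff eD(4) field_simps)
  ultimately show ?thesis by (rule that)
qed

text \<open>
  The top eigenvalue \<open>lam\<close> of \<open>\<kappa> * star \<kappa>\<close> bounds the square of the operator norm, and it is attained at a character \<open>\<gamma>\<close>,
  for which the eigenvalue is \<open>|hat \<kappa> \<gamma>|\<^sup>2\<close>.
\<close>
theorem convolution_norm_le:
  assumes \<kappa>: "\<kappa> \<in> bounded_borel" and B: "B \<ge> 0" and le: "\<And>\<gamma>. \<gamma> \<in> dual_group \<Longrightarrow> norm (hat \<kappa> \<gamma>) \<le> B"
    and \<xi>: "\<xi> \<in> bounded_borel"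
  shows "L2_nrm \<mu> (conv \<kappa> \<xi>) \<le> B * L2_nrm \<mu> \<xi>"
proof (cases "L2_nrm \<mu> \<kappa> = 0")
  case True
  then have "conv \<kappa> \<xi> = (\<lambda>x. 0)" using conv_le_L2[OF \<kappa> \<xi>] by (simp add: fun_eq_iff)
  then show ?thesis using B by simp
next
  case False
  then obtain lam e where lam: "lam > 0" and e: "eigen_idempotent lam (conv \<kappa> (star \<kappa>)) e"
    and est: "\<And>\<xi>. \<xi> \<in> bounded_borel \<Longrightarrow> (L2_nrm \<mu> (conv \<kappa> \<xi>))\<^sup>2 \<le> lam * (L2_nrm \<mu> \<xi>)\<^sup>2"
    using top_idempotent[OF \<kappa>] by metis
  obtain \<gamma> where \<gamma>: "\<gamma> \<in> dual_group" and eig: "conv \<gamma> (conv \<kappa> (star \<kappa>)) = (\<lambda>x. of_real lam * \<gamma> x)"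
    by (rule eigen_character[OF conv_bounded_borel[OF \<kappa> bounded_borel_star[OF \<kappa>]] e])
  have "of_real lam * \<gamma> 0 = of_real ((norm (hat \<kappa> \<gamma>))\<^sup>2) * \<gamma> 0"
    using hat_conv_star[OF \<gamma> \<kappa>, of 0] by (simp only: eig)
  then have "complex_of_real lam = of_real ((norm (hat \<kappa> \<gamma>))\<^sup>2)" by (simp add: dual_groupD(4)[OF \<gamma>])
  then have "lam = (norm (hat \<kappa> \<gamma>))\<^sup>2" by (simp only: of_real_eq_iff)
  also have "\<dots> \<le> B\<^sup>2" by (intro power_mono le \<gamma>) simp
  finally have lamB: "lam \<le> B\<^sup>2" .
  have "(L2_nrm \<mu> (conv \<kappa> \<xi>))\<^sup>2 \<le> (B * L2_nrm \<mu> \<xi>)\<^sup>2"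
    unfolding power_mult_distrib
    by (rule order_trans[OF est[OF \<xi>] mult_right_mono[OF lamB zero_le_power2]])
  then show ?thesis by (rule power2_le_imp_le) (simp add: B)
qed

end

section \<open>The Fourier algebra\<close>

text \<open>
  Term-by-term integration of an absolutely convergent series of functions bounded by \<open>1\<close>, which converges
  uniformly.
\<close>
lemma has_sum_integral:
  fixes e :: "'i \<Rightarrow> 'b \<Rightarrow> complex"
  assumes a: "(\<lambda>i. norm (a i)) summable_on I" and e: "\<And>i x. i \<in> I \<Longrightarrow> norm (e i x) \<le> 1"
    and e_meas: "\<And>i. i \<in> I \<Longrightarrow> e i \<in> borel_measurable N"
    and u: "u \<in> borel_measurable N" "\<And>x. u x = (\<Sum>\<^sub>\<infinity>i\<in>I. a i * e i x)"
    and w: "integrable N w"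
  shows "((\<lambda>i. a i * (LINT x|N. e i x * w x)) has_sum (LINT x|N. u x * w x)) I"
proof -
  have bound: "norm (a i * e i x) \<le> norm (a i)" if "i \<in> I" for i x
    using mult_left_mono[OF e[OF that, of x], of "norm (a i)"] by (simp add: norm_mult)
  have "uniform_limit UNIV (\<lambda>F x. \<Sum>i\<in>F. a i * e i x) (\<lambda>x. \<Sum>\<^sub>\<infinity>i\<in>I. a i * e i x) (finite_subsets_at_top I)"
    by (rule Weierstrass_m_test_general[OF bound a])
  then have lim: "uniform_limit UNIV (\<lambda>F x. \<Sum>i\<in>F. a i * e i x) u (finite_subsets_at_top I)"
    by (simp only: u(2)[abs_def, symmetric] ext[of u, OF u(2), symmetric])
  define C where "C = (LINT x|N. norm (w x))"
  have C: "C \<ge> 0" unfolding C_def by (rule Bochner_Integration.integral_nonneg) auto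
  have w_meas: "w \<in> borel_measurable N" using w by (rule borel_measurable_integrable)
  have u_bound: "norm (u x) \<le> (\<Sum>\<^sub>\<infinity>i\<in>I. norm (a i))" for x
  proof -
    have s: "(\<lambda>i. norm (a i * e i x)) summable_on I"
      by (rule Infinite_Sum.abs_summable_on_comparison_test'[OF a bound])
    have "norm (u x) \<le> (\<Sum>\<^sub>\<infinity>i\<in>I. norm (a i * e i x))" unfolding u(2) by (rule norm_infsum_bound[OF s])
    also have "\<dots> \<le> (\<Sum>\<^sub>\<infinity>i\<in>I. norm (a i))" by (rule infsum_mono[OF s a bound])
    finally show ?thesis .
  qed
  have bi: "integrable N (\<lambda>x. g x * w x)" if "g \<in> borel_measurable N" "\<And>x. norm (g x) \<le> B" for g and B :: real
  proof (rule Bochner_Integration.integrable_bound)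
    show "integrable N (\<lambda>x. of_real B * w x)" using w by (rule integrable_mult_right)
    show "AE x in N. norm (g x * w x) \<le> norm (of_real B * w x)"
    proof (rule AE_I2)
      fix x
      have "norm (g x) \<le> \<bar>B\<bar>" using that(2)[of x] by linarith
      then show "norm (g x * w x) \<le> norm (of_real B * w x)" by (simp add: norm_mult mult_right_mono)
    qed
  qed (use that w_meas in measurable)
  show ?thesis
    unfolding has_sum_def
  proof (rule tendstoI)
    fix r :: real assume r: "r > 0"
    have "eventually (\<lambda>F. \<forall>x\<in>UNIV. dist (\<Sum>i\<in>F. a i * e i x) (u x) < r / (C + 1)) (finite_subsets_at_top I)"
      using lim r C by (intro uniform_limitD) auto
    moreover have "eventually (\<lambda>F. finite F \<and> F \<subseteq> I) (finite_subsets_at_top I)"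
      by (rule eventually_finite_subsets_at_top_weakI) auto
    ultimately show "eventually (\<lambda>F. dist (\<Sum>i\<in>F. a i * (LINT x|N. e i x * w x)) (LINT x|N. u x * w x) < r) (finite_subsets_at_top I)"
    proof eventually_elim
      case (elim F)
      define p where "p x = (\<Sum>i\<in>F. a i * e i x)" for x
      have pm: "p \<in> borel_measurable N" unfolding p_def[abs_def]
        using elim e_meas by (intro borel_measurable_sum borel_measurable_times borel_measurable_const) auto
      have pu: "norm (p x - u x) \<le> r / (C + 1)" for x
        using elim by (auto simp: dist_norm p_def intro: less_imp_le)
      have ei: "integrable N (\<lambda>x. e i x * w x)" if "i \<in> F" for i
        using that elim e by (intro bi[of _ 1] e_meas) auto
      have "(\<Sum>i\<in>F. a i * (LINT x|N. e i x * w x)) = (LINT x|N. p x * w x)"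
        by (simp add: p_def sum_distrib_right mult.assoc Bochner_Integration.integral_sum ei)
      moreover have "(LINT x|N. p x * w x) - (LINT x|N. u x * w x) = (LINT x|N. (p x - u x) * w x)"
      proof -
        have "norm (p x) \<le> r / (C + 1) + (\<Sum>\<^sub>\<infinity>i\<in>I. norm (a i))" for x
          using pu[of x] u_bound[of x] norm_triangle_sub[of "p x" "u x"] by linarith
        then have "integrable N (\<lambda>x. p x * w x)" by (rule bi[OF pm])
        moreover have "integrable N (\<lambda>x. u x * w x)" by (rule bi[OF u(1) u_bound])
        ultimately show ?thesis by (simp add: left_diff_distrib)
      qed
      moreover have "norm (LINT x|N. (p x - u x) * w x) \<le> r / (C + 1) * C"
      proof -
        have "norm (LINT x|N. (p x - u x) * w x) \<le> (LINT x|N. norm ((p x - u x) * w x))"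
          by (rule integral_norm_bound)
        also have "\<dots> \<le> (LINT x|N. r / (C + 1) * norm (w x))"
        proof (rule integral_mono)
          show "integrable N (\<lambda>x. norm ((p x - u x) * w x))"
            by (intro integrable_norm bi[OF _ pu]) (intro borel_measurable_diff pm u(1))
          show "norm ((p x - u x) * w x) \<le> r / (C + 1) * norm (w x)" for x
            unfolding norm_mult by (rule mult_right_mono[OF pu norm_ge_zero])
        qed (intro integrable_mult_right integrable_norm w)
        also have "\<dots> = r / (C + 1) * C" by (simp add: C_def)
        finally show ?thesis .
      qed
      moreover have "r / (C + 1) * C < r" using r C by (simp add: field_simps)
      ultimately show ?case by (simp add: dist_norm)
    qed
  qed
qed

context compact_haar begin

lemma dual_group_mult: "\<gamma> \<in> dual_group \<Longrightarrow> \<delta> \<in> dual_group \<Longrightarrow> (\<lambda>x. \<gamma> x * \<delta> x :: complex) \<in> dual_group"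
  for \<gamma> \<delta> :: "'a \<Rightarrow> complex"
  by (auto simp: dual_group_def norm_mult intro: continuous_on_mult)

lemma dual_group_cnj: "\<gamma> \<in> dual_group \<Longrightarrow> (\<lambda>x. cnj (\<gamma> x)) \<in> dual_group" for \<gamma> :: "'a \<Rightarrow> complex"
  by (auto simp: dual_group_def intro: continuous_on_cnj)

lemma dual_group_one: "(\<lambda>x. 1) \<in> dual_group"
  by (simp add: dual_group_def)

text \<open>
  Translation by a point where \<open>\<gamma>\<close> and \<open>\<delta>\<close> differ multiplies the integral of \<open>\<gamma> \<cdot> cnj \<delta>\<close> by a number other than \<open>1\<close> without
  changing it.
\<close>
lemma character_integral:
  assumes \<gamma>: "\<gamma> \<in> dual_group" and \<delta>: "\<delta> \<in> dual_group"
  shows "(LINT x|\<mu>. \<gamma> x * cnj (\<delta> x)) = (if \<gamma> = \<delta> then of_real total else 0)"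
proof (cases "\<gamma> = \<delta>")
  case True
  then show ?thesis by (simp add: dual_groupD(7)[OF \<delta>] total_def scaleR_conv_of_real)
next
  case False
  define \<theta> where "\<theta> x = \<gamma> x * cnj (\<delta> x)" for x
  have \<theta>: "\<theta> \<in> dual_group" unfolding \<theta>_def[abs_def] by (intro dual_group_mult dual_group_cnj \<gamma> \<delta>)
  obtain a where a: "\<gamma> a \<noteq> \<delta> a" using False by auto
  have "\<theta> a \<noteq> 1"
  proof
    assume "\<theta> a = 1"
    then have "\<gamma> a * (cnj (\<delta> a) * \<delta> a) = \<delta> a" by (simp add: \<theta>_def mult.assoc[symmetric])
    then show False using a by (simp only: dual_groupD(8)[OF \<delta>] mult_1_right)
  qed
  have "(LINT x|\<mu>. \<theta> (x + a)) = (LINT x|\<mu>. \<theta> x)"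
    by (rule integral_translate(2)[OF bounded_borel_measurable[OF dual_groupD(9)[OF \<theta>]]])
  then have "(LINT x|\<mu>. \<theta> x) * \<theta> a = (LINT x|\<mu>. \<theta> x)" by (simp add: dual_groupD(2)[OF \<theta>])
  then have "(LINT x|\<mu>. \<theta> x) = 0" using \<open>\<theta> a \<noteq> 1\<close> by simp
  then show ?thesis using False by (simp add: \<theta>_def)
qed

lemma l1_dual_summable:
  fixes s :: 'a
  assumes "a \<in> l1_dual" shows "(\<lambda>\<gamma>. norm (a \<gamma> * cnj (\<gamma> s))) summable_on dual_group"
    "(\<lambda>\<gamma>. a \<gamma> * cnj (\<gamma> s)) summable_on dual_group"
proof -
  show *: "(\<lambda>\<gamma>. norm (a \<gamma> * cnj (\<gamma> s))) summable_on dual_group"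
  proof -
    have "(\<lambda>\<gamma>. norm (a \<gamma> * cnj (\<gamma> s))) summable_on dual_group \<longleftrightarrow> (\<lambda>\<gamma>. norm (a \<gamma>)) summable_on dual_group"
      by (rule summable_on_cong) (simp add: norm_mult dual_groupD(3))
    then show ?thesis using assms by (simp add: l1_dual_def)
  qed
  show "(\<lambda>\<gamma>. a \<gamma> * cnj (\<gamma> s)) summable_on dual_group" by (rule abs_summable_summable[OF *])
qed

lemma fourier_transform_continuous:
  assumes a: "a \<in> l1_dual" shows "continuous_on UNIV (fourier_transform a :: 'a \<Rightarrow> complex)"
proof -
  have "uniform_limit UNIV (\<lambda>F s. \<Sum>\<gamma>\<in>F. a \<gamma> * cnj (\<gamma> s)) (\<lambda>s. \<Sum>\<^sub>\<infinity>\<gamma>\<in>dual_group. a \<gamma> * cnj (\<gamma> s))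
      (finite_subsets_at_top dual_group)"
    by (rule Weierstrass_m_test_general[where M = "\<lambda>\<gamma>. norm (a \<gamma>)"])
       (use a in \<open>auto simp: norm_mult dual_groupD(3) l1_dual_def\<close>)
  moreover have "eventually (\<lambda>F. continuous_on UNIV (\<lambda>s. \<Sum>\<gamma>\<in>F. a \<gamma> * cnj (\<gamma> s))) (finite_subsets_at_top dual_group)"
    by (rule eventually_finite_subsets_at_top_weakI)
       (intro continuous_on_sum continuous_on_mult continuous_on_const continuous_on_cnj dual_groupD(1), auto)
  ultimately show ?thesis unfolding fourier_transform_def[abs_def]
    by (intro uniform_limit_theorem) auto
qed

lemma fourier_transform_bounded_borel: "a \<in> l1_dual \<Longrightarrow> fourier_transform a \<in> bounded_borel"
  by (intro bounded_borel_continuous fourier_transform_continuous)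

text \<open>
  The integration is against \<open>\<gamma>\<close> itself because \<open>fourier_transform\<close> expands in the functions \<open>cnj \<circ> \<gamma>\<close>; the division
  accounts for \<open>\<mu>\<close> not being normalised.
\<close>
definition coef :: "('a \<Rightarrow> complex) \<Rightarrow> ('a \<Rightarrow> complex) \<Rightarrow> complex"
  where "coef u \<gamma> = (LINT x|\<mu>. u x * \<gamma> x) / of_real total"

lemma coef_fourier_transform:
  assumes a: "a \<in> l1_dual" and \<delta>: "\<delta> \<in> dual_group"
  shows "coef (fourier_transform a) \<delta> = a \<delta>"
proof -
  have "((\<lambda>\<gamma>. a \<gamma> * (LINT x|\<mu>. cnj (\<gamma> x) * \<delta> x)) has_sum (LINT x|\<mu>. fourier_transform a x * \<delta> x)) dual_group"
  proof (rule has_sum_integral)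
    show "(\<lambda>\<gamma>. norm (a \<gamma>)) summable_on dual_group" using a by (simp add: l1_dual_def)
    show "fourier_transform a \<in> borel_measurable \<mu>" using fourier_transform_bounded_borel[OF a] by (simp add: bounded_borel_measurable)
    show "(\<lambda>x. cnj (\<gamma> x)) \<in> borel_measurable \<mu>" if "\<gamma> \<in> dual_group" for \<gamma>
      using bounded_borel_cnj[OF dual_groupD(9)[OF that]] by (simp add: bounded_borel_measurable)
  qed (auto simp: dual_groupD(3) fourier_transform_def bounded_borel_integrable dual_groupD(9) \<delta>)
  moreover have "(LINT x|\<mu>. cnj (\<gamma> x) * \<delta> x) = (if \<gamma> = \<delta> then of_real total else 0)" if "\<gamma> \<in> dual_group" for \<gamma>
    using character_integral[OF \<delta> that] by (simp add: mult.commute)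
  ultimately have "((\<lambda>\<gamma>. a \<gamma> * (if \<gamma> = \<delta> then of_real total else 0)) has_sum (LINT x|\<mu>. fourier_transform a x * \<delta> x)) dual_group"
    by (subst (asm) has_sum_cong[where g = "\<lambda>\<gamma>. a \<gamma> * (if \<gamma> = \<delta> then of_real total else 0)"]) auto
  moreover have "((\<lambda>\<gamma>. a \<gamma> * (if \<gamma> = \<delta> then of_real total else 0)) has_sum (a \<delta> * of_real total)) dual_group"
    by (rule has_sum_finite_neutralI[of "{\<delta>}"]) (use \<delta> in auto)
  ultimately have "(LINT x|\<mu>. fourier_transform a x * \<delta> x) = a \<delta> * of_real total" by (rule has_sum_unique)
  then show ?thesis using total_pos by (simp add: coef_def)
qed

lemma fourier_algebraD:
  assumes "u \<in> fourier_algebra"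
  shows "coef u \<in> l1_dual" "u = fourier_transform (coef u)"
proof -
  obtain a where a: "a \<in> l1_dual" "u = fourier_transform a" using assms by (auto simp: fourier_algebra_def)
  have eq: "coef u \<gamma> = a \<gamma>" if "\<gamma> \<in> dual_group" for \<gamma> using coef_fourier_transform[OF a(1) that] a(2) by simp
  have "(\<lambda>\<gamma>. norm (coef u \<gamma>)) summable_on dual_group \<longleftrightarrow> (\<lambda>\<gamma>. norm (a \<gamma>)) summable_on dual_group"
    by (rule summable_on_cong) (simp add: eq)
  then show "coef u \<in> l1_dual" using a(1) by (simp add: l1_dual_def)
  have "fourier_transform a s = fourier_transform (coef u) s" for s
    unfolding fourier_transform_def by (rule infsum_cong) (simp add: eq)
  then show "u = fourier_transform (coef u)" unfolding a(2) by (auto simp: a(2)[symmetric])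
qed

lemma fourier_algebra_bounded_borel: "u \<in> fourier_algebra \<Longrightarrow> u \<in> bounded_borel"
  and fourier_algebra_continuous: "u \<in> fourier_algebra \<Longrightarrow> continuous_on UNIV u"
  using fourier_transform_bounded_borel fourier_transform_continuous by (auto simp: fourier_algebra_def)

lemma coef_add: "u \<in> bounded_borel \<Longrightarrow> v \<in> bounded_borel \<Longrightarrow> \<gamma> \<in> dual_group \<Longrightarrow> coef (\<lambda>s. u s + v s) \<gamma> = coef u \<gamma> + coef v \<gamma>"
  by (simp add: coef_def distrib_right add_divide_distrib bounded_borel_integrable bounded_borel_mult dual_groupD(9))

lemma coef_scale: "coef (\<lambda>s. c * u s) \<gamma> = c * coef u \<gamma>"
  by (simp add: coef_def mult.assoc)

lemma l1_dual_add:
  assumes "a \<in> l1_dual" "b \<in> l1_dual" shows "(\<lambda>\<gamma>. a \<gamma> + b \<gamma>) \<in> l1_dual"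
proof -
  have "(\<lambda>\<gamma>. norm (a \<gamma>) + norm (b \<gamma>)) summable_on dual_group"
    using assms by (intro summable_on_add) (auto simp: l1_dual_def)
  from Infinite_Sum.abs_summable_on_comparison_test'[OF this norm_triangle_ineq]
  show ?thesis by (simp add: l1_dual_def)
qed

lemma l1_dual_scale: "a \<in> l1_dual \<Longrightarrow> (\<lambda>\<gamma>. c * a \<gamma>) \<in> l1_dual"
  by (simp add: l1_dual_def norm_mult summable_on_cmult_right)

lemma fourier_transform_add:
  "a \<in> l1_dual \<Longrightarrow> b \<in> l1_dual \<Longrightarrow> fourier_transform (\<lambda>\<gamma>. a \<gamma> + b \<gamma>) s = fourier_transform a s + fourier_transform b s"
  for s :: 'a
  by (simp add: fourier_transform_def distrib_right infsum_add l1_dual_summable)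

lemma fourier_transform_scale: "fourier_transform (\<lambda>\<gamma>. c * a \<gamma>) s = c * fourier_transform a s"
  by (simp add: fourier_transform_def mult.assoc infsum_cmult_right')

lemma fourier_algebra_add:
  fixes u v :: "'a \<Rightarrow> complex"
  assumes "u \<in> fourier_algebra" "v \<in> fourier_algebra" shows "(\<lambda>s. u s + v s) \<in> fourier_algebra"
proof -
  obtain a b where "a \<in> l1_dual" "u = fourier_transform a" "b \<in> l1_dual" "v = fourier_transform b"
    using assms by (auto simp: fourier_algebra_def)
  then have "(\<lambda>s. u s + v s) = fourier_transform (\<lambda>\<gamma>. a \<gamma> + b \<gamma>)" "(\<lambda>\<gamma>. a \<gamma> + b \<gamma>) \<in> l1_dual"
    by (auto simp: fourier_transform_add l1_dual_add)
  then show ?thesis by (simp add: fourier_algebra_def)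
qed

lemma fourier_algebra_scale:
  fixes u :: "'a \<Rightarrow> complex"
  assumes "u \<in> fourier_algebra" shows "(\<lambda>s. c * u s) \<in> fourier_algebra"
proof -
  obtain a where "a \<in> l1_dual" "u = fourier_transform a" using assms by (auto simp: fourier_algebra_def)
  then have "(\<lambda>s. c * u s) = fourier_transform (\<lambda>\<gamma>. c * a \<gamma>)" "(\<lambda>\<gamma>. c * a \<gamma>) \<in> l1_dual"
    by (auto simp: fourier_transform_scale l1_dual_scale)
  then show ?thesis by (simp add: fourier_algebra_def)
qed

lemma finite_support_l1_dual: "finite F \<Longrightarrow> (\<lambda>\<gamma>. if \<gamma> \<in> F then a \<gamma> else 0) \<in> l1_dual"
  unfolding l1_dual_def mem_Collect_eq by (rule finite_nonzero_values_imp_summable_on) (auto elim: finite_subset[rotated])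

lemma fourier_transform_finite_support:
  assumes "finite F" "F \<subseteq> dual_group"
  shows "fourier_transform (\<lambda>\<gamma>. if \<gamma> \<in> F then a \<gamma> else 0) s = (\<Sum>\<gamma>\<in>F. a \<gamma> * cnj (\<gamma> s))"
  unfolding fourier_transform_def
  by (rule infsumI, rule has_sum_finite_neutralI[of F]) (use assms in auto)

lemma fourier_algebra_character:
  assumes "\<gamma> \<in> dual_group" shows "(\<lambda>s. cnj (\<gamma> s)) \<in> fourier_algebra"
proof -
  have "(\<lambda>s. cnj (\<gamma> s)) = fourier_transform (\<lambda>\<delta>. if \<delta> \<in> {\<gamma>} then 1 else 0)"
    using fourier_transform_finite_support[of "{\<gamma>}" "\<lambda>_. 1"] assms by auto
  then show ?thesis using finite_support_l1_dual[of "{\<gamma>}" "\<lambda>_. 1"] by (simp add: fourier_algebra_def)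
qed

lemma coef_character:
  assumes "\<gamma> \<in> dual_group" "\<delta> \<in> dual_group" shows "coef (\<lambda>s. cnj (\<gamma> s)) \<delta> = (if \<delta> = \<gamma> then 1 else 0)"
  using character_integral[OF assms(2,1)] total_pos by (simp add: coef_def mult.commute)

lemma bij_betw_character_mult:
  assumes \<gamma>: "\<gamma> \<in> dual_group"
  shows "bij_betw (\<lambda>\<delta> x. \<delta> x * \<gamma> x :: complex) dual_group (dual_group :: ('a \<Rightarrow> complex) set)"
  by (rule bij_betw_byWitness[where f' = "\<lambda>\<delta> x. \<delta> x * cnj (\<gamma> x)"])
     (auto simp: mult.assoc dual_groupD(7,8)[OF \<gamma>] intro: dual_group_mult[OF _ \<gamma>] dual_group_mult[OF _ dual_group_cnj[OF \<gamma>]])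

text \<open>
  The product has the convolution of the coefficient families, summable over the dual group by Fubini, as
  its coefficients.
\<close>
lemma fourier_algebra_mult:
  fixes u v :: "'a \<Rightarrow> complex"
  assumes "u \<in> fourier_algebra" "v \<in> fourier_algebra"
  shows "(\<lambda>s. u s * v s) \<in> fourier_algebra"
proof -
  obtain a b where a: "a \<in> l1_dual" and ua: "u = fourier_transform a" and b: "b \<in> l1_dual" and vb: "v = fourier_transform b"
    using assms by (auto simp: fourier_algebra_def)
  define P where "P \<gamma> \<delta>' = a \<gamma> * b (\<lambda>x. \<delta>' x * cnj (\<gamma> x))" for \<gamma> \<delta>' :: "'a \<Rightarrow> complex"
  define c where "c \<delta>' = (\<Sum>\<^sub>\<infinity>\<gamma>\<in>dual_group. P \<gamma> \<delta>')" for \<delta>'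
  have sa: "(\<lambda>\<gamma>. norm (a \<gamma>)) summable_on dual_group" and sb: "(\<lambda>\<gamma>. norm (b \<gamma>)) summable_on dual_group"
    using a b by (auto simp: l1_dual_def)
  have bij: "bij_betw (\<lambda>\<delta> x. \<delta> x * cnj (\<gamma> x) :: complex) dual_group dual_group" if "\<gamma> \<in> dual_group" for \<gamma> :: "'a \<Rightarrow> complex"
    by (rule bij_betw_character_mult[OF dual_group_cnj[OF that]])
  have sb': "(\<lambda>\<delta>. norm (b (\<lambda>x. \<delta> x * cnj (\<gamma> x)))) summable_on dual_group"
    and ib': "(\<Sum>\<^sub>\<infinity>\<delta>\<in>dual_group. norm (b (\<lambda>x. \<delta> x * cnj (\<gamma> x)))) = (\<Sum>\<^sub>\<infinity>\<delta>\<in>dual_group. norm (b \<delta>))"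
    if "\<gamma> \<in> dual_group" for \<gamma>
    using sb summable_on_reindex_bij_betw[OF bij[OF that], of "\<lambda>\<delta>. norm (b \<delta>)"]
      infsum_reindex_bij_betw[OF bij[OF that], of "\<lambda>\<delta>. norm (b \<delta>)"] by auto
  have row: "(\<lambda>\<delta>'. norm (P \<gamma> \<delta>')) summable_on dual_group"
    and row_sum: "(\<Sum>\<^sub>\<infinity>\<delta>'\<in>dual_group. norm (P \<gamma> \<delta>')) = norm (a \<gamma>) * (\<Sum>\<^sub>\<infinity>\<delta>\<in>dual_group. norm (b \<delta>))"
    if "\<gamma> \<in> dual_group" for \<gamma>
    using summable_on_cmult_right[OF sb'[OF that]] by (simp_all add: P_def norm_mult infsum_cmult_right' ib'[OF that])
  have "(\<lambda>\<gamma>. \<Sum>\<^sub>\<infinity>\<delta>'\<in>dual_group. norm (P \<gamma> \<delta>')) summable_on dual_group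
    \<longleftrightarrow> (\<lambda>\<gamma>. norm (a \<gamma>) * (\<Sum>\<^sub>\<infinity>\<delta>\<in>dual_group. norm (b \<delta>))) summable_on dual_group"
    by (rule summable_on_cong) (rule row_sum)
  moreover have "norm (\<Sum>\<^sub>\<infinity>\<delta>'\<in>dual_group. norm (P \<gamma> \<delta>')) = (\<Sum>\<^sub>\<infinity>\<delta>'\<in>dual_group. norm (P \<gamma> \<delta>'))" for \<gamma>
    by (simp add: infsum_nonneg)
  ultimately have "(\<lambda>z. norm (P (fst z) (snd z))) summable_on dual_group \<times> dual_group"
    using Infinite_Sum.abs_summable_on_Sigma_iff[of "\<lambda>z. P (fst z) (snd z)" dual_group "\<lambda>_. dual_group"]
      summable_on_cmult_left[OF sa, of "\<Sum>\<^sub>\<infinity>\<delta>\<in>dual_group. norm (b \<delta>)"] row by simp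
  then have sP': "(\<lambda>z. norm (P (snd z) (fst z))) summable_on dual_group \<times> dual_group"
    using summable_on_swap[of "\<lambda>z. norm (P (fst z) (snd z))" dual_group dual_group] by (simp add: case_prod_unfold)
  then have s1: "\<And>\<delta>'. \<delta>' \<in> dual_group \<Longrightarrow> (\<lambda>\<gamma>. norm (P \<gamma> \<delta>')) summable_on dual_group"
    and "(\<lambda>\<delta>'. norm (\<Sum>\<^sub>\<infinity>\<gamma>\<in>dual_group. norm (P \<gamma> \<delta>'))) summable_on dual_group"
    using Infinite_Sum.abs_summable_on_Sigma_iff[of "\<lambda>z. P (snd z) (fst z)" dual_group "\<lambda>_. dual_group"] by simp_all
  then have s2: "(\<lambda>\<delta>'. \<Sum>\<^sub>\<infinity>\<gamma>\<in>dual_group. norm (P \<gamma> \<delta>')) summable_on dual_group"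
    by (simp add: infsum_nonneg)
  have c: "c \<in> l1_dual"
    unfolding l1_dual_def mem_Collect_eq
  proof (rule Infinite_Sum.abs_summable_on_comparison_test'[OF s2])
    show "norm (c \<delta>') \<le> (\<Sum>\<^sub>\<infinity>\<gamma>\<in>dual_group. norm (P \<gamma> \<delta>'))" if "\<delta>' \<in> dual_group" for \<delta>'
      unfolding c_def by (rule norm_infsum_bound[OF s1[OF that]])
  qed
  have "u s * v s = fourier_transform c s" for s
  proof -
    have sQ: "(\<lambda>(\<delta>', \<gamma>). P \<gamma> \<delta>' * cnj (\<delta>' s)) summable_on dual_group \<times> dual_group"
    proof (rule abs_summable_summable, rule summable_on_cong[THEN iffD1, OF _ sP'])
      show "norm (P (snd z) (fst z)) = norm (case z of (\<delta>', \<gamma>) \<Rightarrow> P \<gamma> \<delta>' * cnj (\<delta>' s))"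
        if "z \<in> dual_group \<times> dual_group" for z
        using that by (auto simp: norm_mult dual_groupD(3))
    qed
    have "fourier_transform c s = (\<Sum>\<^sub>\<infinity>\<delta>'\<in>dual_group. \<Sum>\<^sub>\<infinity>\<gamma>\<in>dual_group. P \<gamma> \<delta>' * cnj (\<delta>' s))"
      unfolding fourier_transform_def c_def by (simp add: infsum_cmult_left')
    also have "\<dots> = (\<Sum>\<^sub>\<infinity>\<gamma>\<in>dual_group. \<Sum>\<^sub>\<infinity>\<delta>'\<in>dual_group. P \<gamma> \<delta>' * cnj (\<delta>' s))"
      by (rule infsum_swap_banach[OF sQ])
    also have "\<dots> = (\<Sum>\<^sub>\<infinity>\<gamma>\<in>dual_group. a \<gamma> * cnj (\<gamma> s) * v s)"
    proof (rule infsum_cong)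
      fix \<gamma> :: "'a \<Rightarrow> complex" assume \<gamma>: "\<gamma> \<in> dual_group"
      have "(\<Sum>\<^sub>\<infinity>\<delta>'\<in>dual_group. P \<gamma> \<delta>' * cnj (\<delta>' s))
        = (\<Sum>\<^sub>\<infinity>\<delta>\<in>dual_group. P \<gamma> (\<lambda>x. \<delta> x * \<gamma> x) * cnj (\<delta> s * \<gamma> s))"
        by (rule infsum_reindex_bij_betw[OF bij_betw_character_mult[OF \<gamma>], symmetric])
      also have "\<dots> = (\<Sum>\<^sub>\<infinity>\<delta>\<in>dual_group. (a \<gamma> * cnj (\<gamma> s)) * (b \<delta> * cnj (\<delta> s)))"
        by (rule infsum_cong) (simp add: P_def mult.assoc dual_groupD(7)[OF \<gamma>] mult_ac)
      also have "\<dots> = a \<gamma> * cnj (\<gamma> s) * v s"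
        unfolding vb fourier_transform_def by (rule infsum_cmult_right')
      finally show "(\<Sum>\<^sub>\<infinity>\<delta>'\<in>dual_group. P \<gamma> \<delta>' * cnj (\<delta>' s)) = a \<gamma> * cnj (\<gamma> s) * v s" .
    qed
    also have "\<dots> = u s * v s"
      unfolding ua fourier_transform_def[of a] by (rule infsum_cmult_left')
    finally show ?thesis ..
  qed
  then have "(\<lambda>s. u s * v s) = fourier_transform c" by (simp add: fun_eq_iff)
  then show ?thesis using c by (simp add: fourier_algebra_def)
qed

end

section \<open>Operators and pseudomeasures\<close>

lemma bounded_operatorsD:
  assumes "T \<in> bounded_operators M"
  shows "\<And>\<xi>. \<xi> \<in> L2 M \<Longrightarrow> T \<xi> \<in> L2 M"
    "\<And>\<xi> \<eta>. \<xi> \<in> L2 M \<Longrightarrow> \<eta> \<in> L2 M \<Longrightarrow> AE x in M. T (\<lambda>z. \<xi> z + \<eta> z) x = T \<xi> x + T \<eta> x"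
    "\<And>c \<xi>. \<xi> \<in> L2 M \<Longrightarrow> AE x in M. T (\<lambda>z. c * \<xi> z) x = c * T \<xi> x"
    "\<exists>C\<ge>0. \<forall>\<xi>\<in>L2 M. L2_nrm M (T \<xi>) \<le> C * L2_nrm M \<xi>"
proof -
  show "\<And>\<xi>. \<xi> \<in> L2 M \<Longrightarrow> T \<xi> \<in> L2 M"
    "\<And>\<xi> \<eta>. \<xi> \<in> L2 M \<Longrightarrow> \<eta> \<in> L2 M \<Longrightarrow> AE x in M. T (\<lambda>z. \<xi> z + \<eta> z) x = T \<xi> x + T \<eta> x"
    "\<And>c \<xi>. \<xi> \<in> L2 M \<Longrightarrow> AE x in M. T (\<lambda>z. c * \<xi> z) x = c * T \<xi> x"
    using assms by (auto simp: bounded_operators_def)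
  obtain C where C: "\<And>\<xi>. \<xi> \<in> L2 M \<Longrightarrow> L2_nrm M (T \<xi>) \<le> C * L2_nrm M \<xi>"
    using assms unfolding bounded_operators_def by blast
  have "L2_nrm M (T \<xi>) \<le> \<bar>C\<bar> * L2_nrm M \<xi>" if "\<xi> \<in> L2 M" for \<xi>
    using C[OF that] mult_right_mono[OF abs_ge_self[of C] L2_nrm_nonneg[of M \<xi>]] by linarith
  then show "\<exists>C\<ge>0. \<forall>\<xi>\<in>L2 M. L2_nrm M (T \<xi>) \<le> C * L2_nrm M \<xi>" by (intro exI[of _ "\<bar>C\<bar>"]) auto
qed

lemma op_dist_le:
  assumes "\<And>\<xi>. \<xi> \<in> L2 M \<Longrightarrow> L2_nrm M (\<lambda>x. S \<xi> x - T \<xi> x) \<le> c * L2_nrm M \<xi>" "c \<ge> 0"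
  shows "op_dist M S T \<le> c"
  unfolding op_dist_def
proof (rule cSUP_least)
  show "{\<xi> \<in> L2 M. L2_nrm M \<xi> \<le> 1} \<noteq> {}" using L2_zero[of M] by auto
  fix \<xi> assume "\<xi> \<in> {\<xi> \<in> L2 M. L2_nrm M \<xi> \<le> 1}"
  then show "L2_nrm M (\<lambda>x. S \<xi> x - T \<xi> x) \<le> c"
    using assms(1)[of \<xi>] mult_left_mono[of "L2_nrm M \<xi>" 1 c] assms(2) by auto
qed

text \<open>
  Homogeneity extends the bound from the unit ball.  Vectors of norm zero cannot be normalised and need the
  boundedness of both operators.
\<close>
lemma op_dist_ge:
  assumes S: "S \<in> bounded_operators M" and T: "T \<in> bounded_operators M" and \<xi>: "\<xi> \<in> L2 M"
  shows "L2_nrm M (\<lambda>x. S \<xi> x - T \<xi> x) \<le> op_dist M S T * L2_nrm M \<xi>"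
proof -
  obtain C D where C: "C \<ge> 0" "\<And>\<xi>. \<xi> \<in> L2 M \<Longrightarrow> L2_nrm M (S \<xi>) \<le> C * L2_nrm M \<xi>"
    and D: "D \<ge> 0" "\<And>\<xi>. \<xi> \<in> L2 M \<Longrightarrow> L2_nrm M (T \<xi>) \<le> D * L2_nrm M \<xi>"
    using bounded_operatorsD(4)[OF S] bounded_operatorsD(4)[OF T] by auto
  have bound: "L2_nrm M (\<lambda>x. S \<xi> x - T \<xi> x) \<le> (C + D) * L2_nrm M \<xi>" if "\<xi> \<in> L2 M" for \<xi>
  proof -
    have "L2_nrm M (\<lambda>x. S \<xi> x - T \<xi> x) \<le> L2_nrm M (S \<xi>) + L2_nrm M (T \<xi>)"
      using L2_triangle_diff[OF bounded_operatorsD(1)[OF S that] L2_zero bounded_operatorsD(1)[OF T that]]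
        L2_nrm_diff_commute[of M "\<lambda>x. 0" "T \<xi>"] by simp
    then show ?thesis using C(2)[OF that] D(2)[OF that] by (simp add: distrib_right)
  qed
  show ?thesis
  proof (cases "L2_nrm M \<xi> = 0")
    case True
    then show ?thesis using bound[OF \<xi>] by simp
  next
    case False
    define r where "r = L2_nrm M \<xi>"
    have r: "r > 0" using False by (simp add: r_def less_le)
    define \<zeta> where "\<zeta> = (\<lambda>x. complex_of_real (1 / r) * \<xi> x)"
    have \<zeta>: "\<zeta> \<in> L2 M" unfolding \<zeta>_def by (rule L2_scale[OF \<xi>])
    have n: "L2_nrm M \<zeta> = 1" unfolding \<zeta>_def L2_nrm_scale using r by (simp add: r_def norm_divide)
    have bdd: "bdd_above ((\<lambda>\<xi>. L2_nrm M (\<lambda>x. S \<xi> x - T \<xi> x)) ` {\<xi> \<in> L2 M. L2_nrm M \<xi> \<le> 1})"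
    proof (rule bdd_aboveI2)
      fix \<xi> assume "\<xi> \<in> {\<xi> \<in> L2 M. L2_nrm M \<xi> \<le> 1}"
      then show "L2_nrm M (\<lambda>x. S \<xi> x - T \<xi> x) \<le> C + D"
        using bound[of \<xi>] mult_left_mono[of "L2_nrm M \<xi>" 1 "C + D"] C(1) D(1) by auto
    qed
    have "L2_nrm M (\<lambda>x. S \<zeta> x - T \<zeta> x) \<le> op_dist M S T"
      unfolding op_dist_def by (rule cSUP_upper[OF _ bdd]) (use \<zeta> n in simp)
    moreover have "L2_nrm M (\<lambda>x. S \<zeta> x - T \<zeta> x) = L2_nrm M (\<lambda>x. complex_of_real (1 / r) * (S \<xi> x - T \<xi> x))"
    proof (rule L2_nrm_cong(2))
      show "(\<lambda>x. complex_of_real (1 / r) * (S \<xi> x - T \<xi> x)) \<in> L2 M"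
        by (intro L2_scale L2_diff bounded_operatorsD(1)[OF S \<xi>] bounded_operatorsD(1)[OF T \<xi>])
      show "(\<lambda>x. S \<zeta> x - T \<zeta> x) \<in> borel_measurable M"
        by (intro L2_measurable L2_diff bounded_operatorsD(1)[OF S \<zeta>] bounded_operatorsD(1)[OF T \<zeta>])
      show "AE x in M. complex_of_real (1 / r) * (S \<xi> x - T \<xi> x) = S \<zeta> x - T \<zeta> x"
        using bounded_operatorsD(3)[OF S \<xi>, of "complex_of_real (1 / r)"]
          bounded_operatorsD(3)[OF T \<xi>, of "complex_of_real (1 / r)"]
        unfolding \<zeta>_def by eventually_elim (simp only: right_diff_distrib)
    qed
    moreover have "norm (complex_of_real (1 / r)) = 1 / r" using r by (simp add: norm_divide)
    ultimately have "1 / r * L2_nrm M (\<lambda>x. S \<xi> x - T \<xi> x) \<le> op_dist M S T"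
      by (simp only: L2_nrm_scale)
    then show ?thesis using r by (simp add: r_def field_simps)
  qed
qed

lemma bounded_operators_diff:
  assumes S: "S \<in> bounded_operators M" and T: "T \<in> bounded_operators M"
  shows "(\<lambda>\<xi> x. S \<xi> x - T \<xi> x) \<in> bounded_operators M"
  unfolding bounded_operators_def mem_Collect_eq
proof (intro conjI ballI allI)
  fix \<xi> assume \<xi>: "\<xi> \<in> L2 M"
  show "(\<lambda>x. S \<xi> x - T \<xi> x) \<in> L2 M"
    by (intro L2_diff bounded_operatorsD(1)[OF S \<xi>] bounded_operatorsD(1)[OF T \<xi>])
  show "AE x in M. S (\<lambda>z. c * \<xi> z) x - T (\<lambda>z. c * \<xi> z) x = c * (S \<xi> x - T \<xi> x)" for c
    using bounded_operatorsD(3)[OF S \<xi>, of c] bounded_operatorsD(3)[OF T \<xi>, of c]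
    by eventually_elim (simp only: right_diff_distrib)
  fix \<eta> assume \<eta>: "\<eta> \<in> L2 M"
  show "AE x in M. S (\<lambda>z. \<xi> z + \<eta> z) x - T (\<lambda>z. \<xi> z + \<eta> z) x = (S \<xi> x - T \<xi> x) + (S \<eta> x - T \<eta> x)"
    using bounded_operatorsD(2)[OF S \<xi> \<eta>] bounded_operatorsD(2)[OF T \<xi> \<eta>]
    by eventually_elim simp
next
  show "\<exists>C. \<forall>\<xi>\<in>L2 M. L2_nrm M (\<lambda>x. S \<xi> x - T \<xi> x) \<le> C * L2_nrm M \<xi>"
    using op_dist_ge[OF S T] by blast
qed

text \<open>
  Test against \<open>cnj v\<close>, truncated to the sets where \<open>|v|\<close> is at most \<open>n\<close>.
\<close>
lemma L2_orthogonal_bounded_zero: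
  assumes v: "v \<in> L2 M"
    and orth: "\<And>\<eta> C. \<eta> \<in> borel_measurable M \<Longrightarrow> (\<And>x. norm (\<eta> x) \<le> C) \<Longrightarrow> (LINT x|M. v x * \<eta> x) = 0"
  shows "AE x in M. v x = 0"
proof -
  note [measurable] = L2_measurable[OF v]
  have "AE x in M. norm (v x) \<le> real n \<longrightarrow> v x = 0" for n
  proof -
    define \<eta> where "\<eta> x = (if norm (v x) \<le> real n then cnj (v x) else 0)" for x
    have \<eta>: "\<eta> \<in> borel_measurable M" unfolding \<eta>_def[abs_def] by measurable
    have eq: "v x * \<eta> x = of_real ((norm (\<eta> x))\<^sup>2)" for x
      unfolding complex_norm_square by (simp add: \<eta>_def)
    have \<eta>2: "\<eta> \<in> L2 M"
      by (rule L2_dominated(1)[OF v \<eta>, of 1]) (auto simp: \<eta>_def)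
    have "complex_of_real (LINT x|M. (norm (\<eta> x))\<^sup>2) = (LINT x|M. v x * \<eta> x)"
      unfolding eq by (rule integral_complex_of_real[symmetric])
    also have "\<dots> = 0" by (rule orth[OF \<eta>, of "real n"]) (auto simp: \<eta>_def)
    finally have "L2_nrm M \<eta> = 0" by (simp add: L2_nrm_def)
    then have "AE x in M. \<eta> x = 0" using L2_nrm_eq_0[OF \<eta>2] by simp
    then show ?thesis by eventually_elim (auto simp: \<eta>_def split: if_splits)
  qed
  then have "AE x in M. \<forall>n. norm (v x) \<le> real n \<longrightarrow> v x = 0"
    unfolding AE_all_countable by blast
  then show ?thesis
  proof eventually_elim
    case (elim x)
    obtain n where "norm (v x) \<le> real n" using real_arch_simple by blast
    then show ?case using elim by blast
  qed
qed

lemma L2_bounded_dense: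
  assumes v: "v \<in> L2 M" and r: "r > 0"
  obtains w C where "w \<in> borel_measurable M" "w \<in> L2 M" "\<And>x. norm (w x) \<le> C" "L2_nrm M (\<lambda>x. v x - w x) < r"
    "L2_nrm M w \<le> L2_nrm M v"
proof -
  note [measurable] = L2_measurable[OF v]
  define w where "w n x = (if norm (v x) \<le> real n then v x else 0)" for n x
  have w: "w n \<in> borel_measurable M" for n unfolding w_def[abs_def] by measurable
  have wL2: "w n \<in> L2 M" "L2_nrm M (w n) \<le> L2_nrm M v" for n
    using L2_dominated[OF v w, of 1] by (auto simp: w_def)
  have "(\<lambda>n. LINT x|M. (norm (v x - w n x))\<^sup>2) \<longlonglongrightarrow> (LINT x|M. 0)"
  proof (rule integral_dominated_convergence[where w = "\<lambda>x. (norm (v x))\<^sup>2"])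
    show "integrable M (\<lambda>x. (norm (v x))\<^sup>2)" by (rule L2_integrable_square[OF v])
    show "AE x in M. (\<lambda>n. (norm (v x - w n x))\<^sup>2) \<longlonglongrightarrow> 0"
    proof (rule AE_I2)
      fix x
      obtain N where "norm (v x) \<le> real N" using real_arch_simple by blast
      then have "eventually (\<lambda>n. (norm (v x - w n x))\<^sup>2 = 0) sequentially"
        by (intro eventually_sequentiallyI[of N]) (auto simp: w_def)
      then show "(\<lambda>n. (norm (v x - w n x))\<^sup>2) \<longlonglongrightarrow> 0" by (rule tendsto_eventually)
    qed
    show "AE x in M. norm ((norm (v x - w n x))\<^sup>2) \<le> (norm (v x))\<^sup>2" for n
      by (rule AE_I2) (simp add: w_def)
  qed (use w in measurable)
  then have "eventually (\<lambda>n. (LINT x|M. (norm (v x - w n x))\<^sup>2) < r\<^sup>2) sequentially"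
    using r by (intro order_tendstoD) auto
  then obtain n where "(L2_nrm M (\<lambda>x. v x - w n x))\<^sup>2 < r\<^sup>2"
    unfolding L2_nrm_square by (auto simp: eventually_sequentially)
  then have "L2_nrm M (\<lambda>x. v x - w n x) < r" by (rule power2_less_imp_less) (use r in simp)
  then show ?thesis by (intro that[OF w wL2(1) _ _ wL2(2), of n "real n"]) (auto simp: w_def)
qed

context compact_haar begin

text \<open>
  The Hilbert-Schmidt bound: apply the Cauchy-Schwarz inequality to almost every column of the kernel and
  integrate.
\<close>
lemma integral_operator_bounded:
  assumes k: "k \<in> L2 (\<mu> \<Otimes>\<^sub>M \<mu>)"
  shows "integral_operator \<mu> k \<in> bounded_operators \<mu>"
    and "\<And>\<xi>. \<xi> \<in> L2 \<mu> \<Longrightarrow> AE y in \<mu>. integrable \<mu> (\<lambda>x. k (x, y) * \<xi> x)"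
proof -
  note [measurable] = L2_measurable[OF k]
  have isq: "integrable (\<mu> \<Otimes>\<^sub>M \<mu>) (\<lambda>(x, y). (norm (k (x, y)))\<^sup>2)"
    using L2_integrable_square[OF k] by (simp add: case_prod_unfold)
  have col: "AE y in \<mu>. (\<lambda>x. k (x, y)) \<in> L2 \<mu>"
    using square.AE_integrable_snd[OF isq]
  proof eventually_elim
    case (elim y)
    have "(\<lambda>x. k (x, y)) \<in> borel_measurable \<mu>" by measurable
    with elim show ?case by (simp add: L2_def)
  qed
  show int: "AE y in \<mu>. integrable \<mu> (\<lambda>x. k (x, y) * \<xi> x)" if "\<xi> \<in> L2 \<mu>" for \<xi>
    using col by eventually_elim (rule L2_integrable_mult[OF _ that])
  have L2: "integral_operator \<mu> k \<xi> \<in> L2 \<mu> \<and> L2_nrm \<mu> (integral_operator \<mu> k \<xi>) \<le> L2_nrm (\<mu> \<Otimes>\<^sub>M \<mu>) k * L2_nrm \<mu> \<xi>"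
    if \<xi>: "\<xi> \<in> L2 \<mu>" for \<xi>
  proof -
    note [measurable] = L2_measurable[OF \<xi>]
    define T where "T = integral_operator \<mu> k \<xi>"
    have T: "T \<in> borel_measurable \<mu>" unfolding T_def integral_operator_def by measurable
    define q where "q y = (LINT x|\<mu>. (norm (k (x, y)))\<^sup>2)" for y
    have q: "integrable \<mu> q" unfolding q_def using square.integrable_snd[OF isq] .
    have le: "AE y in \<mu>. (norm (T y))\<^sup>2 \<le> (L2_nrm \<mu> \<xi>)\<^sup>2 * q y"
      using col
    proof eventually_elim
      case (elim y)
      have "norm (T y) \<le> L2_nrm \<mu> (\<lambda>x. k (x, y)) * L2_nrm \<mu> \<xi>"
        unfolding T_def integral_operator_def by (rule L2_Cauchy_Schwarz[OF elim \<xi>])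
      then have "(norm (T y))\<^sup>2 \<le> (L2_nrm \<mu> (\<lambda>x. k (x, y)) * L2_nrm \<mu> \<xi>)\<^sup>2" by (intro power_mono) auto
      then show ?case by (simp only: power_mult_distrib L2_nrm_square q_def mult.commute)
    qed
    have i2: "integrable \<mu> (\<lambda>y. (L2_nrm \<mu> \<xi>)\<^sup>2 * q y)" using q by simp
    have i1: "integrable \<mu> (\<lambda>y. (norm (T y))\<^sup>2)"
      by (rule Bochner_Integration.integrable_bound[OF i2]) (use T le in auto)
    have "(L2_nrm \<mu> T)\<^sup>2 \<le> (L2_nrm \<mu> \<xi>)\<^sup>2 * (LINT y|\<mu>. q y)"
      unfolding L2_nrm_square[of \<mu> T] using integral_mono_AE[OF i1 i2 le] by simp
    also have "(LINT y|\<mu>. q y) = (L2_nrm (\<mu> \<Otimes>\<^sub>M \<mu>) k)\<^sup>2"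
      unfolding q_def L2_nrm_square using square.integral_snd[OF isq] by (simp add: case_prod_unfold)
    finally have "(L2_nrm \<mu> T)\<^sup>2 \<le> (L2_nrm (\<mu> \<Otimes>\<^sub>M \<mu>) k * L2_nrm \<mu> \<xi>)\<^sup>2"
      by (simp only: power_mult_distrib mult.commute)
    then have "L2_nrm \<mu> T \<le> L2_nrm (\<mu> \<Otimes>\<^sub>M \<mu>) k * L2_nrm \<mu> \<xi>" by (rule power2_le_imp_le) simp
    moreover have "T \<in> L2 \<mu>" using T i1 by (simp add: L2_def)
    ultimately show ?thesis by (simp add: T_def)
  qed
  show "integral_operator \<mu> k \<in> bounded_operators \<mu>"
    unfolding bounded_operators_def mem_Collect_eq
  proof (intro conjI ballI allI)
    fix \<xi> assume \<xi>: "\<xi> \<in> L2 \<mu>"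
    show "integral_operator \<mu> k \<xi> \<in> L2 \<mu>" using L2[OF \<xi>] by simp
    show "AE x in \<mu>. integral_operator \<mu> k (\<lambda>z. c * \<xi> z) x = c * integral_operator \<mu> k \<xi> x" for c
      by (simp add: integral_operator_def mult.left_commute[of _ c])
    fix \<eta> assume \<eta>: "\<eta> \<in> L2 \<mu>"
    show "AE x in \<mu>. integral_operator \<mu> k (\<lambda>z. \<xi> z + \<eta> z) x = integral_operator \<mu> k \<xi> x + integral_operator \<mu> k \<eta> x"
      using int[OF \<xi>] int[OF \<eta>] by eventually_elim (simp add: integral_operator_def distrib_left)
  next
    show "\<exists>C. \<forall>\<xi>\<in>L2 \<mu>. L2_nrm \<mu> (integral_operator \<mu> k \<xi>) \<le> C * L2_nrm \<mu> \<xi>" using L2 by blast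
  qed
qed

lemma integral_operator_diff:
  assumes "k \<in> L2 (\<mu> \<Otimes>\<^sub>M \<mu>)" "k' \<in> L2 (\<mu> \<Otimes>\<^sub>M \<mu>)" "\<xi> \<in> L2 \<mu>"
  shows "AE y in \<mu>. integral_operator \<mu> (\<lambda>z. k z - k' z) \<xi> y = integral_operator \<mu> k \<xi> y - integral_operator \<mu> k' \<xi> y"
  using integral_operator_bounded(2)[OF assms(1,3)] integral_operator_bounded(2)[OF assms(2,3)]
  by eventually_elim (simp add: integral_operator_def left_diff_distrib)

text \<open>
  The pseudomeasure with the prescribed transform \<open>d\<close>, which should be bounded on the dual group.
\<close>
definition pm_of :: "(('a \<Rightarrow> complex) \<Rightarrow> complex) \<Rightarrow> (('a \<Rightarrow> complex) \<Rightarrow> complex)"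
  where "pm_of d = (\<lambda>u\<in>fourier_algebra. \<Sum>\<^sub>\<infinity>\<gamma>\<in>dual_group. coef u \<gamma> * d \<gamma>)"

lemma coef_pairing:
  assumes a: "a \<in> l1_dual" and d: "\<And>\<gamma>. \<gamma> \<in> dual_group \<Longrightarrow> norm (d \<gamma>) \<le> C"
  shows "(\<lambda>\<gamma>. norm (a \<gamma> * d \<gamma>)) summable_on dual_group" "(\<lambda>\<gamma>. a \<gamma> * d \<gamma>) summable_on dual_group"
    "norm (\<Sum>\<^sub>\<infinity>\<gamma>\<in>dual_group. a \<gamma> * d \<gamma>) \<le> C * (\<Sum>\<^sub>\<infinity>\<gamma>\<in>dual_group. norm (a \<gamma>))"
proof -
  have sa: "(\<lambda>\<gamma>. C * norm (a \<gamma>)) summable_on dual_group"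
    using a by (intro summable_on_cmult_right) (simp add: l1_dual_def)
  have le: "norm (a \<gamma> * d \<gamma>) \<le> C * norm (a \<gamma>)" if "\<gamma> \<in> dual_group" for \<gamma>
    using mult_right_mono[OF d[OF that] norm_ge_zero[of "a \<gamma>"]] by (simp add: norm_mult mult.commute)
  show s: "(\<lambda>\<gamma>. norm (a \<gamma> * d \<gamma>)) summable_on dual_group"
    by (rule Infinite_Sum.abs_summable_on_comparison_test'[OF sa le])
  show "(\<lambda>\<gamma>. a \<gamma> * d \<gamma>) summable_on dual_group" by (rule abs_summable_summable[OF s])
  have "norm (\<Sum>\<^sub>\<infinity>\<gamma>\<in>dual_group. a \<gamma> * d \<gamma>) \<le> (\<Sum>\<^sub>\<infinity>\<gamma>\<in>dual_group. norm (a \<gamma> * d \<gamma>))"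
    by (rule norm_infsum_bound[OF s])
  also have "\<dots> \<le> (\<Sum>\<^sub>\<infinity>\<gamma>\<in>dual_group. C * norm (a \<gamma>))" by (rule infsum_mono[OF s sa le])
  finally show "norm (\<Sum>\<^sub>\<infinity>\<gamma>\<in>dual_group. a \<gamma> * d \<gamma>) \<le> C * (\<Sum>\<^sub>\<infinity>\<gamma>\<in>dual_group. norm (a \<gamma>))"
    by (simp add: infsum_cmult_right')
qed

lemma pm_of_pseudomeasure:
  assumes d: "\<And>\<gamma>. \<gamma> \<in> dual_group \<Longrightarrow> norm (d \<gamma>) \<le> C"
  shows "pm_of d \<in> pseudomeasures"
  unfolding pseudomeasures_def mem_Collect_eq
proof (intro conjI ballI allI)
  show "pm_of d \<in> extensional fourier_algebra" by (simp add: pm_of_def)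
  fix u :: "'a \<Rightarrow> complex" assume u: "u \<in> fourier_algebra"
  show "pm_of d (\<lambda>s. c * u s) = c * pm_of d u" for c
    using u by (simp add: pm_of_def fourier_algebra_scale coef_scale mult.assoc infsum_cmult_right')
  fix v :: "'a \<Rightarrow> complex" assume v: "v \<in> fourier_algebra"
  have "(\<Sum>\<^sub>\<infinity>\<gamma>\<in>dual_group. coef (\<lambda>s. u s + v s) \<gamma> * d \<gamma>) = (\<Sum>\<^sub>\<infinity>\<gamma>\<in>dual_group. coef u \<gamma> * d \<gamma> + coef v \<gamma> * d \<gamma>)"
    by (rule infsum_cong) (simp add: coef_add fourier_algebra_bounded_borel u v distrib_right)
  also have "\<dots> = (\<Sum>\<^sub>\<infinity>\<gamma>\<in>dual_group. coef u \<gamma> * d \<gamma>) + (\<Sum>\<^sub>\<infinity>\<gamma>\<in>dual_group. coef v \<gamma> * d \<gamma>)"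
    by (intro infsum_add coef_pairing(2)[OF _ d] fourier_algebraD(1) u v)
  finally show "pm_of d (\<lambda>s. u s + v s) = pm_of d u + pm_of d v"
    using u v by (simp add: pm_of_def fourier_algebra_add)
next
  show "\<exists>C. \<forall>a\<in>l1_dual. norm (pm_of d (fourier_transform a)) \<le> C * (\<Sum>\<^sub>\<infinity>\<gamma>\<in>dual_group. norm (a \<gamma>))"
  proof (intro exI ballI)
    fix a :: "('a \<Rightarrow> complex) \<Rightarrow> complex" assume a: "a \<in> l1_dual"
    then have "pm_of d (fourier_transform a) = (\<Sum>\<^sub>\<infinity>\<gamma>\<in>dual_group. coef (fourier_transform a) \<gamma> * d \<gamma>)"
      by (simp add: pm_of_def fourier_algebra_def)
    also have "\<dots> = (\<Sum>\<^sub>\<infinity>\<gamma>\<in>dual_group. a \<gamma> * d \<gamma>)"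
      by (rule infsum_cong) (simp add: coef_fourier_transform a)
    finally show "norm (pm_of d (fourier_transform a)) \<le> C * (\<Sum>\<^sub>\<infinity>\<gamma>\<in>dual_group. norm (a \<gamma>))"
      using coef_pairing(3)[OF a d] by simp
  qed
qed

lemma pm_transform_pm_of: 
  assumes \<gamma>: "\<gamma> \<in> dual_group" shows "pm_transform (pm_of d) \<gamma> = d \<gamma>"
proof -
  have "((\<lambda>\<delta>. coef (\<lambda>s. cnj (\<gamma> s)) \<delta> * d \<delta>) has_sum d \<gamma>) dual_group"
    by (rule has_sum_finite_neutralI[of "{\<gamma>}"]) (use \<gamma> in \<open>auto simp: coef_character\<close>)
  then show ?thesis
    by (simp add: pm_transform_def pm_of_def fourier_algebra_character \<gamma> infsumI)
qed

text \<open>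
  Finite partial sums are handled by linearity, and boundedness of \<open>F\<close> controls the tails in the norm of the
  Fourier algebra.
\<close>
lemma pseudomeasure_expansion:
  assumes F: "F \<in> pseudomeasures" and a: "a \<in> l1_dual"
  shows "((\<lambda>\<gamma>. a \<gamma> * pm_transform F \<gamma>) has_sum F (fourier_transform a)) (dual_group :: ('a \<Rightarrow> complex) set)"
proof -
  obtain C where C: "\<And>b. b \<in> l1_dual \<Longrightarrow> norm (F (fourier_transform b)) \<le> C * (\<Sum>\<^sub>\<infinity>\<gamma>\<in>dual_group. norm (b \<gamma>))"
    and add: "\<And>u v. u \<in> fourier_algebra \<Longrightarrow> v \<in> fourier_algebra \<Longrightarrow> F (\<lambda>s. u s + v s) = F u + F v"
    and scale: "\<And>c u. u \<in> fourier_algebra \<Longrightarrow> F (\<lambda>s. c * u s) = c * F u"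
    using F unfolding pseudomeasures_def by blast
  have F0: "F (\<lambda>s. 0) = 0" using scale[OF fourier_algebra_character[OF dual_group_one], of 0] by simp
  have fin: "(\<lambda>s. \<Sum>\<gamma>\<in>G. a \<gamma> * cnj (\<gamma> s)) \<in> fourier_algebra \<and>
      F (\<lambda>s. \<Sum>\<gamma>\<in>G. a \<gamma> * cnj (\<gamma> s)) = (\<Sum>\<gamma>\<in>G. a \<gamma> * pm_transform F \<gamma>)" if "finite G" "G \<subseteq> dual_group" for G
    using that
  proof (induction G)
    case empty
    show ?case using fourier_algebra_scale[OF fourier_algebra_character[OF dual_group_one], of 0] F0 by simp
  next
    case (insert \<gamma> G)
    have "(\<lambda>s. a \<gamma> * cnj (\<gamma> s)) \<in> fourier_algebra" "F (\<lambda>s. a \<gamma> * cnj (\<gamma> s)) = a \<gamma> * pm_transform F \<gamma>"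
      using insert by (auto simp: pm_transform_def intro!: fourier_algebra_scale fourier_algebra_character scale)
    then show ?case using insert by (simp add: fourier_algebra_add add)
  qed
  have sa: "(\<lambda>\<gamma>. norm (a \<gamma>)) summable_on dual_group" using a by (simp add: l1_dual_def)
  define S where "S = (\<Sum>\<^sub>\<infinity>\<gamma>\<in>dual_group. norm (a \<gamma>))"
  show ?thesis
    unfolding has_sum_def
  proof (rule tendstoI)
    fix r :: real assume r: "r > 0"
    have "((\<lambda>\<gamma>. norm (a \<gamma>)) has_sum S) dual_group" unfolding S_def using sa by (rule has_sum_infsum)
    then have "eventually (\<lambda>G. dist (\<Sum>\<gamma>\<in>G. norm (a \<gamma>)) S < r / (\<bar>C\<bar> + 1)) (finite_subsets_at_top dual_group)"
      unfolding has_sum_def by (rule tendstoD) (use r in auto)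
    moreover have "eventually (\<lambda>G. finite G \<and> G \<subseteq> dual_group) (finite_subsets_at_top dual_group)"
      by (rule eventually_finite_subsets_at_top_weakI) auto
    ultimately show "eventually (\<lambda>G. dist (\<Sum>\<gamma>\<in>G. a \<gamma> * pm_transform F \<gamma>) (F (fourier_transform a)) < r) (finite_subsets_at_top dual_group)"
    proof eventually_elim
      case (elim G)
      define b where "b \<gamma> = (if \<gamma> \<in> G then 0 else a \<gamma>)" for \<gamma>
      define a' where "a' \<gamma> = (if \<gamma> \<in> G then a \<gamma> else 0)" for \<gamma>
      have b: "b \<in> l1_dual" unfolding l1_dual_def mem_Collect_eq
        by (rule Infinite_Sum.abs_summable_on_comparison_test'[OF sa]) (simp add: b_def)
      have a': "a' \<in> l1_dual" unfolding a'_def[abs_def] using elim by (intro finite_support_l1_dual) auto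
      have sum_eq: "fourier_transform a = (\<lambda>s. fourier_transform a' s + fourier_transform b s)"
      proof
        fix s :: 'a
        have "a = (\<lambda>\<gamma>. a' \<gamma> + b \<gamma>)" by (auto simp: a'_def b_def)
        then show "fourier_transform a s = fourier_transform a' s + fourier_transform b s"
          using fourier_transform_add[OF a' b, of s] by simp
      qed
      have "F (fourier_transform a) = F (fourier_transform a') + F (fourier_transform b)"
        unfolding sum_eq by (rule add) (use a' b in \<open>auto simp: fourier_algebra_def\<close>)
      moreover have "fourier_transform a' = (\<lambda>s. \<Sum>\<gamma>\<in>G. a \<gamma> * cnj (\<gamma> s))"
        unfolding a'_def[abs_def] by (rule ext, rule fourier_transform_finite_support) (use elim in auto)
      then have "F (fourier_transform a') = (\<Sum>\<gamma>\<in>G. a \<gamma> * pm_transform F \<gamma>)" using fin elim by simp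
      moreover have "(\<Sum>\<^sub>\<infinity>\<gamma>\<in>dual_group. norm (b \<gamma>)) = S - (\<Sum>\<gamma>\<in>G. norm (a \<gamma>))"
      proof -
        have a's: "(\<lambda>\<gamma>. norm (a' \<gamma>)) summable_on dual_group" and bs: "(\<lambda>\<gamma>. norm (b \<gamma>)) summable_on dual_group"
          using a' b by (auto simp: l1_dual_def)
        have "S = (\<Sum>\<^sub>\<infinity>\<gamma>\<in>dual_group. norm (a' \<gamma>) + norm (b \<gamma>))"
          unfolding S_def by (rule infsum_cong) (simp add: a'_def b_def)
        also have "\<dots> = (\<Sum>\<^sub>\<infinity>\<gamma>\<in>dual_group. norm (a' \<gamma>)) + (\<Sum>\<^sub>\<infinity>\<gamma>\<in>dual_group. norm (b \<gamma>))"
          by (rule infsum_add[OF a's bs])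
        also have "(\<Sum>\<^sub>\<infinity>\<gamma>\<in>dual_group. norm (a' \<gamma>)) = (\<Sum>\<gamma>\<in>G. norm (a \<gamma>))"
          by (rule infsumI, rule has_sum_finite_neutralI[of G]) (use elim in \<open>auto simp: a'_def\<close>)
        finally show ?thesis by simp
      qed
      moreover have "norm (F (fourier_transform b)) \<le> \<bar>C\<bar> * (\<Sum>\<^sub>\<infinity>\<gamma>\<in>dual_group. norm (b \<gamma>))"
        using C[OF b] mult_right_mono[OF abs_ge_self[of C], of "\<Sum>\<^sub>\<infinity>\<gamma>\<in>dual_group. norm (b \<gamma>)"]
        by (simp add: infsum_nonneg)
      moreover have "\<bar>C\<bar> * (S - (\<Sum>\<gamma>\<in>G. norm (a \<gamma>))) < r"
      proof -
        have "\<bar>C\<bar> * (S - (\<Sum>\<gamma>\<in>G. norm (a \<gamma>))) \<le> \<bar>C\<bar> * (r / (\<bar>C\<bar> + 1))"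
          using elim by (intro mult_left_mono) (auto simp: dist_real_def)
        also have "\<dots> < r" using r by (simp add: field_simps)
        finally show ?thesis .
      qed
      ultimately show ?case by (simp add: dist_norm)
    qed
  qed
qed

lemma J_ideal_mult:
  assumes "h \<in> J_ideal \<mu> f" "u \<in> fourier_algebra" shows "(\<lambda>s. h s * u s) \<in> J_ideal \<mu> f"
proof -
  obtain g where g: "g \<in> fourier_algebra" "AE s in \<mu>. f s * h s = g s" and h: "h \<in> fourier_algebra"
    using assms(1) by (auto simp: J_ideal_def)
  from g(2) have "AE s in \<mu>. f s * (h s * u s) = g s * u s"
    by eventually_elim (simp add: mult.assoc[symmetric])
  then show ?thesis
    using fourier_algebra_mult[OF h assms(2)] fourier_algebra_mult[OF g(1) assms(2)]
    unfolding J_ideal_def by (intro CollectI conjI bexI[of _ "\<lambda>s. g s * u s"])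
qed

lemma closed_E_set: "closed (E_set \<mu> f)"
proof -
  have "closed {s. h s = 0}" if "h \<in> J_ideal \<mu> f" for h
    using that by (intro closed_Collect_eq fourier_algebra_continuous continuous_on_const) (auto simp: J_ideal_def)
  then have "closed (\<Inter>h\<in>J_ideal \<mu> f. {s. h s = 0})" by (intro closed_INT) auto
  moreover have "(\<Inter>h\<in>J_ideal \<mu> f. {s. h s = 0}) = E_set \<mu> f" by (auto simp: E_set_def)
  ultimately show ?thesis by simp
qed

text \<open>
  Outside \<open>E_set\<close> some \<open>h\<close> in \<open>J_ideal\<close> does not vanish, and \<open>h F = 0\<close> because \<open>J_ideal\<close> is an ideal.
\<close>
lemma annihilator_J_ideal_supported:
  assumes F: "F \<in> pseudomeasures" and J: "\<And>h. h \<in> J_ideal \<mu> f \<Longrightarrow> F h = 0"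
  shows "F \<in> PM (E_set \<mu> f)"
proof -
  have "x \<in> E_set \<mu> f" if x: "x \<in> pm_support F" for x
  proof (rule ccontr)
    assume "x \<notin> E_set \<mu> f"
    then obtain h where h: "h \<in> J_ideal \<mu> f" "h x \<noteq> 0" by (auto simp: E_set_def)
    have "pm_mult h F = zero_pm"
      unfolding pm_mult_def zero_pm_def by (rule restrict_ext) (rule J[OF J_ideal_mult[OF h(1)]])
    then show False using x h by (auto simp: pm_support_def J_ideal_def)
  qed
  then show ?thesis using F by (auto simp: PM_def)
qed

end

section \<open>Closability from the absence of pseudofunctions\<close>

context compact_haar begin

lemma L2_nrm_character_mult:
  "\<gamma> \<in> dual_group \<Longrightarrow> L2_nrm \<mu> (\<lambda>x. \<gamma> x * \<xi> x) = L2_nrm \<mu> \<xi>"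
  "\<gamma> \<in> dual_group \<Longrightarrow> L2_nrm \<mu> (\<lambda>x. cnj (\<gamma> x) * \<xi> x) = L2_nrm \<mu> \<xi>"
  by (simp_all add: L2_nrm_def norm_mult dual_groupD(3))

lemma bounded_borel_square_measurable:
  assumes "g \<in> bounded_borel"
  shows "(\<lambda>z. g (fst z)) \<in> borel_measurable (\<mu> \<Otimes>\<^sub>M \<mu>)" "(\<lambda>z. g (snd z)) \<in> borel_measurable (\<mu> \<Otimes>\<^sub>M \<mu>)"
    "(\<lambda>z. g (fst z - snd z)) \<in> borel_measurable (\<mu> \<Otimes>\<^sub>M \<mu>)"
  by (rule measurable_compose[OF _ bounded_borel_measurable[OF assms]], measurable)+

lemma L2_square_tensor:
  assumes k: "k \<in> L2 (\<mu> \<Otimes>\<^sub>M \<mu>)" and \<xi>: "\<xi> \<in> bounded_borel" and \<eta>: "\<eta> \<in> bounded_borel"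
  shows "(\<lambda>z. k z * \<xi> (fst z) * \<eta> (snd z)) \<in> L2 (\<mu> \<Otimes>\<^sub>M \<mu>)"
proof -
  obtain C D where "\<And>x. norm (\<xi> x) \<le> C" "\<And>x. norm (\<eta> x) \<le> D" using \<xi> \<eta> by (metis bounded_borelE)
  then have "(\<lambda>z. \<eta> (snd z) * (\<xi> (fst z) * k z)) \<in> L2 (\<mu> \<Otimes>\<^sub>M \<mu>)"
    by (intro L2_mult_bounded(1)[of _ _ "\<lambda>z. \<eta> (snd z)" D] L2_mult_bounded(1)[of _ _ "\<lambda>z. \<xi> (fst z)" C]
        k bounded_borel_square_measurable \<xi> \<eta>)
  then show ?thesis by (simp add: mult_ac)
qed

lemma L2_square_integrable: "G \<in> L2 (\<mu> \<Otimes>\<^sub>M \<mu>) \<Longrightarrow> integrable (\<mu> \<Otimes>\<^sub>M \<mu>) G"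
  using L2_integrable_mult[of G "\<mu> \<Otimes>\<^sub>M \<mu>" "\<lambda>_. 1"] by (simp add: L2_def)

lemma integral_operator_pairing:
  assumes k: "k \<in> L2 (\<mu> \<Otimes>\<^sub>M \<mu>)" and \<xi>: "\<xi> \<in> bounded_borel" and \<eta>: "\<eta> \<in> bounded_borel"
  shows "(LINT y|\<mu>. integral_operator \<mu> k \<xi> y * \<eta> y) = (LINT z|(\<mu> \<Otimes>\<^sub>M \<mu>). k z * \<xi> (fst z) * \<eta> (snd z))"
proof -
  have "integrable (\<mu> \<Otimes>\<^sub>M \<mu>) (\<lambda>(x, y). k (x, y) * \<xi> x * \<eta> y)"
    using L2_square_integrable[OF L2_square_tensor[OF assms]] by (simp add: case_prod_unfold)
  from square.integral_snd[OF this]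
  show ?thesis by (simp add: integral_operator_def case_prod_unfold)
qed

lemma character_square_orthogonal:
  assumes \<gamma>: "\<gamma> \<in> dual_group" and \<delta>: "\<delta> \<in> dual_group" and ne: "\<gamma> \<noteq> \<delta>"
  shows "(LINT z|(\<mu> \<Otimes>\<^sub>M \<mu>). \<gamma> (fst z - snd z) * cnj (\<delta> (fst z - snd z))) = 0"
proof -
  define \<theta> where "\<theta> x = \<gamma> x * cnj (\<delta> x)" for x
  have \<theta>: "\<theta> \<in> dual_group" unfolding \<theta>_def[abs_def] by (intro dual_group_mult dual_group_cnj \<gamma> \<delta>)
  have "integrable (\<mu> \<Otimes>\<^sub>M \<mu>) (\<lambda>(x, y). \<theta> (x - y))"
    using bounded_borel_square_measurable(3)[OF dual_groupD(9)[OF \<theta>]] dual_groupD(3)[OF \<theta>]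
    by (intro square.integrable_const_bound[where B = 1]) (auto simp: case_prod_unfold)
  from square.integral_snd[OF this]
  have "(LINT z|(\<mu> \<Otimes>\<^sub>M \<mu>). \<theta> (fst z - snd z)) = (LINT y|\<mu>. LINT x|\<mu>. \<theta> (x - y))"
    by (simp add: case_prod_unfold)
  moreover have "(LINT x|\<mu>. \<theta> (x - y)) = 0" for y
    using integral_translate(3)[OF bounded_borel_measurable[OF dual_groupD(9)[OF \<theta>]], of y]
      character_integral[OF \<gamma> \<delta>] ne by (simp add: \<theta>_def)
  ultimately have "(LINT z|(\<mu> \<Otimes>\<^sub>M \<mu>). \<theta> (fst z - snd z)) = 0" by simp
  then show ?thesis by (simp only: \<theta>_def)
qed

text \<open>
  The matrix coefficients \<open>d \<gamma>\<close> of \<open>D\<close> between \<open>cnj \<gamma> \<cdot> \<xi>\<close> and \<open>\<gamma> \<cdot> \<eta>\<close> are the transform of a pseudofunction supported in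
  \<open>E_set\<close>, which must vanish; \<open>d\<close> at the trivial character is the integral in question.
\<close>
theorem limit_operator_zero:
  assumes D: "D \<in> bounded_operators \<mu>"
    and approx: "\<And>\<epsilon>. \<epsilon> > 0 \<Longrightarrow> \<exists>k\<in>L2 (\<mu> \<Otimes>\<^sub>M \<mu>). \<exists>g\<in>L2 (\<mu> \<Otimes>\<^sub>M \<mu>).
      (AE z in \<mu> \<Otimes>\<^sub>M \<mu>. g z = f (fst z - snd z) * k z) \<and>
      (\<forall>\<xi>\<in>L2 \<mu>. L2_nrm \<mu> (integral_operator \<mu> k \<xi>) \<le> \<epsilon> * L2_nrm \<mu> \<xi> \<and>
        L2_nrm \<mu> (\<lambda>x. D \<xi> x - integral_operator \<mu> g \<xi> x) \<le> \<epsilon> * L2_nrm \<mu> \<xi>)"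
    and not_M: "\<not> M_set (E_set \<mu> f)"
    and \<xi>: "\<xi> \<in> bounded_borel" and \<eta>: "\<eta> \<in> bounded_borel"
  shows "(LINT y|\<mu>. D \<xi> y * \<eta> y) = 0"
proof -
  note D_L2 = bounded_operatorsD(1)[OF D]
  obtain C where C: "C \<ge> 0" "\<And>\<xi>. \<xi> \<in> L2 \<mu> \<Longrightarrow> L2_nrm \<mu> (D \<xi>) \<le> C * L2_nrm \<mu> \<xi>"
    using bounded_operatorsD(4)[OF D] by auto
  define \<xi>' where "\<xi>' \<gamma> = (\<lambda>x. cnj (\<gamma> x) * \<xi> x)" for \<gamma>
  define \<eta>' where "\<eta>' \<gamma> = (\<lambda>x. \<gamma> x * \<eta> x)" for \<gamma>
  have \<xi>': "\<xi>' \<gamma> \<in> bounded_borel" "L2_nrm \<mu> (\<xi>' \<gamma>) = L2_nrm \<mu> \<xi>"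
    and \<eta>': "\<eta>' \<gamma> \<in> bounded_borel" "L2_nrm \<mu> (\<eta>' \<gamma>) = L2_nrm \<mu> \<eta>" if "\<gamma> \<in> dual_group" for \<gamma>
    using that \<xi> \<eta> dual_groupD(9)[OF that]
    by (auto simp: \<xi>'_def \<eta>'_def L2_nrm_character_mult intro: bounded_borel_mult bounded_borel_cnj)
  define W where "W = L2_nrm \<mu> \<xi> * L2_nrm \<mu> \<eta>"
  have W: "W \<ge> 0" by (simp add: W_def)
  define d where "d \<gamma> = (LINT y|\<mu>. D (\<xi>' \<gamma>) y * \<eta>' \<gamma> y)" for \<gamma>
  have pair_le: "norm (LINT y|\<mu>. v y * \<eta>' \<gamma> y) \<le> c * W"
    if "\<gamma> \<in> dual_group" "v \<in> L2 \<mu>" "L2_nrm \<mu> v \<le> c * L2_nrm \<mu> (\<xi>' \<gamma>)" for v \<gamma> c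
  proof -
    have "norm (LINT y|\<mu>. v y * \<eta>' \<gamma> y) \<le> L2_nrm \<mu> v * L2_nrm \<mu> (\<eta>' \<gamma>)"
      by (rule L2_Cauchy_Schwarz[OF that(2) bounded_borel_L2[OF \<eta>'(1)[OF that(1)]]])
    also have "\<dots> \<le> c * L2_nrm \<mu> \<xi> * L2_nrm \<mu> \<eta>"
      using that(3) \<xi>'(2)[OF that(1)] \<eta>'(2)[OF that(1)] by (simp add: mult_right_mono)
    finally show ?thesis by (simp add: W_def mult.assoc)
  qed
  have d_bound: "norm (d \<gamma>) \<le> C * W" if "\<gamma> \<in> dual_group" for \<gamma>
    unfolding d_def by (rule pair_le[OF that D_L2 C(2)]) (rule bounded_borel_L2[OF \<xi>'(1)[OF that]])+
  have F: "pm_of d \<in> pseudomeasures" by (rule pm_of_pseudomeasure[OF d_bound])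
  \<comment> \<open>the matrix coefficients of an integral operator are Fourier coefficients on the square of the group\<close>
  define G where "G k z = k z * \<xi> (fst z) * \<eta> (snd z)" for k z
  have G: "G k \<in> L2 (\<mu> \<Otimes>\<^sub>M \<mu>)" if "k \<in> L2 (\<mu> \<Otimes>\<^sub>M \<mu>)" for k
    unfolding G_def[abs_def] by (rule L2_square_tensor[OF that \<xi> \<eta>])
  have coefficient: "(LINT y|\<mu>. integral_operator \<mu> k (\<xi>' \<gamma>) y * \<eta>' \<gamma> y)
      = (LINT z|(\<mu> \<Otimes>\<^sub>M \<mu>). cnj (\<gamma> (fst z - snd z)) * G k z)" if "k \<in> L2 (\<mu> \<Otimes>\<^sub>M \<mu>)" "\<gamma> \<in> dual_group" for k \<gamma>
  proof -
    have "(LINT y|\<mu>. integral_operator \<mu> k (\<xi>' \<gamma>) y * \<eta>' \<gamma> y) = (LINT z|(\<mu> \<Otimes>\<^sub>M \<mu>). k z * \<xi>' \<gamma> (fst z) * \<eta>' \<gamma> (snd z))"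
      by (rule integral_operator_pairing[OF that(1) \<xi>'(1)[OF that(2)] \<eta>'(1)[OF that(2)]])
    then show ?thesis
      by (simp add: \<xi>'_def \<eta>'_def G_def dual_groupD(6)[OF that(2)] mult_ac)
  qed
  define \<Phi> where "\<Phi> k u = (LINT z|(\<mu> \<Otimes>\<^sub>M \<mu>). u (fst z - snd z) * G k z)" for k u
  have \<Phi>: "((\<lambda>\<gamma>. coef u \<gamma> * (LINT y|\<mu>. integral_operator \<mu> k (\<xi>' \<gamma>) y * \<eta>' \<gamma> y)) has_sum \<Phi> k u) dual_group"
    if k: "k \<in> L2 (\<mu> \<Otimes>\<^sub>M \<mu>)" and u: "u \<in> fourier_algebra" for k u
  proof -
    have "((\<lambda>\<gamma>. coef u \<gamma> * (LINT z|(\<mu> \<Otimes>\<^sub>M \<mu>). cnj (\<gamma> (fst z - snd z)) * G k z)) has_sum \<Phi> k u) dual_group"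
      unfolding \<Phi>_def
    proof (rule has_sum_integral)
      show "(\<lambda>\<gamma>. norm (coef u \<gamma>)) summable_on dual_group"
        using fourier_algebraD(1)[OF u] by (simp add: l1_dual_def)
      show "u (fst z - snd z) = (\<Sum>\<^sub>\<infinity>\<gamma>\<in>dual_group. coef u \<gamma> * cnj (\<gamma> (fst z - snd z)))" for z :: "'a \<times> 'a"
        using fun_cong[OF fourier_algebraD(2)[OF u], of "fst z - snd z"] by (simp add: fourier_transform_def)
      show "(\<lambda>z. cnj (\<gamma> (fst z - snd z))) \<in> borel_measurable (\<mu> \<Otimes>\<^sub>M \<mu>)" if "\<gamma> \<in> dual_group" for \<gamma>
        by (rule bounded_borel_square_measurable(3)[OF bounded_borel_cnj[OF dual_groupD(9)[OF that]]])
      show "(\<lambda>z. u (fst z - snd z)) \<in> borel_measurable (\<mu> \<Otimes>\<^sub>M \<mu>)"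
        by (rule bounded_borel_square_measurable(3)[OF fourier_algebra_bounded_borel[OF u]])
      show "integrable (\<mu> \<Otimes>\<^sub>M \<mu>) (G k)" by (rule L2_square_integrable[OF G[OF k]])
    qed (simp add: dual_groupD(3))
    then show ?thesis
      by (subst has_sum_cong[where g = "\<lambda>\<gamma>. coef u \<gamma> * (LINT z|(\<mu> \<Otimes>\<^sub>M \<mu>). cnj (\<gamma> (fst z - snd z)) * G k z)"])
         (simp_all add: coefficient k)
  qed
  define A where "A u = (\<Sum>\<^sub>\<infinity>\<gamma>\<in>dual_group. norm (coef u \<gamma>))" for u
  have A: "A u \<ge> 0" for u unfolding A_def by (rule infsum_nonneg) auto
  \<comment> \<open>the pairing of \<open>pm_of d\<close> with \<open>h\<close> is close to \<open>\<Phi> g h\<close>, which equals \<open>\<Phi> k h'\<close> since \<open>g\<close> is \<open>f (x - y) k\<close>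
    and \<open>h' = f h\<close>, and \<open>\<Phi> k h'\<close> is small because the operator of \<open>k\<close> is\<close>
  have vanish: "pm_of d h = 0" if h: "h \<in> J_ideal \<mu> f" for h
  proof -
    obtain h' where hA: "h \<in> fourier_algebra" and h'A: "h' \<in> fourier_algebra" and fh: "AE s in \<mu>. f s * h s = h' s"
      using h by (auto simp: J_ideal_def)
    have small: "norm (pm_of d h) \<le> \<epsilon> * (W * (A h + A h'))" if \<epsilon>: "\<epsilon> > 0" for \<epsilon>
    proof -
      obtain k g where k: "k \<in> L2 (\<mu> \<Otimes>\<^sub>M \<mu>)" and g: "g \<in> L2 (\<mu> \<Otimes>\<^sub>M \<mu>)"
        and gk: "AE z in \<mu> \<Otimes>\<^sub>M \<mu>. g z = f (fst z - snd z) * k z"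
        and k_small: "\<And>\<xi>. \<xi> \<in> L2 \<mu> \<Longrightarrow> L2_nrm \<mu> (integral_operator \<mu> k \<xi>) \<le> \<epsilon> * L2_nrm \<mu> \<xi>"
        and g_close: "\<And>\<xi>. \<xi> \<in> L2 \<mu> \<Longrightarrow> L2_nrm \<mu> (\<lambda>x. D \<xi> x - integral_operator \<mu> g \<xi> x) \<le> \<epsilon> * L2_nrm \<mu> \<xi>"
        using approx[OF \<epsilon>] by blast
      note IkL2 = bounded_operatorsD(1)[OF integral_operator_bounded(1)[OF k]]
      note IgL2 = bounded_operatorsD(1)[OF integral_operator_bounded(1)[OF g]]
      have "norm (pm_of d h - \<Phi> g h) \<le> \<epsilon> * W * A h"
      proof -
        have eq: "pm_of d h - \<Phi> g h = (\<Sum>\<^sub>\<infinity>\<gamma>\<in>dual_group. coef h \<gamma> * (d \<gamma> - (LINT y|\<mu>. integral_operator \<mu> g (\<xi>' \<gamma>) y * \<eta>' \<gamma> y)))"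
          using infsum_diff_complex[OF coef_pairing(2)[OF fourier_algebraD(1)[OF hA] d_bound] has_sum_imp_summable[OF \<Phi>[OF g hA]]]
            infsumI[OF \<Phi>[OF g hA]] hA
          by (simp add: pm_of_def right_diff_distrib)
        have "norm (d \<gamma> - (LINT y|\<mu>. integral_operator \<mu> g (\<xi>' \<gamma>) y * \<eta>' \<gamma> y)) \<le> \<epsilon> * W" if \<gamma>: "\<gamma> \<in> dual_group" for \<gamma>
        proof -
          note x = bounded_borel_L2[OF \<xi>'(1)[OF \<gamma>]] and e = bounded_borel_L2[OF \<eta>'(1)[OF \<gamma>]]
          have "d \<gamma> - (LINT y|\<mu>. integral_operator \<mu> g (\<xi>' \<gamma>) y * \<eta>' \<gamma> y)
              = (LINT y|\<mu>. (D (\<xi>' \<gamma>) y - integral_operator \<mu> g (\<xi>' \<gamma>) y) * \<eta>' \<gamma> y)"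
            unfolding d_def left_diff_distrib
            by (rule Bochner_Integration.integral_diff[symmetric]; rule L2_integrable_mult[OF _ e]; rule D_L2[OF x] IgL2[OF x])
          also have "norm \<dots> \<le> \<epsilon> * W" by (rule pair_le[OF \<gamma> L2_diff[OF D_L2[OF x] IgL2[OF x]] g_close[OF x]])
          finally show ?thesis .
        qed
        from coef_pairing(3)[OF fourier_algebraD(1)[OF hA] this]
        show ?thesis unfolding eq A_def .
      qed
      moreover have "norm (\<Phi> k h') \<le> \<epsilon> * W * A h'"
      proof -
        define dk where "dk \<gamma> = (LINT y|\<mu>. integral_operator \<mu> k (\<xi>' \<gamma>) y * \<eta>' \<gamma> y)" for \<gamma>
        have bound: "norm (dk \<gamma>) \<le> \<epsilon> * W" if \<gamma>: "\<gamma> \<in> dual_group" for \<gamma>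
          unfolding dk_def by (rule pair_le[OF \<gamma> IkL2 k_small]) (rule bounded_borel_L2[OF \<xi>'(1)[OF \<gamma>]])+
        from coef_pairing(3)[OF fourier_algebraD(1)[OF h'A], of dk, OF bound]
        show ?thesis unfolding dk_def infsumI[OF \<Phi>[OF k h'A]] A_def .
      qed
      moreover have "\<Phi> g h = \<Phi> k h'"
        unfolding \<Phi>_def
      proof (rule integral_cong_AE)
        show "AE z in \<mu> \<Otimes>\<^sub>M \<mu>. h (fst z - snd z) * G g z = h' (fst z - snd z) * G k z"
          using gk AE_square_diff[OF fh]
        proof eventually_elim
          case (elim z)
          have "h (fst z - snd z) * G g z = (f (fst z - snd z) * h (fst z - snd z)) * G k z"
            by (simp add: G_def elim(1) mult_ac)
          then show ?case by (simp only: elim(2))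
        qed
      qed (intro borel_measurable_times bounded_borel_square_measurable(3)[OF fourier_algebra_bounded_borel] L2_measurable[OF G] hA h'A g k)+
      ultimately have "norm (pm_of d h) \<le> \<epsilon> * W * A h + \<epsilon> * W * A h'"
        using norm_triangle_sub[of "pm_of d h" "\<Phi> g h"] by simp
      then show ?thesis by (simp add: algebra_simps)
    qed
    define c where "c = W * (A h + A h')"
    have c: "c \<ge> 0" unfolding c_def using W A[of h] A[of h'] by simp
    have "norm (pm_of d h) \<le> 0 + e" if "e > 0" for e
    proof -
      have "norm (pm_of d h) \<le> e / (c + 1) * c" using small[of "e / (c + 1)"] that c by (simp add: c_def)
      also have "\<dots> \<le> e" using that c by (simp add: field_simps)
      finally show ?thesis by simp
    qed
    then have "norm (pm_of d h) \<le> 0" by (rule field_le_epsilon)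
    then show ?thesis by simp
  qed
  have "pm_of d \<in> PM (E_set \<mu> f)" by (rule annihilator_J_ideal_supported[OF F vanish])
  moreover have "pm_of d \<in> pseudofunctions"
    unfolding pseudofunctions_def mem_Collect_eq
  proof (intro conjI F allI impI)
    fix \<delta> :: real assume \<delta>: "\<delta> > 0"
    define \<epsilon> where "\<epsilon> = \<delta> / (2 * (W + 1))"
    have \<epsilon>: "\<epsilon> > 0" using \<delta> W by (simp add: \<epsilon>_def)
    have \<epsilon>W: "\<epsilon> * W \<le> \<delta> / 2" using \<delta> W by (simp add: \<epsilon>_def field_simps)
    obtain g where g: "g \<in> L2 (\<mu> \<Otimes>\<^sub>M \<mu>)"
      and g_close: "\<And>\<xi>. \<xi> \<in> L2 \<mu> \<Longrightarrow> L2_nrm \<mu> (\<lambda>x. D \<xi> x - integral_operator \<mu> g \<xi> x) \<le> \<epsilon> * L2_nrm \<mu> \<xi>"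
      using approx[OF \<epsilon>] by blast
    note IgL2 = bounded_operatorsD(1)[OF integral_operator_bounded(1)[OF g]]
    \<comment> \<open>the coefficients of a square integrable kernel close to \<open>D\<close> vanish at infinity\<close>
    have fin: "finite {\<gamma> \<in> dual_group. \<delta> / 2 \<le> norm (LINT z|(\<mu> \<Otimes>\<^sub>M \<mu>). G g z * cnj (\<gamma> (fst z - snd z)))}"
    proof (rule Bessel)
      show "(\<lambda>z. \<gamma> (fst z - snd z)) \<in> borel_measurable (\<mu> \<Otimes>\<^sub>M \<mu>)" if "\<gamma> \<in> dual_group" for \<gamma>
        by (rule bounded_borel_square_measurable(3)[OF dual_groupD(9)[OF that]])
    qed (use \<delta> in \<open>auto simp: G g dual_groupD(3) character_square_orthogonal square.finite_measure_axioms\<close>)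
    show "finite {\<gamma> \<in> dual_group. \<delta> \<le> norm (pm_transform (pm_of d) \<gamma>)}"
    proof (rule finite_subset[OF _ fin], clarify)
      fix \<gamma> :: "'a \<Rightarrow> complex" assume \<gamma>: "\<gamma> \<in> dual_group" and big: "\<delta> \<le> norm (pm_transform (pm_of d) \<gamma>)"
      note x = bounded_borel_L2[OF \<xi>'(1)[OF \<gamma>]] and e = bounded_borel_L2[OF \<eta>'(1)[OF \<gamma>]]
      have "d \<gamma> - (LINT y|\<mu>. integral_operator \<mu> g (\<xi>' \<gamma>) y * \<eta>' \<gamma> y)
          = (LINT y|\<mu>. (D (\<xi>' \<gamma>) y - integral_operator \<mu> g (\<xi>' \<gamma>) y) * \<eta>' \<gamma> y)"
        unfolding d_def left_diff_distrib
        by (rule Bochner_Integration.integral_diff[symmetric]; rule L2_integrable_mult[OF _ e]; rule D_L2[OF x] IgL2[OF x])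
      also have "norm \<dots> \<le> \<epsilon> * W" by (rule pair_le[OF \<gamma> L2_diff[OF D_L2[OF x] IgL2[OF x]] g_close[OF x]])
      finally have close: "norm (d \<gamma> - (LINT z|(\<mu> \<Otimes>\<^sub>M \<mu>). G g z * cnj (\<gamma> (fst z - snd z)))) \<le> \<delta> / 2"
        unfolding coefficient[OF g \<gamma>] using \<epsilon>W by (simp add: mult.commute)
      have "\<delta> \<le> norm (d \<gamma>)" using big by (simp only: pm_transform_pm_of[OF \<gamma>])
      then show "\<delta> / 2 \<le> norm (LINT z|(\<mu> \<Otimes>\<^sub>M \<mu>). G g z * cnj (\<gamma> (fst z - snd z)))"
        using close norm_triangle_sub[of "d \<gamma>" "LINT z|(\<mu> \<Otimes>\<^sub>M \<mu>). G g z * cnj (\<gamma> (fst z - snd z))"] by linarith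
    qed
  qed
  ultimately have "pm_of d = zero_pm" using not_M closed_E_set by (auto simp: M_set_def)
  moreover have "(\<lambda>s :: 'a. 1 :: complex) \<in> fourier_algebra"
    using fourier_algebra_character[OF dual_group_one] by simp
  ultimately have "pm_transform (pm_of d) (\<lambda>x. 1) = 0"
    by (simp add: pm_transform_def zero_pm_def)
  then have "d (\<lambda>x. 1) = 0" by (simp only: pm_transform_pm_of[OF dual_group_one])
  then show ?thesis by (simp add: d_def \<xi>'_def \<eta>'_def)
qed

text \<open>
  Subtracting the kernels that approximate two elements of the closed graph with the same first component
  gives the situation of \<open>limit_operator_zero\<close>; the conclusion extends from bounded functions by density.
\<close>
theorem closable_if_not_M_set:
  assumes \<phi>: "\<And>s t. \<phi> (s, t) = f (s - t)" and not_M: "\<not> M_set (E_set \<mu> f)"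
  shows "closable_multiplier \<mu> \<phi>"
  unfolding closable_multiplier_def
proof (clarify)
  fix S T S' T'
  assume ST: "(S, T) \<in> graph_closure \<mu> (multiplier_graph \<mu> \<phi>)"
    and ST': "(S', T') \<in> graph_closure \<mu> (multiplier_graph \<mu> \<phi>)" and eq: "op_eq \<mu> S S'"
  have bounded: "S \<in> bounded_operators \<mu>" "T \<in> bounded_operators \<mu>" "S' \<in> bounded_operators \<mu>" "T' \<in> bounded_operators \<mu>"
    using ST ST' by (auto simp: graph_closure_def compact_operators_def)
  have kernels: "\<exists>k\<in>L2 (\<mu> \<Otimes>\<^sub>M \<mu>). \<exists>g\<in>L2 (\<mu> \<Otimes>\<^sub>M \<mu>). (AE z in \<mu> \<Otimes>\<^sub>M \<mu>. g z = f (fst z - snd z) * k z) \<and>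
      (\<forall>\<xi>\<in>L2 \<mu>. L2_nrm \<mu> (\<lambda>x. S \<xi> x - integral_operator \<mu> k \<xi> x) \<le> \<epsilon> * L2_nrm \<mu> \<xi> \<and>
        L2_nrm \<mu> (\<lambda>x. T \<xi> x - integral_operator \<mu> g \<xi> x) \<le> \<epsilon> * L2_nrm \<mu> \<xi>)"
    if ST: "(S, T) \<in> graph_closure \<mu> (multiplier_graph \<mu> \<phi>)" and \<epsilon>: "\<epsilon> > 0" for S T \<epsilon>
  proof -
    have b: "S \<in> bounded_operators \<mu>" "T \<in> bounded_operators \<mu>"
      using ST by (auto simp: graph_closure_def compact_operators_def)
    obtain A B where "(A, B) \<in> multiplier_graph \<mu> \<phi>" and A: "op_dist \<mu> S A < \<epsilon>" and B: "op_dist \<mu> T B < \<epsilon>"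
      using ST \<epsilon> unfolding graph_closure_def by blast
    then obtain k g where Ak: "A = integral_operator \<mu> k" and Bg: "B = integral_operator \<mu> g"
      and k: "k \<in> L2 (\<mu> \<Otimes>\<^sub>M \<mu>)" and g: "g \<in> L2 (\<mu> \<Otimes>\<^sub>M \<mu>)" and gk: "AE z in \<mu> \<Otimes>\<^sub>M \<mu>. g z = \<phi> z * k z"
      unfolding multiplier_graph_def by blast
    have "\<phi> z = f (fst z - snd z)" for z using \<phi>[of "fst z" "snd z"] by simp
    then have gk': "AE z in \<mu> \<Otimes>\<^sub>M \<mu>. g z = f (fst z - snd z) * k z" using gk by simp
    have "L2_nrm \<mu> (\<lambda>x. S \<xi> x - integral_operator \<mu> k \<xi> x) \<le> \<epsilon> * L2_nrm \<mu> \<xi>"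
      "L2_nrm \<mu> (\<lambda>x. T \<xi> x - integral_operator \<mu> g \<xi> x) \<le> \<epsilon> * L2_nrm \<mu> \<xi>" if \<xi>: "\<xi> \<in> L2 \<mu>" for \<xi>
      using op_dist_ge[OF b(1) integral_operator_bounded(1)[OF k] \<xi>] op_dist_ge[OF b(2) integral_operator_bounded(1)[OF g] \<xi>]
        mult_right_mono[OF less_imp_le[OF A] L2_nrm_nonneg[of \<mu> \<xi>]] mult_right_mono[OF less_imp_le[OF B] L2_nrm_nonneg[of \<mu> \<xi>]]
      unfolding Ak Bg by linarith+
    then show ?thesis using k g gk' by blast
  qed
  define D where "D \<xi> = (\<lambda>x. T \<xi> x - T' \<xi> x)" for \<xi>
  have D: "D \<in> bounded_operators \<mu>" unfolding D_def[abs_def] by (rule bounded_operators_diff[OF bounded(2,4)])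
  have approx: "\<exists>k\<in>L2 (\<mu> \<Otimes>\<^sub>M \<mu>). \<exists>g\<in>L2 (\<mu> \<Otimes>\<^sub>M \<mu>).
      (AE z in \<mu> \<Otimes>\<^sub>M \<mu>. g z = f (fst z - snd z) * k z) \<and>
      (\<forall>\<xi>\<in>L2 \<mu>. L2_nrm \<mu> (integral_operator \<mu> k \<xi>) \<le> \<epsilon> * L2_nrm \<mu> \<xi> \<and>
        L2_nrm \<mu> (\<lambda>x. D \<xi> x - integral_operator \<mu> g \<xi> x) \<le> \<epsilon> * L2_nrm \<mu> \<xi>)" if \<epsilon>: "\<epsilon> > 0" for \<epsilon>
  proof -
    obtain k g where k: "k \<in> L2 (\<mu> \<Otimes>\<^sub>M \<mu>)" and g: "g \<in> L2 (\<mu> \<Otimes>\<^sub>M \<mu>)"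
      and gk: "AE z in \<mu> \<Otimes>\<^sub>M \<mu>. g z = f (fst z - snd z) * k z"
      and kS: "\<And>\<xi>. \<xi> \<in> L2 \<mu> \<Longrightarrow> L2_nrm \<mu> (\<lambda>x. S \<xi> x - integral_operator \<mu> k \<xi> x) \<le> \<epsilon> / 2 * L2_nrm \<mu> \<xi>"
      and gT: "\<And>\<xi>. \<xi> \<in> L2 \<mu> \<Longrightarrow> L2_nrm \<mu> (\<lambda>x. T \<xi> x - integral_operator \<mu> g \<xi> x) \<le> \<epsilon> / 2 * L2_nrm \<mu> \<xi>"
      using kernels[OF ST half_gt_zero[OF \<epsilon>]] by blast
    obtain k' g' where k': "k' \<in> L2 (\<mu> \<Otimes>\<^sub>M \<mu>)" and g': "g' \<in> L2 (\<mu> \<Otimes>\<^sub>M \<mu>)"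
      and gk': "AE z in \<mu> \<Otimes>\<^sub>M \<mu>. g' z = f (fst z - snd z) * k' z"
      and kS': "\<And>\<xi>. \<xi> \<in> L2 \<mu> \<Longrightarrow> L2_nrm \<mu> (\<lambda>x. S' \<xi> x - integral_operator \<mu> k' \<xi> x) \<le> \<epsilon> / 2 * L2_nrm \<mu> \<xi>"
      and gT': "\<And>\<xi>. \<xi> \<in> L2 \<mu> \<Longrightarrow> L2_nrm \<mu> (\<lambda>x. T' \<xi> x - integral_operator \<mu> g' \<xi> x) \<le> \<epsilon> / 2 * L2_nrm \<mu> \<xi>"
      using kernels[OF ST' half_gt_zero[OF \<epsilon>]] by blast
    have kk: "(\<lambda>z. k z - k' z) \<in> L2 (\<mu> \<Otimes>\<^sub>M \<mu>)" and gg: "(\<lambda>z. g z - g' z) \<in> L2 (\<mu> \<Otimes>\<^sub>M \<mu>)"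
      by (intro L2_diff k k' g g')+
    note op = bounded_operatorsD(1)[OF integral_operator_bounded(1)]
    show ?thesis
    proof (rule bexI[OF bexI[OF _ gg] kk], intro conjI ballI)
      show "AE z in \<mu> \<Otimes>\<^sub>M \<mu>. g z - g' z = f (fst z - snd z) * (k z - k' z)"
        using gk gk' by eventually_elim (simp add: right_diff_distrib)
      fix \<xi> assume \<xi>: "\<xi> \<in> L2 \<mu>"
      note b = bounded_operatorsD(1)[OF bounded(1) \<xi>] bounded_operatorsD(1)[OF bounded(2) \<xi>]
        bounded_operatorsD(1)[OF bounded(3) \<xi>] bounded_operatorsD(1)[OF bounded(4) \<xi>]
      have d1: "(\<lambda>x. S' \<xi> x - integral_operator \<mu> k' \<xi> x) \<in> L2 \<mu>" "(\<lambda>x. S \<xi> x - integral_operator \<mu> k \<xi> x) \<in> L2 \<mu>"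
        "(\<lambda>x. T' \<xi> x - integral_operator \<mu> g' \<xi> x) \<in> L2 \<mu>" "(\<lambda>x. T \<xi> x - integral_operator \<mu> g \<xi> x) \<in> L2 \<mu>"
        by (intro L2_diff b op k k' g g' \<xi>)+
      have "L2_nrm \<mu> (integral_operator \<mu> (\<lambda>z. k z - k' z) \<xi>)
          = L2_nrm \<mu> (\<lambda>x. (S' \<xi> x - integral_operator \<mu> k' \<xi> x) - (S \<xi> x - integral_operator \<mu> k \<xi> x))"
      proof (rule L2_nrm_cong(2)[OF L2_diff[OF d1(1,2)] L2_measurable[OF op[OF kk \<xi>]]])
        have "AE x in \<mu>. S \<xi> x = S' \<xi> x" using eq \<xi> by (simp add: op_eq_def)
        then show "AE x in \<mu>. (S' \<xi> x - integral_operator \<mu> k' \<xi> x) - (S \<xi> x - integral_operator \<mu> k \<xi> x)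
            = integral_operator \<mu> (\<lambda>z. k z - k' z) \<xi> x"
          using integral_operator_diff[OF k k' \<xi>] by eventually_elim simp
      qed
      also have "\<dots> \<le> L2_nrm \<mu> (\<lambda>x. S' \<xi> x - integral_operator \<mu> k' \<xi> x) + L2_nrm \<mu> (\<lambda>x. S \<xi> x - integral_operator \<mu> k \<xi> x)"
        using L2_triangle_diff[OF d1(1) L2_zero d1(2)] L2_nrm_diff_commute[of \<mu> "\<lambda>x. 0" "\<lambda>x. S \<xi> x - integral_operator \<mu> k \<xi> x"] by simp
      finally show "L2_nrm \<mu> (integral_operator \<mu> (\<lambda>z. k z - k' z) \<xi>) \<le> \<epsilon> * L2_nrm \<mu> \<xi>"
        using kS[OF \<xi>] kS'[OF \<xi>] by simp
      have "L2_nrm \<mu> (\<lambda>x. D \<xi> x - integral_operator \<mu> (\<lambda>z. g z - g' z) \<xi> x)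
          = L2_nrm \<mu> (\<lambda>x. (T \<xi> x - integral_operator \<mu> g \<xi> x) - (T' \<xi> x - integral_operator \<mu> g' \<xi> x))"
      proof (rule L2_nrm_cong(2)[OF L2_diff[OF d1(4,3)]])
        show "(\<lambda>x. D \<xi> x - integral_operator \<mu> (\<lambda>z. g z - g' z) \<xi> x) \<in> borel_measurable \<mu>"
          by (intro L2_measurable L2_diff bounded_operatorsD(1)[OF D \<xi>] op[OF gg \<xi>])
        show "AE x in \<mu>. (T \<xi> x - integral_operator \<mu> g \<xi> x) - (T' \<xi> x - integral_operator \<mu> g' \<xi> x)
            = D \<xi> x - integral_operator \<mu> (\<lambda>z. g z - g' z) \<xi> x"
          using integral_operator_diff[OF g g' \<xi>] by eventually_elim (simp add: D_def)
      qed
      also have "\<dots> \<le> L2_nrm \<mu> (\<lambda>x. T \<xi> x - integral_operator \<mu> g \<xi> x) + L2_nrm \<mu> (\<lambda>x. T' \<xi> x - integral_operator \<mu> g' \<xi> x)"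
        using L2_triangle_diff[OF d1(4) L2_zero d1(3)] L2_nrm_diff_commute[of \<mu> "\<lambda>x. 0" "\<lambda>x. T' \<xi> x - integral_operator \<mu> g' \<xi> x"] by simp
      finally show "L2_nrm \<mu> (\<lambda>x. D \<xi> x - integral_operator \<mu> (\<lambda>z. g z - g' z) \<xi> x) \<le> \<epsilon> * L2_nrm \<mu> \<xi>"
        using gT[OF \<xi>] gT'[OF \<xi>] by simp
    qed
  qed
  have zero: "AE x in \<mu>. D \<xi> x = 0" if \<xi>: "\<xi> \<in> bounded_borel" for \<xi>
  proof (rule L2_orthogonal_bounded_zero[OF bounded_operatorsD(1)[OF D bounded_borel_L2[OF \<xi>]]])
    fix \<eta> :: "'a \<Rightarrow> complex" and B :: real assume "\<eta> \<in> borel_measurable \<mu>" "\<And>x. norm (\<eta> x) \<le> B"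
    then have \<eta>: "\<eta> \<in> bounded_borel" by (intro bounded_borelI[of _ B]) simp_all
    show "(LINT x|\<mu>. D \<xi> x * \<eta> x) = 0"
      by (rule limit_operator_zero[where f = f, OF D _ not_M \<xi> \<eta>]) (rule approx)
  qed
  show "op_eq \<mu> T T'"
    unfolding op_eq_def
  proof
    fix \<xi> assume \<xi>: "\<xi> \<in> L2 \<mu>"
    obtain C where C: "C \<ge> 0" "\<And>\<xi>. \<xi> \<in> L2 \<mu> \<Longrightarrow> L2_nrm \<mu> (D \<xi>) \<le> C * L2_nrm \<mu> \<xi>"
      using bounded_operatorsD(4)[OF D] by auto
    have "L2_nrm \<mu> (D \<xi>) \<le> 0 + e" if e: "e > 0" for e
    proof -
      have pos: "e / (C + 1) > 0" using e C(1) by simp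
      obtain w B where w: "w \<in> borel_measurable \<mu>" "w \<in> L2 \<mu>" "\<And>x. norm (w x) \<le> B"
        and close: "L2_nrm \<mu> (\<lambda>x. \<xi> x - w x) < e / (C + 1)"
        using L2_bounded_dense[OF \<xi> pos] by blast
      have wB: "w \<in> bounded_borel" using w by (intro bounded_borelI[of _ B]) simp_all
      have diff: "(\<lambda>x. \<xi> x - w x) \<in> L2 \<mu>" by (rule L2_diff[OF \<xi> w(2)])
      have "AE x in \<mu>. D \<xi> x = D w x + D (\<lambda>x. \<xi> x - w x) x"
        using bounded_operatorsD(2)[OF D w(2) diff] by simp
      then have "AE x in \<mu>. D (\<lambda>x. \<xi> x - w x) x = D \<xi> x" using zero[OF wB] by eventually_elim simp
      then have "L2_nrm \<mu> (D \<xi>) = L2_nrm \<mu> (D (\<lambda>x. \<xi> x - w x))"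
        by (rule L2_nrm_cong(2)[OF bounded_operatorsD(1)[OF D diff] L2_measurable[OF bounded_operatorsD(1)[OF D \<xi>]]])
      also have "\<dots> \<le> C * L2_nrm \<mu> (\<lambda>x. \<xi> x - w x)" by (rule C(2)[OF diff])
      also have "\<dots> \<le> C * (e / (C + 1))" using close C(1) by (intro mult_left_mono) auto
      also have "\<dots> \<le> e" using e C(1) by (simp add: field_simps)
      finally show ?thesis by simp
    qed
    then have "L2_nrm \<mu> (D \<xi>) \<le> 0" by (rule field_le_epsilon)
    then have "L2_nrm \<mu> (D \<xi>) = 0" using L2_nrm_nonneg[of \<mu> "D \<xi>"] by simp
    then have "AE x in \<mu>. D \<xi> x = 0" using L2_nrm_eq_0[OF bounded_operatorsD(1)[OF D \<xi>]] by simp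
    then show "AE x in \<mu>. T \<xi> x = T' \<xi> x" by eventually_elim (simp add: D_def)
  qed
qed

end

section \<open>Approximation by kernels depending on the difference\<close>

lemma infsum_bool_prod:
  fixes g :: "bool \<times> 'i \<Rightarrow> complex"
  assumes g: "g summable_on UNIV" and zero: "\<And>b i. i \<notin> I \<Longrightarrow> g (b, i) = 0"
  shows "infsum g UNIV = (\<Sum>\<^sub>\<infinity>i\<in>I. g (True, i)) + (\<Sum>\<^sub>\<infinity>i\<in>I. g (False, i))"
proof -
  have s: "g summable_on X" for X using g by (rule summable_on_subset_banach) simp
  have "infsum g UNIV = infsum g (Pair True ` I \<union> Pair False ` I)"
  proof (rule infsum_cong_neutral)
    fix x :: "bool \<times> 'i" assume "x \<in> UNIV - (Pair True ` I \<union> Pair False ` I)"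
    then show "g x = 0" using zero[of "snd x" "fst x"] by (cases x; cases "fst x") auto
  qed auto
  also have "\<dots> = infsum g (Pair True ` I) + infsum g (Pair False ` I)"
    by (rule infsum_Un_disjoint[OF s s]) auto
  finally show ?thesis by (simp add: infsum_reindex inj_on_def o_def)
qed

text \<open>
  The space of bounded operators is complete.  Linearity of the limit holds only up to null sets, so it is
  derived from norm estimates.
\<close>
lemma operator_limit:
  fixes T :: "nat \<Rightarrow> ('b \<Rightarrow> complex) \<Rightarrow> ('b \<Rightarrow> complex)"
  assumes M: "finite_measure M" and T: "\<And>n. T n \<in> bounded_operators M"
    and rate: "\<And>n m \<xi>. n \<le> m \<Longrightarrow> \<xi> \<in> L2 M \<Longrightarrow> L2_nrm M (\<lambda>x. T m \<xi> x - T n \<xi> x) \<le> r n * L2_nrm M \<xi>"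
    and r: "r \<longlonglongrightarrow> 0"
  obtains S where "S \<in> bounded_operators M"
    "\<And>n \<xi>. \<xi> \<in> L2 M \<Longrightarrow> L2_nrm M (\<lambda>x. S \<xi> x - T n \<xi> x) \<le> r n * L2_nrm M \<xi>"
proof -
  note TL2 = bounded_operatorsD(1)[OF T]
  have small: "\<exists>N. \<forall>n\<ge>N. r n * c < e" if "e > 0" for e c :: real
  proof -
    have "(\<lambda>n. r n * c) \<longlonglongrightarrow> 0" using tendsto_mult_left_zero[OF r] .
    then have "eventually (\<lambda>n. r n * c < e) sequentially" using that by (rule order_tendstoD)
    then show ?thesis by (simp add: eventually_sequentially)
  qed
  have "\<exists>\<eta>. \<eta> \<in> L2 M \<and> (\<lambda>n. L2_nrm M (\<lambda>x. T n \<xi> x - \<eta> x)) \<longlonglongrightarrow> 0" if \<xi>: "\<xi> \<in> L2 M" for \<xi>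
  proof -
    have "\<exists>N. \<forall>m\<ge>N. \<forall>n\<ge>N. L2_nrm M (\<lambda>x. T m \<xi> x - T n \<xi> x) < e" if e: "e > 0" for e
    proof -
      obtain N where N: "\<And>n. n \<ge> N \<Longrightarrow> r n * L2_nrm M \<xi> < e" using small[OF e] by blast
      have "L2_nrm M (\<lambda>x. T m \<xi> x - T n \<xi> x) < e" if "m \<ge> N" "n \<ge> N" for m n
        using rate[of n m \<xi>] rate[of m n \<xi>] N[OF that(1)] N[OF that(2)] \<xi>
          L2_nrm_diff_commute[of M "T m \<xi>" "T n \<xi>"] by (cases "n \<le> m") auto
      then show ?thesis by blast
    qed
    from L2_complete[OF M TL2[OF \<xi>] this] show ?thesis by blast
  qed
  then obtain S where S: "\<And>\<xi>. \<xi> \<in> L2 M \<Longrightarrow> S \<xi> \<in> L2 M"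
    and lim: "\<And>\<xi>. \<xi> \<in> L2 M \<Longrightarrow> (\<lambda>n. L2_nrm M (\<lambda>x. T n \<xi> x - S \<xi> x)) \<longlonglongrightarrow> 0"
    by metis
  have close: "L2_nrm M (\<lambda>x. S \<xi> x - T n \<xi> x) \<le> r n * L2_nrm M \<xi>" if \<xi>: "\<xi> \<in> L2 M" for n \<xi>
  proof (rule field_le_epsilon)
    fix e :: real assume "e > 0"
    then have "eventually (\<lambda>m. L2_nrm M (\<lambda>x. T m \<xi> x - S \<xi> x) < e) sequentially"
      using lim[OF \<xi>] by (intro order_tendstoD)
    then obtain m where m: "m \<ge> n" "L2_nrm M (\<lambda>x. T m \<xi> x - S \<xi> x) < e"
      unfolding eventually_sequentially by (meson max.cobounded1 max.cobounded2)
    have "L2_nrm M (\<lambda>x. S \<xi> x - T n \<xi> x) \<le> L2_nrm M (\<lambda>x. S \<xi> x - T m \<xi> x) + L2_nrm M (\<lambda>x. T m \<xi> x - T n \<xi> x)"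
      by (rule L2_triangle_diff[OF S[OF \<xi>] TL2[OF \<xi>] TL2[OF \<xi>]])
    then show "L2_nrm M (\<lambda>x. S \<xi> x - T n \<xi> x) \<le> r n * L2_nrm M \<xi> + e"
      using rate[OF m(1) \<xi>] m(2) L2_nrm_diff_commute[of M "S \<xi>" "T m \<xi>"] by linarith
  qed
  have zero: "AE x in M. v x = 0" if v: "v \<in> L2 M" and le: "\<And>n. L2_nrm M v \<le> r n * c" for v c
  proof -
    have "L2_nrm M v \<le> 0 + e" if e: "e > 0" for e
      using small[OF e, of c] le by (metis add_0 less_imp_le order_refl order_trans)
    then have "L2_nrm M v \<le> 0" by (rule field_le_epsilon)
    then show ?thesis using L2_nrm_eq_0[OF v] L2_nrm_nonneg[of M v] by simp
  qed
  have "S \<in> bounded_operators M"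
    unfolding bounded_operators_def mem_Collect_eq
  proof (intro conjI ballI allI)
    fix \<xi> assume \<xi>: "\<xi> \<in> L2 M"
    show "S \<xi> \<in> L2 M" by (rule S[OF \<xi>])
    have d: "(\<lambda>x. S \<xi> x - T n \<xi> x) \<in> L2 M" if "\<xi> \<in> L2 M" for n \<xi> by (rule L2_diff[OF S[OF that] TL2[OF that]])
    show "AE x in M. S (\<lambda>z. c * \<xi> z) x = c * S \<xi> x" for c
    proof -
      have c\<xi>: "(\<lambda>z. c * \<xi> z) \<in> L2 M" by (rule L2_scale[OF \<xi>])
      have v: "(\<lambda>x. S (\<lambda>z. c * \<xi> z) x - c * S \<xi> x) \<in> L2 M" by (intro L2_diff L2_scale S c\<xi> \<xi>)
      have "AE x in M. S (\<lambda>z. c * \<xi> z) x - c * S \<xi> x = 0"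
      proof (rule zero[OF v])
        fix n
        have "L2_nrm M (\<lambda>x. S (\<lambda>z. c * \<xi> z) x - c * S \<xi> x)
            = L2_nrm M (\<lambda>x. (S (\<lambda>z. c * \<xi> z) x - T n (\<lambda>z. c * \<xi> z) x) - c * (S \<xi> x - T n \<xi> x))"
        proof (rule L2_nrm_cong(2)[OF L2_diff[OF d[OF c\<xi>] L2_scale[OF d[OF \<xi>]]] L2_measurable[OF v]])
          show "AE x in M. S (\<lambda>z. c * \<xi> z) x - T n (\<lambda>z. c * \<xi> z) x - c * (S \<xi> x - T n \<xi> x) = S (\<lambda>z. c * \<xi> z) x - c * S \<xi> x"
            using bounded_operatorsD(3)[OF T[of n] \<xi>, of c] by eventually_elim (simp add: right_diff_distrib)
        qed
        also have "\<dots> \<le> L2_nrm M (\<lambda>x. S (\<lambda>z. c * \<xi> z) x - T n (\<lambda>z. c * \<xi> z) x) + L2_nrm M (\<lambda>x. c * (S \<xi> x - T n \<xi> x))"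
          using L2_triangle_diff[OF d[OF c\<xi>, of n] L2_zero L2_scale[OF d[OF \<xi>, of n], of c]]
            L2_nrm_diff_commute[of M "\<lambda>x. 0" "\<lambda>x. c * (S \<xi> x - T n \<xi> x)"] by simp
        also have "\<dots> \<le> r n * (2 * (norm c * L2_nrm M \<xi>))"
          using close[OF c\<xi>, of n] mult_left_mono[OF close[OF \<xi>, of n] norm_ge_zero[of c]]
          unfolding L2_nrm_scale by (simp add: mult_ac)
        finally show "L2_nrm M (\<lambda>x. S (\<lambda>z. c * \<xi> z) x - c * S \<xi> x) \<le> r n * (2 * (norm c * L2_nrm M \<xi>))" .
      qed
      then show ?thesis by eventually_elim simp
    qed
    fix \<eta> assume \<eta>: "\<eta> \<in> L2 M"
    show "AE x in M. S (\<lambda>z. \<xi> z + \<eta> z) x = S \<xi> x + S \<eta> x"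
    proof -
      have s: "(\<lambda>z. \<xi> z + \<eta> z) \<in> L2 M" by (rule L2_add[OF \<xi> \<eta>])
      have v: "(\<lambda>x. S (\<lambda>z. \<xi> z + \<eta> z) x - (S \<xi> x + S \<eta> x)) \<in> L2 M" by (intro L2_diff L2_add S s \<xi> \<eta>)
      have "AE x in M. S (\<lambda>z. \<xi> z + \<eta> z) x - (S \<xi> x + S \<eta> x) = 0"
      proof (rule zero[OF v])
        fix n
        define p where "p x = S \<xi> x - T n \<xi> x + (S \<eta> x - T n \<eta> x)" for x
        have p: "p \<in> L2 M" unfolding p_def[abs_def] by (rule L2_add[OF d[OF \<xi>] d[OF \<eta>]])
        have "L2_nrm M (\<lambda>x. S (\<lambda>z. \<xi> z + \<eta> z) x - (S \<xi> x + S \<eta> x))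
            = L2_nrm M (\<lambda>x. (S (\<lambda>z. \<xi> z + \<eta> z) x - T n (\<lambda>z. \<xi> z + \<eta> z) x) - p x)"
        proof (rule L2_nrm_cong(2)[OF L2_diff[OF d[OF s] p] L2_measurable[OF v]])
          show "AE x in M. S (\<lambda>z. \<xi> z + \<eta> z) x - T n (\<lambda>z. \<xi> z + \<eta> z) x - p x = S (\<lambda>z. \<xi> z + \<eta> z) x - (S \<xi> x + S \<eta> x)"
            using bounded_operatorsD(2)[OF T[of n] \<xi> \<eta>] by eventually_elim (simp add: p_def)
        qed
        also have "\<dots> \<le> L2_nrm M (\<lambda>x. S (\<lambda>z. \<xi> z + \<eta> z) x - T n (\<lambda>z. \<xi> z + \<eta> z) x) + L2_nrm M p"
          using L2_triangle_diff[OF d[OF s, of n] L2_zero p] L2_nrm_diff_commute[of M "\<lambda>x. 0" p] by simp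
        also have "\<dots> \<le> r n * L2_nrm M (\<lambda>z. \<xi> z + \<eta> z) + (r n * L2_nrm M \<xi> + r n * L2_nrm M \<eta>)"
          using close[OF s, of n] close[OF \<xi>, of n] close[OF \<eta>, of n]
            L2_triangle[OF d[OF \<xi>, of n] d[OF \<eta>, of n]] unfolding p_def[abs_def] by linarith
        finally show "L2_nrm M (\<lambda>x. S (\<lambda>z. \<xi> z + \<eta> z) x - (S \<xi> x + S \<eta> x))
            \<le> r n * (L2_nrm M (\<lambda>z. \<xi> z + \<eta> z) + L2_nrm M \<xi> + L2_nrm M \<eta>)"
          by (simp add: distrib_left)
      qed
      then show ?thesis by eventually_elim simp
    qed
  next
    obtain C where C: "\<And>\<xi>. \<xi> \<in> L2 M \<Longrightarrow> L2_nrm M (T 0 \<xi>) \<le> C * L2_nrm M \<xi>"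
      using bounded_operatorsD(4)[OF T[of 0]] by auto
    have "L2_nrm M (S \<xi>) \<le> (r 0 + C) * L2_nrm M \<xi>" if \<xi>: "\<xi> \<in> L2 M" for \<xi>
    proof -
      have "L2_nrm M (S \<xi>) \<le> L2_nrm M (\<lambda>x. S \<xi> x - T 0 \<xi> x) + L2_nrm M (T 0 \<xi>)"
        using L2_triangle_diff[OF S[OF \<xi>] TL2[OF \<xi>, of 0] L2_zero] by simp
      then show ?thesis using close[OF \<xi>, of 0] C[OF \<xi>] by (simp add: distrib_right)
    qed
    then show "\<exists>C. \<forall>\<xi>\<in>L2 M. L2_nrm M (S \<xi>) \<le> C * L2_nrm M \<xi>" by blast
  qed
  then show ?thesis using close by (rule that)
qed

context compact_haar begin

lemma hat_vanishing:
  assumes g: "g \<in> bounded_borel" and \<epsilon>: "\<epsilon> > 0" shows "finite {\<gamma> \<in> dual_group. \<epsilon> \<le> norm (hat g \<gamma>)}"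
  unfolding hat_def
  by (rule Bessel[OF finite_measure_axioms bounded_borel_L2[OF g] _ _ _ \<epsilon>])
     (auto simp: dual_groupD(3) character_integral intro: bounded_borel_measurable dual_groupD(9))

lemma hat_add: "g \<in> bounded_borel \<Longrightarrow> h \<in> bounded_borel \<Longrightarrow> \<gamma> \<in> dual_group \<Longrightarrow> hat (\<lambda>x. g x + h x) \<gamma> = hat g \<gamma> + hat h \<gamma>"
  by (simp add: hat_def distrib_right bounded_borel_integrable bounded_borel_mult bounded_borel_cnj dual_groupD(9))

lemma hat_scale: "hat (\<lambda>x. c * g x) \<gamma> = c * hat g \<gamma>"
  by (simp add: hat_def mult.assoc)

lemma hat_diff: "g \<in> bounded_borel \<Longrightarrow> h \<in> bounded_borel \<Longrightarrow> \<gamma> \<in> dual_group \<Longrightarrow> hat (\<lambda>x. g x - h x) \<gamma> = hat g \<gamma> - hat h \<gamma>"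
  by (simp add: hat_def left_diff_distrib bounded_borel_integrable bounded_borel_mult bounded_borel_cnj dual_groupD(9))

lemma pairing_hat:
  assumes a: "a \<in> l1_dual" and g: "g \<in> bounded_borel"
  shows "(\<Sum>\<^sub>\<infinity>\<gamma>\<in>dual_group. a \<gamma> * hat g \<gamma>) = (LINT x|\<mu>. fourier_transform a x * g x)"
proof -
  have "((\<lambda>\<gamma>. a \<gamma> * (LINT x|\<mu>. cnj (\<gamma> x) * g x)) has_sum (LINT x|\<mu>. fourier_transform a x * g x)) dual_group"
  proof (rule has_sum_integral)
    show "(\<lambda>\<gamma>. norm (a \<gamma>)) summable_on dual_group" using a by (simp add: l1_dual_def)
    show "fourier_transform a \<in> borel_measurable \<mu>" using fourier_transform_bounded_borel[OF a] by (simp add: bounded_borel_measurable)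
    show "(\<lambda>x. cnj (\<gamma> x)) \<in> borel_measurable \<mu>" if "\<gamma> \<in> dual_group" for \<gamma>
      using bounded_borel_cnj[OF dual_groupD(9)[OF that]] by (simp add: bounded_borel_measurable)
  qed (auto simp: dual_groupD(3) fourier_transform_def bounded_borel_integrable g)
  then show ?thesis by (simp add: hat_def mult.commute infsumI)
qed

text \<open>
  The coefficients of the pairs \<open>(\<kappa>, f \<kappa>)\<close> form a space \<open>V\<close> of null sequences on two copies of the dual group, tagged by
  booleans, and the claim is that \<open>(0, pm_transform F)\<close> lies in its closure.  Otherwise a summable family
  \<open>(a1, a2)\<close> separates them.  Annihilating \<open>V\<close> means that the Fourier transforms \<open>u\<close> and \<open>v\<close> of \<open>a1\<close> and \<open>a2\<close> satisfy \<open>u + f v = 0\<close>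
  almost everywhere, so that \<open>v\<close> is in \<open>J_ideal\<close> and \<open>F v = 0\<close>; but \<open>F v\<close> is the value of the separating functional
  at \<open>(0, pm_transform F)\<close>.
\<close>
theorem kernel_approximation:
  assumes F: "F \<in> pseudofunctions" and J: "\<And>v. v \<in> J_ideal \<mu> f \<Longrightarrow> F v = 0"
    and f: "f \<in> borel_measurable borel" and \<epsilon>: "\<epsilon> > 0"
  obtains \<kappa> w where "\<kappa> \<in> bounded_borel" "w \<in> bounded_borel" "AE s in \<mu>. w s = f s * \<kappa> s"
    "\<And>\<gamma>. \<gamma> \<in> dual_group \<Longrightarrow> norm (hat \<kappa> \<gamma>) \<le> \<epsilon>"
    "\<And>\<gamma>. \<gamma> \<in> dual_group \<Longrightarrow> norm (pm_transform F \<gamma> - hat w \<gamma>) \<le> \<epsilon>"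
proof (rule ccontr)
  assume no: "\<not> thesis"
  note conclude = that
  define X where "X \<kappa> w = (\<lambda>(b, \<gamma>). if \<gamma> \<in> dual_group then (if b then hat \<kappa> \<gamma> else hat w \<gamma>) else 0)"
    for \<kappa> w :: "'a \<Rightarrow> complex"
  define V where "V = {X \<kappa> w | \<kappa> w. \<kappa> \<in> bounded_borel \<and> w \<in> bounded_borel \<and> (AE s in \<mu>. w s = f s * \<kappa> s)}"
  define c where "c = (\<lambda>(b, \<gamma>). if \<gamma> \<in> dual_group \<and> \<not> b then pm_transform F \<gamma> else 0)"
  have V0: "(\<lambda>i. 0) \<in> V"
  proof -
    have "(\<lambda>i. 0) = X (\<lambda>_. 0) (\<lambda>_. 0)" by (auto simp: X_def hat_def)
    then show ?thesis unfolding V_def using bounded_borel_const[of 0] by fastforce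
  qed
  have Vadd: "(\<lambda>i. x i + y i) \<in> V" if x: "x \<in> V" and y: "y \<in> V" for x y
  proof -
    obtain \<kappa> w where x: "x = X \<kappa> w" "\<kappa> \<in> bounded_borel" "w \<in> bounded_borel" "AE s in \<mu>. w s = f s * \<kappa> s" using x by (auto simp: V_def)
    obtain \<kappa>' w' where y: "y = X \<kappa>' w'" "\<kappa>' \<in> bounded_borel" "w' \<in> bounded_borel" "AE s in \<mu>. w' s = f s * \<kappa>' s" using y by (auto simp: V_def)
    have "(\<lambda>i. x i + y i) = X (\<lambda>s. \<kappa> s + \<kappa>' s) (\<lambda>s. w s + w' s)"
      using x(2,3) y(2,3) by (auto simp: x(1) y(1) X_def hat_add)
    moreover have "AE s in \<mu>. w s + w' s = f s * (\<kappa> s + \<kappa>' s)"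
      using x(4) y(4) by eventually_elim (simp add: distrib_left)
    ultimately show ?thesis unfolding V_def using bounded_borel_add[OF x(2) y(2)] bounded_borel_add[OF x(3) y(3)] by blast
  qed
  have Vscale: "(\<lambda>i. z * x i) \<in> V" if x: "x \<in> V" for x z
  proof -
    obtain \<kappa> w where x: "x = X \<kappa> w" "\<kappa> \<in> bounded_borel" "w \<in> bounded_borel" "AE s in \<mu>. w s = f s * \<kappa> s" using x by (auto simp: V_def)
    have "(\<lambda>i. z * x i) = X (\<lambda>s. z * \<kappa> s) (\<lambda>s. z * w s)" by (auto simp: x(1) X_def hat_scale)
    moreover have "AE s in \<mu>. z * w s = f s * (z * \<kappa> s)"
      using x(4) by eventually_elim simp
    ultimately show ?thesis unfolding V_def using bounded_borel_scale[OF x(2), of z] bounded_borel_scale[OF x(3), of z] by blast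
  qed
  have Vvan: "vanishing x" if "x \<in> V" for x
  proof -
    obtain \<kappa> w where x: "x = X \<kappa> w" "\<kappa> \<in> bounded_borel" "w \<in> bounded_borel" using \<open>x \<in> V\<close> by (auto simp: V_def)
    have "finite {i. \<delta> \<le> norm (x i)}" if \<delta>: "\<delta> > 0" for \<delta>
    proof (rule finite_subset)
      show "{i. \<delta> \<le> norm (x i)} \<subseteq> Pair True ` {\<gamma> \<in> dual_group. \<delta> \<le> norm (hat \<kappa> \<gamma>)} \<union> Pair False ` {\<gamma> \<in> dual_group. \<delta> \<le> norm (hat w \<gamma>)}"
        using \<delta> by (auto simp: x(1) X_def image_iff split: if_splits)
      show "finite (Pair True ` {\<gamma> \<in> dual_group. \<delta> \<le> norm (hat \<kappa> \<gamma>)} \<union> Pair False ` {\<gamma> \<in> dual_group. \<delta> \<le> norm (hat w \<gamma>)})"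
        by (intro finite_UnI finite_imageI hat_vanishing x \<delta>)
    qed
    then show ?thesis by (simp add: vanishing_def)
  qed
  have cvan: "vanishing c"
  proof -
    have "finite {i. \<delta> \<le> norm (c i)}" if \<delta>: "\<delta> > 0" for \<delta>
    proof (rule finite_subset)
      show "{i. \<delta> \<le> norm (c i)} \<subseteq> Pair False ` {\<gamma> \<in> dual_group. \<delta> \<le> norm (pm_transform F \<gamma>)}"
        using \<delta> by (auto simp: c_def image_iff split: if_splits)
      show "finite (Pair False ` {\<gamma> \<in> dual_group. \<delta> \<le> norm (pm_transform F \<gamma>)})"
        using F \<delta> by (intro finite_imageI) (simp add: pseudofunctions_def)
    qed
    then show ?thesis by (simp add: vanishing_def)
  qed
  have far: "\<exists>i. \<epsilon> \<le> norm (c i - x i)" if "x \<in> V" for x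
  proof (rule ccontr)
    assume near: "\<nexists>i. \<epsilon> \<le> norm (c i - x i)"
    obtain \<kappa> w where x: "x = X \<kappa> w" "\<kappa> \<in> bounded_borel" "w \<in> bounded_borel" "AE s in \<mu>. w s = f s * \<kappa> s" using \<open>x \<in> V\<close> by (auto simp: V_def)
    have le: "norm (c i - x i) \<le> \<epsilon>" for i using near by (meson le_cases)
    have "norm (hat \<kappa> \<gamma>) \<le> \<epsilon>" "norm (pm_transform F \<gamma> - hat w \<gamma>) \<le> \<epsilon>" if \<gamma>: "\<gamma> \<in> dual_group" for \<gamma>
      using le[of "(True, \<gamma>)"] le[of "(False, \<gamma>)"] \<gamma> by (simp_all add: x(1) X_def c_def)
    then show False using no conclude[OF x(2,3,4)] by blast
  qed
  obtain a where a: "(\<lambda>i. norm (a i)) summable_on UNIV"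
    and a_V: "\<And>x. x \<in> V \<Longrightarrow> (\<Sum>\<^sub>\<infinity>i. a i * x i) = 0" and a_c: "(\<Sum>\<^sub>\<infinity>i. a i * c i) \<noteq> 0"
    using c0_separation[OF V0 Vadd Vscale Vvan cvan \<epsilon> far] by blast
  define a1 where "a1 \<gamma> = a (True, \<gamma>)" for \<gamma>
  define a2 where "a2 \<gamma> = a (False, \<gamma>)" for \<gamma>
  have "(\<lambda>\<gamma>. norm (a (b, \<gamma>))) summable_on dual_group" for b
  proof -
    have "(\<lambda>i. norm (a i)) summable_on (Pair b ` dual_group)"
      using a by (rule summable_on_subset_banach) simp
    then show ?thesis by (subst (asm) summable_on_reindex) (auto simp: inj_on_def o_def)
  qed
  then have a1: "a1 \<in> l1_dual" and a2: "a2 \<in> l1_dual" by (auto simp: l1_dual_def a1_def[abs_def] a2_def[abs_def])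
  have split: "(\<Sum>\<^sub>\<infinity>i. a i * x i) = (\<Sum>\<^sub>\<infinity>\<gamma>\<in>dual_group. a1 \<gamma> * x (True, \<gamma>)) + (\<Sum>\<^sub>\<infinity>\<gamma>\<in>dual_group. a2 \<gamma> * x (False, \<gamma>))"
    if x: "\<And>b \<gamma>. \<gamma> \<notin> dual_group \<Longrightarrow> x (b, \<gamma>) = 0" and bounded: "vanishing x" for x
  proof -
    obtain C where C: "\<And>i. norm (x i) \<le> C"
      using vanishing_bounded[OF bounded] by (auto simp: bounded_iff)
    have "(\<lambda>i. norm (a i * x i)) summable_on UNIV"
    proof (rule Infinite_Sum.abs_summable_on_comparison_test'[OF summable_on_cmult_left[OF a, of C]])
      show "norm (a i * x i) \<le> norm (a i) * C" for i
        unfolding norm_mult by (rule mult_left_mono[OF C norm_ge_zero])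
    qed
    then have "(\<lambda>i. a i * x i) summable_on UNIV" by (rule abs_summable_summable)
    from infsum_bool_prod[OF this, of dual_group] show ?thesis by (simp add: x a1_def a2_def)
  qed
  define u where "u = fourier_transform a1"
  define v where "v = fourier_transform a2"
  have u: "u \<in> fourier_algebra" and v: "v \<in> fourier_algebra" using a1 a2 by (auto simp: u_def v_def fourier_algebra_def)
  have orth: "(LINT s|\<mu>. u s * \<kappa> s) + (LINT s|\<mu>. v s * w s) = 0"
    if \<kappa>: "\<kappa> \<in> bounded_borel" and w: "w \<in> bounded_borel" and ae: "AE s in \<mu>. w s = f s * \<kappa> s" for \<kappa> w
  proof -
    have XV: "X \<kappa> w \<in> V" using \<kappa> w ae by (auto simp: V_def)
    have "0 = (\<Sum>\<^sub>\<infinity>i. a i * X \<kappa> w i)" using a_V[OF XV] by simp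
    also have "\<dots> = (\<Sum>\<^sub>\<infinity>\<gamma>\<in>dual_group. a1 \<gamma> * X \<kappa> w (True, \<gamma>)) + (\<Sum>\<^sub>\<infinity>\<gamma>\<in>dual_group. a2 \<gamma> * X \<kappa> w (False, \<gamma>))"
      by (rule split) (auto simp: X_def intro: Vvan[OF XV, unfolded X_def])
    also have "\<dots> = (\<Sum>\<^sub>\<infinity>\<gamma>\<in>dual_group. a1 \<gamma> * hat \<kappa> \<gamma>) + (\<Sum>\<^sub>\<infinity>\<gamma>\<in>dual_group. a2 \<gamma> * hat w \<gamma>)"
      by (intro arg_cong2[where f = "(+)"] infsum_cong) (auto simp: X_def)
    finally show ?thesis by (simp add: pairing_hat a1 a2 \<kappa> w u_def v_def)
  qed
  note [measurable] = f bounded_borel_measurable[OF fourier_algebra_bounded_borel[OF u]] bounded_borel_measurable[OF fourier_algebra_bounded_borel[OF v]]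
  have "AE s in \<mu>. norm (f s) \<le> real n \<longrightarrow> u s + f s * v s = 0" for n
  proof -
    \<comment> \<open>the conjugate of \<open>u + f v\<close>, truncated so that both \<open>\<kappa>\<close> and \<open>f \<kappa>\<close> are bounded\<close>
    define \<kappa> where "\<kappa> s = (if norm (f s) \<le> real n then cnj (u s + f s * v s) else 0)" for s
    have \<kappa>m: "\<kappa> \<in> borel_measurable borel" unfolding \<kappa>_def[abs_def] by measurable
    obtain C D where C: "\<And>s. norm (u s) \<le> C" and D: "D \<ge> 0" "\<And>s. norm (v s) \<le> D"
      using fourier_algebra_bounded_borel[OF u] fourier_algebra_bounded_borel[OF v] by (metis bounded_borelE)
    have "norm (\<kappa> s) \<le> C + real n * D" for s
    proof (cases "norm (f s) \<le> real n")
      case True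
      then have "norm (f s) * norm (v s) \<le> real n * D" using D by (intro mult_mono) auto
      moreover have "norm (\<kappa> s) \<le> norm (u s) + norm (f s) * norm (v s)"
        using True norm_triangle_ineq[of "u s" "f s * v s"] by (simp add: \<kappa>_def norm_mult flip: complex_cnj_add complex_cnj_mult)
      ultimately show ?thesis using C[of s] by linarith
    next
      case False
      have "0 \<le> C" using C[of s] norm_ge_zero order_trans by blast
      then show ?thesis using False D by (simp add: \<kappa>_def)
    qed
    then have \<kappa>: "\<kappa> \<in> bounded_borel" using \<kappa>m by (intro bounded_borelI)
    have w: "(\<lambda>s. f s * \<kappa> s) \<in> bounded_borel"
    proof -
      have "(\<lambda>s. if norm (f s) \<le> real n then f s else 0) \<in> bounded_borel" by (rule bounded_borelI[where C = "real n"]) auto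
      from bounded_borel_mult[OF this \<kappa>] show ?thesis by (simp add: \<kappa>_def if_distrib cong: if_cong)
    qed
    have "0 = (LINT s|\<mu>. u s * \<kappa> s) + (LINT s|\<mu>. v s * (f s * \<kappa> s))" using orth[OF \<kappa> w] by simp
    also have "\<dots> = (LINT s|\<mu>. u s * \<kappa> s + v s * (f s * \<kappa> s))"
      by (intro Bochner_Integration.integral_add[symmetric] bounded_borel_integrable bounded_borel_mult \<kappa> w fourier_algebra_bounded_borel u v)
    also have "\<dots> = (LINT s|\<mu>. of_real ((norm (\<kappa> s))\<^sup>2))"
    proof (rule Bochner_Integration.integral_cong[OF refl])
      fix s
      have "u s * \<kappa> s + v s * (f s * \<kappa> s) = (u s + f s * v s) * \<kappa> s" by (simp add: algebra_simps)
      also have "\<dots> = \<kappa> s * cnj (\<kappa> s)" by (simp add: \<kappa>_def)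
      finally show "u s * \<kappa> s + v s * (f s * \<kappa> s) = of_real ((norm (\<kappa> s))\<^sup>2)" by (simp only: complex_norm_square)
    qed
    also have "\<dots> = of_real ((L2_nrm \<mu> \<kappa>)\<^sup>2)" unfolding L2_nrm_square by (rule integral_complex_of_real)
    finally have "L2_nrm \<mu> \<kappa> = 0" by simp
    then have "AE s in \<mu>. \<kappa> s = 0" using L2_nrm_eq_0[OF bounded_borel_L2[OF \<kappa>]] by simp
    then show ?thesis
    proof eventually_elim
      case (elim s)
      then show ?case by (metis \<kappa>_def complex_cnj_zero_iff)
    qed
  qed
  then have "AE s in \<mu>. \<forall>n. norm (f s) \<le> real n \<longrightarrow> u s + f s * v s = 0"
    unfolding AE_all_countable by blast
  then have "AE s in \<mu>. f s * v s = (-1) * u s"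
  proof eventually_elim
    case (elim s)
    obtain n where "norm (f s) \<le> real n" using real_arch_simple by blast
    then have "u s + f s * v s = 0" using elim by blast
    then show ?case by (simp add: eq_neg_iff_add_eq_0 add.commute)
  qed
  then have "v \<in> J_ideal \<mu> f"
    unfolding J_ideal_def using v fourier_algebra_scale[OF u, of "-1"]
    by (intro CollectI conjI bexI[of _ "\<lambda>s. (-1) * u s"])
  then have "F v = 0" by (rule J)
  moreover have "F v = (\<Sum>\<^sub>\<infinity>i. a i * c i)"
  proof -
    have Fp: "F \<in> pseudomeasures" using F by (simp add: pseudofunctions_def)
    have "(\<Sum>\<^sub>\<infinity>i. a i * c i) = (\<Sum>\<^sub>\<infinity>\<gamma>\<in>dual_group. a1 \<gamma> * c (True, \<gamma>)) + (\<Sum>\<^sub>\<infinity>\<gamma>\<in>dual_group. a2 \<gamma> * c (False, \<gamma>))"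
      by (rule split[OF _ cvan]) (simp add: c_def)
    also have "\<dots> = (\<Sum>\<^sub>\<infinity>\<gamma>\<in>dual_group. a2 \<gamma> * pm_transform F \<gamma>)"
    proof -
      have "(\<Sum>\<^sub>\<infinity>\<gamma>\<in>dual_group. a1 \<gamma> * c (True, \<gamma>)) = 0" by (simp add: c_def)
      moreover have "(\<Sum>\<^sub>\<infinity>\<gamma>\<in>dual_group. a2 \<gamma> * c (False, \<gamma>)) = (\<Sum>\<^sub>\<infinity>\<gamma>\<in>dual_group. a2 \<gamma> * pm_transform F \<gamma>)"
        by (rule infsum_cong) (simp add: c_def)
      ultimately show ?thesis by simp
    qed
    also have "\<dots> = F v" unfolding v_def by (rule infsumI[OF pseudomeasure_expansion[OF Fp a2]])
    finally show ?thesis ..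
  qed
  ultimately show False using a_c by simp
qed

text \<open>
  Elements of \<open>J_ideal\<close> vanish on \<open>E_set\<close>, so measures concentrated there annihilate them, and evaluation at a
  fixed element of the Fourier algebra is continuous in the weak topology.
\<close>
lemma N_set_annihilates_J_ideal:
  assumes F: "F \<in> N_set (E_set \<mu> f)" and v: "v \<in> J_ideal \<mu> f" shows "F v = 0"
proof -
  have vA: "v \<in> fourier_algebra" using v by (simp add: J_ideal_def)
  let ?X = "pm_weak_topology :: (('a \<Rightarrow> complex) \<Rightarrow> complex) topology"
  define Z where "Z = {G \<in> topspace ?X. G v \<in> {0}}"
  have "continuous_map ?X euclidean (\<lambda>G. G v)"
    unfolding pm_weak_topology_def
    by (rule continuous_map_from_subtopology, rule continuous_map_product_projection[OF vA])
  then have "closedin ?X Z"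
    unfolding Z_def by (rule closedin_continuous_map_preimage) simp
  moreover have "G v = 0" if G: "G \<in> radon_pm (E_set \<mu> f)" for G
  proof -
    have null: "(LINT s|m. v s) = 0" if m: "m \<in> positive_measures_on (E_set \<mu> f)" for m
    proof (rule integral_eq_zero_AE)
      have "AE s in m. s \<notin> - E_set \<mu> f"
        using m closed_E_set[of f] by (intro AE_not_in) (auto simp: positive_measures_on_def null_sets_def)
      then show "AE s in m. v s = 0" by eventually_elim (use v in \<open>auto simp: E_set_def\<close>)
    qed
    show ?thesis using G vA by (auto simp: radon_pm_def null)
  qed
  then have "topspace ?X \<inter> radon_pm (E_set \<mu> f) \<subseteq> Z" by (auto simp: Z_def)
  ultimately have "?X closure_of (topspace ?X \<inter> radon_pm (E_set \<mu> f)) \<subseteq> Z" by (intro closure_of_minimal)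
  then show ?thesis using F unfolding N_set_def closure_of_restrict[of ?X "radon_pm (E_set \<mu> f)"] by (auto simp: Z_def)
qed

definition diff_kernel :: "('a \<Rightarrow> complex) \<Rightarrow> 'a \<times> 'a \<Rightarrow> complex"
  where "diff_kernel \<kappa> z = \<kappa> (fst z - snd z)"

lemma diff_kernel_L2: assumes "\<kappa> \<in> bounded_borel" shows "diff_kernel \<kappa> \<in> L2 (\<mu> \<Otimes>\<^sub>M \<mu>)"
proof -
  obtain C where "\<And>x. norm (\<kappa> x) \<le> C" using assms by (metis bounded_borelE)
  then show ?thesis using bounded_borel_square_measurable(3)[OF assms]
    by (intro L2_bounded(1)[OF square.finite_measure_axioms, of _ C]) (auto simp: diff_kernel_def[abs_def])
qed

text \<open>
  On bounded functions the operator is convolution by the reflection of \<open>\<kappa>\<close>, whose coefficients are those of \<open>\<kappa>\<close>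
  at the conjugate characters; the estimate extends by density.
\<close>
lemma diff_kernel_operator_le:
  assumes \<kappa>: "\<kappa> \<in> bounded_borel" and B: "B \<ge> 0" and le: "\<And>\<gamma>. \<gamma> \<in> dual_group \<Longrightarrow> norm (hat \<kappa> \<gamma>) \<le> B"
    and \<xi>: "\<xi> \<in> L2 \<mu>"
  shows "L2_nrm \<mu> (integral_operator \<mu> (diff_kernel \<kappa>) \<xi>) \<le> B * L2_nrm \<mu> \<xi>"
proof -
  define T where "T = integral_operator \<mu> (diff_kernel \<kappa>)"
  have T: "T \<in> bounded_operators \<mu>" unfolding T_def by (rule integral_operator_bounded(1)[OF diff_kernel_L2[OF \<kappa>]])
  define \<kappa>' where "\<kappa>' x = \<kappa> (- x)" for x
  have \<kappa>': "\<kappa>' \<in> bounded_borel" unfolding \<kappa>'_def[abs_def] by (rule bounded_borel_uminus[OF \<kappa>])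
  have hat': "norm (hat \<kappa>' \<gamma>) \<le> B" if \<gamma>: "\<gamma> \<in> dual_group" for \<gamma>
  proof -
    have m: "(\<lambda>y. \<kappa> y * \<gamma> y) \<in> borel_measurable borel"
      by (rule bounded_borel_measurable[OF bounded_borel_mult[OF \<kappa> dual_groupD(9)[OF \<gamma>]]])
    have "hat \<kappa>' \<gamma> = hat \<kappa> (\<lambda>x. cnj (\<gamma> x))"
      using integral_reflect[OF m, of 0] by (simp add: hat_def \<kappa>'_def dual_groupD(5)[OF \<gamma>])
    then show ?thesis using le[OF dual_group_cnj[OF \<gamma>]] by simp
  qed
  have bounded: "L2_nrm \<mu> (T w) \<le> B * L2_nrm \<mu> w" if w: "w \<in> bounded_borel" for w
  proof -
    have "T w = conv \<kappa>' w" by (simp add: T_def integral_operator_def diff_kernel_def conv_def \<kappa>'_def fun_eq_iff)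
    then show ?thesis using convolution_norm_le[OF \<kappa>' B hat' w] by simp
  qed
  obtain C where C: "C \<ge> 0" "\<And>\<xi>. \<xi> \<in> L2 \<mu> \<Longrightarrow> L2_nrm \<mu> (T \<xi>) \<le> C * L2_nrm \<mu> \<xi>"
    using bounded_operatorsD(4)[OF T] by auto
  have "L2_nrm \<mu> (T \<xi>) \<le> B * L2_nrm \<mu> \<xi> + e" if e: "e > 0" for e
  proof -
    have pos: "e / (C + 1) > 0" using e C(1) by simp
    obtain w D where w: "w \<in> borel_measurable \<mu>" "w \<in> L2 \<mu>" "\<And>x. norm (w x) \<le> D"
      and close: "L2_nrm \<mu> (\<lambda>x. \<xi> x - w x) < e / (C + 1)" and nw: "L2_nrm \<mu> w \<le> L2_nrm \<mu> \<xi>"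
      using L2_bounded_dense[OF \<xi> pos] by blast
    have wB: "w \<in> bounded_borel" using w by (intro bounded_borelI[of _ D]) simp_all
    have diff: "(\<lambda>x. \<xi> x - w x) \<in> L2 \<mu>" by (rule L2_diff[OF \<xi> w(2)])
    have s: "(\<lambda>x. T w x + T (\<lambda>x. \<xi> x - w x) x) \<in> L2 \<mu>"
      by (intro L2_add bounded_operatorsD(1)[OF T] w diff)
    have "AE x in \<mu>. T w x + T (\<lambda>x. \<xi> x - w x) x = T \<xi> x"
      using bounded_operatorsD(2)[OF T w(2) diff] by (simp add: eq_commute)
    then have "L2_nrm \<mu> (T \<xi>) = L2_nrm \<mu> (\<lambda>x. T w x + T (\<lambda>x. \<xi> x - w x) x)"
      by (rule L2_nrm_cong(2)[OF s L2_measurable[OF bounded_operatorsD(1)[OF T \<xi>]]])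
    also have "\<dots> \<le> L2_nrm \<mu> (T w) + L2_nrm \<mu> (T (\<lambda>x. \<xi> x - w x))"
      by (rule L2_triangle[OF bounded_operatorsD(1)[OF T w(2)] bounded_operatorsD(1)[OF T diff]])
    also have "\<dots> \<le> B * L2_nrm \<mu> \<xi> + C * (e / (C + 1))"
      using bounded[OF wB] mult_left_mono[OF nw B] C(2)[OF diff] mult_left_mono[OF less_imp_le[OF close] C(1)] by linarith
    also have "C * (e / (C + 1)) \<le> e" using e C(1) by (simp add: field_simps)
    finally show ?thesis by simp
  qed
  then show ?thesis unfolding T_def by (rule field_le_epsilon)
qed

lemma diff_kernel_operator_diff_le:
  assumes \<kappa>: "\<kappa> \<in> bounded_borel" "\<kappa>' \<in> bounded_borel" and B: "B \<ge> 0"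
    and le: "\<And>\<gamma>. \<gamma> \<in> dual_group \<Longrightarrow> norm (hat \<kappa> \<gamma> - hat \<kappa>' \<gamma>) \<le> B" and \<xi>: "\<xi> \<in> L2 \<mu>"
  shows "L2_nrm \<mu> (\<lambda>x. integral_operator \<mu> (diff_kernel \<kappa>) \<xi> x - integral_operator \<mu> (diff_kernel \<kappa>') \<xi> x) \<le> B * L2_nrm \<mu> \<xi>"
proof -
  note op = bounded_operatorsD(1)[OF integral_operator_bounded(1)[OF diff_kernel_L2] \<xi>]
  have d: "(\<lambda>x. \<kappa> x - \<kappa>' x) \<in> bounded_borel" by (rule bounded_borel_diff[OF \<kappa>])
  have eq: "diff_kernel (\<lambda>x. \<kappa> x - \<kappa>' x) = (\<lambda>z. diff_kernel \<kappa> z - diff_kernel \<kappa>' z)"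
    by (simp add: diff_kernel_def fun_eq_iff)
  have "L2_nrm \<mu> (\<lambda>x. integral_operator \<mu> (diff_kernel \<kappa>) \<xi> x - integral_operator \<mu> (diff_kernel \<kappa>') \<xi> x)
      = L2_nrm \<mu> (integral_operator \<mu> (diff_kernel (\<lambda>x. \<kappa> x - \<kappa>' x)) \<xi>)"
    unfolding eq
    by (rule L2_nrm_cong(2)[OF op[OF d, unfolded eq] L2_measurable[OF L2_diff[OF op[OF \<kappa>(1)] op[OF \<kappa>(2)]]]
          integral_operator_diff[OF diff_kernel_L2[OF \<kappa>(1)] diff_kernel_L2[OF \<kappa>(2)] \<xi>]])
  also have "\<dots> \<le> B * L2_nrm \<mu> \<xi>"
    by (rule diff_kernel_operator_le[OF d B _ \<xi>]) (simp add: hat_diff \<kappa> le)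
  finally show ?thesis .
qed

lemma diff_kernel_operator_character:
  assumes \<kappa>: "\<kappa> \<in> bounded_borel" and \<gamma>: "\<gamma> \<in> dual_group"
  shows "integral_operator \<mu> (diff_kernel \<kappa>) (\<lambda>x. cnj (\<gamma> x)) y = hat \<kappa> \<gamma> * cnj (\<gamma> y)"
proof -
  have m: "(\<lambda>x. \<kappa> x * cnj (\<gamma> (x + y))) \<in> borel_measurable borel"
    by (intro bounded_borel_measurable bounded_borel_mult \<kappa> bounded_borel_cnj bounded_borel_translate dual_groupD(9)[OF \<gamma>])
  have "integral_operator \<mu> (diff_kernel \<kappa>) (\<lambda>x. cnj (\<gamma> x)) y = (LINT x|\<mu>. \<kappa> (x - y) * cnj (\<gamma> ((x - y) + y)))"
    by (simp add: integral_operator_def diff_kernel_def)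
  also have "\<dots> = (LINT x|\<mu>. \<kappa> x * cnj (\<gamma> (x + y)))" by (rule integral_translate(3)[OF m])
  also have "\<dots> = (LINT x|\<mu>. (\<kappa> x * cnj (\<gamma> x)) * cnj (\<gamma> y))"
    by (simp add: dual_groupD(2)[OF \<gamma>] mult.assoc)
  finally show ?thesis by (simp add: hat_def)
qed

text \<open>
  A trigonometric polynomial with prescribed coefficients; its operator has finite rank, which is made
  explicit by the last formula.
\<close>
lemma character_polynomial:
  fixes c :: "('a \<Rightarrow> complex) \<Rightarrow> complex"
  assumes G: "finite G" "G \<subseteq> dual_group"
  defines "q \<equiv> (\<lambda>x. (\<Sum>\<gamma>\<in>G. (c \<gamma> / of_real total) * \<gamma> x))"
  shows "q \<in> bounded_borel" "\<And>\<delta>. \<delta> \<in> dual_group \<Longrightarrow> hat q \<delta> = (if \<delta> \<in> G then c \<delta> else 0)"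
    "\<And>\<xi> y. \<xi> \<in> L2 \<mu> \<Longrightarrow> integral_operator \<mu> (diff_kernel q) \<xi> y
      = (\<Sum>\<gamma>\<in>G. (c \<gamma> / of_real total * (LINT x|\<mu>. \<gamma> x * \<xi> x)) * cnj (\<gamma> y))"
proof -
  show q: "q \<in> bounded_borel" unfolding q_def using G by (intro bounded_borel_sum bounded_borel_scale dual_groupD(9)) auto
  have int: "integrable \<mu> (\<lambda>x. \<gamma> x * cnj (\<delta> x))" if "\<gamma> \<in> G" "\<delta> \<in> dual_group" for \<gamma> \<delta>
    using that G by (intro bounded_borel_integrable bounded_borel_mult bounded_borel_cnj dual_groupD(9)) auto
  show "hat q \<delta> = (if \<delta> \<in> G then c \<delta> else 0)" if \<delta>: "\<delta> \<in> dual_group" for \<delta>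
  proof -
    have "hat q \<delta> = (LINT x|\<mu>. (\<Sum>\<gamma>\<in>G. (c \<gamma> / of_real total) * (\<gamma> x * cnj (\<delta> x))))"
      by (simp add: hat_def q_def sum_distrib_right mult.assoc)
    also have "\<dots> = (\<Sum>\<gamma>\<in>G. (c \<gamma> / of_real total) * (LINT x|\<mu>. \<gamma> x * cnj (\<delta> x)))"
      by (subst Bochner_Integration.integral_sum) (auto intro!: integrable_mult_right int \<delta>)
    also have "\<dots> = (\<Sum>\<gamma>\<in>G. if \<gamma> = \<delta> then c \<delta> else 0)"
      using G total_pos by (intro sum.cong refl) (auto simp: character_integral \<delta> subset_iff)
    finally show ?thesis using G by simp
  qed
  show "integral_operator \<mu> (diff_kernel q) \<xi> y
      = (\<Sum>\<gamma>\<in>G. (c \<gamma> / of_real total * (LINT x|\<mu>. \<gamma> x * \<xi> x)) * cnj (\<gamma> y))" if \<xi>: "\<xi> \<in> L2 \<mu>" for \<xi> y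
  proof -
    have i: "integrable \<mu> (\<lambda>x. \<gamma> x * \<xi> x)" if "\<gamma> \<in> G" for \<gamma>
      using that G by (intro L2_integrable_mult \<xi> bounded_borel_L2 dual_groupD(9)) auto
    have "integral_operator \<mu> (diff_kernel q) \<xi> y = (LINT x|\<mu>. (\<Sum>\<gamma>\<in>G. (c \<gamma> / of_real total * cnj (\<gamma> y)) * (\<gamma> x * \<xi> x)))"
      unfolding integral_operator_def diff_kernel_def q_def
    proof (rule Bochner_Integration.integral_cong[OF refl])
      fix x
      have "\<gamma> (x - y) = \<gamma> x * cnj (\<gamma> y)" if "\<gamma> \<in> G" for \<gamma> using that G by (intro dual_groupD(6)) auto
      then show "(\<Sum>\<gamma>\<in>G. c \<gamma> / of_real total * \<gamma> (fst (x, y) - snd (x, y))) * \<xi> x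
          = (\<Sum>\<gamma>\<in>G. (c \<gamma> / of_real total * cnj (\<gamma> y)) * (\<gamma> x * \<xi> x))"
        unfolding sum_distrib_right by (intro sum.cong refl) (simp add: mult_ac)
    qed
    also have "\<dots> = (\<Sum>\<gamma>\<in>G. (c \<gamma> / of_real total * cnj (\<gamma> y)) * (LINT x|\<mu>. \<gamma> x * \<xi> x))"
      by (subst Bochner_Integration.integral_sum) (auto intro!: integrable_mult_right i)
    finally show ?thesis by (simp add: mult_ac)
  qed
qed

end

section \<open>Multipliers that are not closable\<close>

context compact_haar begin

text \<open>
  Truncating \<open>c\<close> to the finitely many characters with \<open>|c \<gamma>| \<ge> 1 / (n + 1)\<close> gives finite rank operators that are Cauchy in
  norm.  Compactness of the limit \<open>T\<close>: the finite rank operators depend on their argument through the countably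
  many numbers \<open>b j \<gamma>\<close>, and a diagonal subsequence makes all of them converge.  The second property identifies
  \<open>T\<close> as the operator with symbol \<open>c\<close>: its distance to the operator of \<open>\<kappa>\<close> is at most the sup norm of \<open>c - hat \<kappa>\<close>.
\<close>
theorem character_multiplier_compact:
  fixes c :: "('a \<Rightarrow> complex) \<Rightarrow> complex"
  assumes c: "\<And>\<epsilon>. \<epsilon> > 0 \<Longrightarrow> finite {\<gamma> \<in> dual_group. \<epsilon> \<le> norm (c \<gamma>)}"
  obtains T where "T \<in> compact_operators \<mu>"
    "\<And>\<kappa> B \<xi>. \<kappa> \<in> bounded_borel \<Longrightarrow> (\<And>\<gamma>. \<gamma> \<in> dual_group \<Longrightarrow> norm (c \<gamma> - hat \<kappa> \<gamma>) \<le> B) \<Longrightarrow> \<xi> \<in> L2 \<mu> \<Longrightarrow>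
      L2_nrm \<mu> (\<lambda>x. T \<xi> x - integral_operator \<mu> (diff_kernel \<kappa>) \<xi> x) \<le> B * L2_nrm \<mu> \<xi>"
proof -
  define r where "r n = 1 / real (Suc n)" for n
  have r_pos: "r n > 0" for n by (simp add: r_def)
  have r_dec: "r m \<le> r n" if "n \<le> m" for m n using that by (simp add: r_def field_simps)
  have r_lim: "r \<longlonglongrightarrow> 0" unfolding r_def by (rule LIMSEQ_Suc[OF lim_1_over_n])
  define G where "G n = {\<gamma> \<in> dual_group. r n \<le> norm (c \<gamma>)}" for n
  have G: "finite (G n)" "G n \<subseteq> dual_group" for n
    using c[OF r_pos] by (auto simp: G_def)
  define q where "q n x = (\<Sum>\<gamma>\<in>G n. (c \<gamma> / of_real total) * \<gamma> x)" for n x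
  have q: "q n \<in> bounded_borel" and hat_q: "\<And>\<delta>. \<delta> \<in> dual_group \<Longrightarrow> hat (q n) \<delta> = (if \<delta> \<in> G n then c \<delta> else 0)"
    and op_q: "\<And>\<xi> y. \<xi> \<in> L2 \<mu> \<Longrightarrow> integral_operator \<mu> (diff_kernel (q n)) \<xi> y
      = (\<Sum>\<gamma>\<in>G n. (c \<gamma> / of_real total * (LINT x|\<mu>. \<gamma> x * \<xi> x)) * cnj (\<gamma> y))" for n
    using character_polynomial[OF G(1)[of n] G(2)[of n], where c = c] unfolding q_def[abs_def] by simp_all
  have hat_close: "norm (c \<gamma> - hat (q n) \<gamma>) \<le> r n" if "\<gamma> \<in> dual_group" for n \<gamma>
    using that r_pos[of n] by (auto simp: hat_q G_def)
  define Tn where "Tn n = integral_operator \<mu> (diff_kernel (q n))" for n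
  have Tn: "Tn n \<in> bounded_operators \<mu>" for n
    unfolding Tn_def by (rule integral_operator_bounded(1)[OF diff_kernel_L2[OF q]])
  have rate: "L2_nrm \<mu> (\<lambda>x. Tn m \<xi> x - Tn n \<xi> x) \<le> r n * L2_nrm \<mu> \<xi>" if nm: "n \<le> m" and \<xi>: "\<xi> \<in> L2 \<mu>" for n m \<xi>
    unfolding Tn_def
  proof (rule diff_kernel_operator_diff_le[OF q q _ _ \<xi>])
    show "norm (hat (q m) \<gamma> - hat (q n) \<gamma>) \<le> r n" if "\<gamma> \<in> dual_group" for \<gamma>
      using that r_dec[OF nm] r_pos[of n] by (auto simp: hat_q G_def)
  qed (use r_pos[of n] in simp)
  obtain T where T: "T \<in> bounded_operators \<mu>"
    and close: "\<And>n \<xi>. \<xi> \<in> L2 \<mu> \<Longrightarrow> L2_nrm \<mu> (\<lambda>x. T \<xi> x - Tn n \<xi> x) \<le> r n * L2_nrm \<mu> \<xi>"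
    using operator_limit[OF finite_measure_axioms Tn rate r_lim] by blast
  note TL2 = bounded_operatorsD(1)[OF T] and TnL2 = bounded_operatorsD(1)[OF Tn]
  have "T \<in> compact_operators \<mu>"
    unfolding compact_operators_def mem_Collect_eq
  proof (intro conjI T allI impI)
    fix \<xi> :: "nat \<Rightarrow> 'a \<Rightarrow> complex"
    assume "\<forall>n. \<xi> n \<in> L2 \<mu> \<and> L2_nrm \<mu> (\<xi> n) \<le> 1"
    then have \<xi>: "\<And>n. \<xi> n \<in> L2 \<mu>" and \<xi>1: "\<And>n. L2_nrm \<mu> (\<xi> n) \<le> 1" by auto
    define b where "b j \<gamma> = (LINT x|\<mu>. \<gamma> x * \<xi> j x)" for j \<gamma>
    have nrm_char: "L2_nrm \<mu> \<gamma> = sqrt total" if "\<gamma> \<in> dual_group" for \<gamma>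
      by (simp add: L2_nrm_def dual_groupD(3)[OF that] total_def)
    have b_le: "norm (b j \<gamma>) \<le> sqrt total" if \<gamma>: "\<gamma> \<in> (\<Union>n. G n)" for j \<gamma>
    proof -
      have \<gamma>': "\<gamma> \<in> dual_group" using \<gamma> G(2) by blast
      have "norm (b j \<gamma>) \<le> L2_nrm \<mu> \<gamma> * L2_nrm \<mu> (\<xi> j)"
        unfolding b_def by (rule L2_Cauchy_Schwarz[OF bounded_borel_L2[OF dual_groupD(9)[OF \<gamma>']] \<xi>])
      also have "\<dots> \<le> sqrt total * 1"
        unfolding nrm_char[OF \<gamma>'] by (rule mult_left_mono[OF \<xi>1]) (use total_pos in simp)
      finally show ?thesis by simp
    qed
    have "countable (\<Union>n. G n)" using G(1) by (intro countable_UN) (auto intro: countable_finite)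
    from function_convergent_subsequence[of "\<Union>n. G n" b, OF this b_le] obtain k where k: "strict_mono (k :: nat \<Rightarrow> nat)"
      and conv: "\<And>\<gamma>. \<gamma> \<in> (\<Union>n. G n) \<Longrightarrow> \<exists>l. (\<lambda>j. b (k j) \<gamma>) \<longlonglongrightarrow> l"
      by metis
    have cauchy: "\<exists>N. \<forall>i\<ge>N. \<forall>j\<ge>N. L2_nrm \<mu> (\<lambda>x. T (\<xi> (k i)) x - T (\<xi> (k j)) x) < e" if e: "e > 0" for e
    proof -
      obtain n where n: "r n < e / 4"
        using order_tendstoD(2)[OF r_lim, of "e / 4"] e by (auto simp: eventually_sequentially)
      define S where "S i j = (\<Sum>\<gamma>\<in>G n. norm (c \<gamma> / of_real total) * norm (b (k i) \<gamma> - b (k j) \<gamma>))" for i j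
      have "\<forall>\<gamma>\<in>G n. \<exists>l. (\<lambda>j. b (k j) \<gamma>) \<longlonglongrightarrow> l" using conv by blast
      from bchoice[OF this] obtain l where l: "\<And>\<gamma>. \<gamma> \<in> G n \<Longrightarrow> (\<lambda>j. b (k j) \<gamma>) \<longlonglongrightarrow> l \<gamma>"
        by blast
      define s where "s j = (\<Sum>\<gamma>\<in>G n. norm (c \<gamma> / of_real total) * norm (b (k j) \<gamma> - l \<gamma>))" for j
      have s0: "s \<longlonglongrightarrow> (\<Sum>\<gamma>\<in>G n. norm (c \<gamma> / of_real total) * norm (l \<gamma> - l \<gamma>))"
        unfolding s_def by (intro tendsto_sum tendsto_mult tendsto_const tendsto_norm tendsto_diff l)
      have S_le: "S i j \<le> s i + s j" for i j
        unfolding S_def s_def sum.distrib[symmetric]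
      proof (rule sum_mono)
        fix \<gamma>
        have "norm (b (k i) \<gamma> - b (k j) \<gamma>) \<le> norm (b (k i) \<gamma> - l \<gamma>) + norm (b (k j) \<gamma> - l \<gamma>)"
          using norm_triangle_ineq4[of "b (k i) \<gamma> - l \<gamma>" "b (k j) \<gamma> - l \<gamma>"] by simp
        from mult_left_mono[OF this norm_ge_zero[of "c \<gamma> / of_real total"]]
        show "norm (c \<gamma> / of_real total) * norm (b (k i) \<gamma> - b (k j) \<gamma>)
          \<le> norm (c \<gamma> / of_real total) * norm (b (k i) \<gamma> - l \<gamma>) + norm (c \<gamma> / of_real total) * norm (b (k j) \<gamma> - l \<gamma>)"
          by (simp only: distrib_left)
      qed
      have pos: "e / (4 * sqrt total) > 0" using e total_pos by simp
      have "eventually (\<lambda>j. s j < e / (4 * sqrt total)) sequentially"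
        using s0 pos by (intro order_tendstoD) auto
      then obtain N where N: "\<And>j. j \<ge> N \<Longrightarrow> s j < e / (4 * sqrt total)" by (auto simp: eventually_sequentially)
      have "L2_nrm \<mu> (\<lambda>x. T (\<xi> (k i)) x - T (\<xi> (k j)) x) < e" if i: "i \<ge> N" and j: "j \<ge> N" for i j
      proof -
        define u where "u = \<xi> (k i)"
        define v where "v = \<xi> (k j)"
        have u: "u \<in> L2 \<mu>" "L2_nrm \<mu> u \<le> 1" and v: "v \<in> L2 \<mu>" "L2_nrm \<mu> v \<le> 1" by (auto simp: u_def v_def \<xi> \<xi>1)
        have "norm (Tn n u x - Tn n v x) \<le> S i j" for x
        proof -
          have "Tn n u x - Tn n v x = (\<Sum>\<gamma>\<in>G n. (c \<gamma> / of_real total * (b (k i) \<gamma> - b (k j) \<gamma>)) * cnj (\<gamma> x))"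
            unfolding Tn_def op_q[OF u(1)] op_q[OF v(1)] sum_subtractf[symmetric]
            by (intro sum.cong refl) (simp add: b_def u_def v_def algebra_simps diff_divide_distrib)
          also have "norm \<dots> \<le> S i j"
            unfolding S_def
          proof (rule sum_norm_le)
            fix \<gamma> assume "\<gamma> \<in> G n"
            then have unimodular: "norm (\<gamma> x) = 1" using G(2) by (intro dual_groupD(3)) auto
            show "norm ((c \<gamma> / of_real total * (b (k i) \<gamma> - b (k j) \<gamma>)) * cnj (\<gamma> x))
                \<le> norm (c \<gamma> / of_real total) * norm (b (k i) \<gamma> - b (k j) \<gamma>)"
              by (simp only: norm_mult complex_mod_cnj unimodular mult_1_right order_refl)
          qed
          finally show ?thesis .
        qed
        then have "L2_nrm \<mu> (\<lambda>x. Tn n u x - Tn n v x) \<le> S i j * sqrt total"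
          using L2_bounded(2)[OF finite_measure_axioms L2_measurable[OF L2_diff[OF TnL2[OF u(1)] TnL2[OF v(1)]]]]
          by (simp add: total_def)
        also have "S i j * sqrt total < e / 2"
        proof -
          have "S i j < e / (4 * sqrt total) + e / (4 * sqrt total)" using S_le[of i j] N[OF i] N[OF j] by linarith
          then have "S i j * sqrt total < (e / (4 * sqrt total) + e / (4 * sqrt total)) * sqrt total"
            using total_pos by (intro mult_strict_right_mono) auto
          also have "\<dots> = e / 2" using total_pos by (simp add: field_simps)
          finally show ?thesis .
        qed
        finally have mid: "L2_nrm \<mu> (\<lambda>x. Tn n u x - Tn n v x) < e / 2" .
        have "L2_nrm \<mu> (\<lambda>x. T u x - T v x) \<le> L2_nrm \<mu> (\<lambda>x. T u x - Tn n u x) + L2_nrm \<mu> (\<lambda>x. Tn n u x - T v x)"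
          by (rule L2_triangle_diff[OF TL2[OF u(1)] TnL2[OF u(1)] TL2[OF v(1)]])
        also have "L2_nrm \<mu> (\<lambda>x. Tn n u x - T v x) \<le> L2_nrm \<mu> (\<lambda>x. Tn n u x - Tn n v x) + L2_nrm \<mu> (\<lambda>x. Tn n v x - T v x)"
          by (rule L2_triangle_diff[OF TnL2[OF u(1)] TnL2[OF v(1)] TL2[OF v(1)]])
        also have "L2_nrm \<mu> (\<lambda>x. Tn n v x - T v x) \<le> r n * 1"
          using close[OF v(1), of n] mult_left_mono[OF v(2) less_imp_le[OF r_pos[of n]]]
            L2_nrm_diff_commute[of \<mu> "Tn n v" "T v"] by linarith
        also have "L2_nrm \<mu> (\<lambda>x. T u x - Tn n u x) \<le> r n * 1"
          using close[OF u(1), of n] mult_left_mono[OF u(2) less_imp_le[OF r_pos[of n]]] by linarith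
        finally show ?thesis using mid n by (simp add: u_def v_def)
      qed
      then show ?thesis by blast
    qed
    obtain \<eta> where "\<eta> \<in> L2 \<mu>" "(\<lambda>j. L2_nrm \<mu> (\<lambda>x. T (\<xi> (k j)) x - \<eta> x)) \<longlonglongrightarrow> 0"
      using L2_complete[OF finite_measure_axioms TL2[OF \<xi>] cauchy] by blast
    then show "\<exists>\<eta>\<in>L2 \<mu>. \<exists>k. strict_mono k \<and> (\<lambda>j. L2_nrm \<mu> (\<lambda>x. T (\<xi> (k j)) x - \<eta> x)) \<longlonglongrightarrow> 0"
      using k by blast
  qed
  moreover have "L2_nrm \<mu> (\<lambda>x. T \<xi> x - integral_operator \<mu> (diff_kernel \<kappa>) \<xi> x) \<le> B * L2_nrm \<mu> \<xi>"
    if \<kappa>: "\<kappa> \<in> bounded_borel" and le: "\<And>\<gamma>. \<gamma> \<in> dual_group \<Longrightarrow> norm (c \<gamma> - hat \<kappa> \<gamma>) \<le> B" and \<xi>: "\<xi> \<in> L2 \<mu>" for \<kappa> B \<xi>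
  proof -
    have B: "B \<ge> 0" using le[OF dual_group_one] norm_ge_zero order_trans by blast
    note op = bounded_operatorsD(1)[OF integral_operator_bounded(1)[OF diff_kernel_L2[OF \<kappa>]] \<xi>]
    have bound: "L2_nrm \<mu> (\<lambda>x. T \<xi> x - integral_operator \<mu> (diff_kernel \<kappa>) \<xi> x) \<le> B * L2_nrm \<mu> \<xi> + r n * (2 * L2_nrm \<mu> \<xi>)" for n
    proof -
      have "norm (hat (q n) \<gamma> - hat \<kappa> \<gamma>) \<le> r n + B" if "\<gamma> \<in> dual_group" for \<gamma>
        using le[OF that] hat_close[OF that, of n] norm_triangle_ineq4[of "c \<gamma> - hat \<kappa> \<gamma>" "c \<gamma> - hat (q n) \<gamma>"] by simp
      then have "L2_nrm \<mu> (\<lambda>x. Tn n \<xi> x - integral_operator \<mu> (diff_kernel \<kappa>) \<xi> x) \<le> (r n + B) * L2_nrm \<mu> \<xi>"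
        unfolding Tn_def using r_pos[of n] B by (intro diff_kernel_operator_diff_le q \<kappa> \<xi>) auto
      then show ?thesis
        using L2_triangle_diff[OF TL2[OF \<xi>] TnL2[OF \<xi>, of n] op] close[OF \<xi>, of n] by (simp add: algebra_simps)
    qed
    have "(\<lambda>n. B * L2_nrm \<mu> \<xi> + r n * (2 * L2_nrm \<mu> \<xi>)) \<longlonglongrightarrow> B * L2_nrm \<mu> \<xi> + 0 * (2 * L2_nrm \<mu> \<xi>)"
      by (intro tendsto_add tendsto_mult tendsto_const r_lim)
    then have "L2_nrm \<mu> (\<lambda>x. T \<xi> x - integral_operator \<mu> (diff_kernel \<kappa>) \<xi> x) \<le> B * L2_nrm \<mu> \<xi> + 0 * (2 * L2_nrm \<mu> \<xi>)"
      by (rule LIMSEQ_le_const) (use bound in blast)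
    then show ?thesis by simp
  qed
  ultimately show ?thesis by (rule that)
qed

lemma zero_operator_compact: "(\<lambda>\<xi> x. 0) \<in> compact_operators \<mu>"
  unfolding compact_operators_def bounded_operators_def mem_Collect_eq
proof (intro conjI ballI allI impI)
  show "\<exists>C. \<forall>\<xi>\<in>L2 \<mu>. L2_nrm \<mu> (\<lambda>x. 0) \<le> C * L2_nrm \<mu> \<xi>" by (intro exI[of _ 0]) simp
  show "\<exists>\<eta>\<in>L2 \<mu>. \<exists>r :: nat \<Rightarrow> nat. strict_mono r \<and> (\<lambda>n. L2_nrm \<mu> (\<lambda>x. 0 - \<eta> x)) \<longlonglongrightarrow> 0"
    by (intro bexI[of _ "\<lambda>x. 0"] exI[of _ id]) (auto simp: L2_zero strict_mono_def)
qed (auto simp: L2_zero)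

text \<open>
  For a pseudofunction \<open>F \<noteq> 0\<close> in \<open>N_set\<close> let \<open>T\<close> be the compact operator with symbol \<open>pm_transform F\<close>.  Then \<open>(0, T)\<close> and
  \<open>(0, 0)\<close> both belong to the closed graph, although \<open>T \<noteq> 0\<close>.  Both the graph and \<open>J_ideal\<close> see \<open>f\<close>
  only modulo null sets, so a Borel representative \<open>f'\<close> can take its place where the symbol is truncated.
\<close>
theorem not_closable_if_M1_set:
  assumes \<phi>: "\<And>s t. \<phi> (s, t) = f (s - t)" and M1: "M1_set (E_set \<mu> f)"
    and f': "f' \<in> borel_measurable borel" "AE s in \<mu>. f s = f' s"
  shows "\<not> closable_multiplier \<mu> \<phi>"
proof
  assume closable: "closable_multiplier \<mu> \<phi>"
  obtain F where F: "F \<in> N_set (E_set \<mu> f)" "F \<in> pseudofunctions" "F \<noteq> zero_pm"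
    using M1 by (auto simp: M1_set_def)
  have Fp: "F \<in> pseudomeasures" using F(2) by (simp add: pseudofunctions_def)
  have "(AE s in \<mu>. f s * h s = g s) \<longleftrightarrow> (AE s in \<mu>. f' s * h s = g s)" for h g
  proof
    show "AE s in \<mu>. f' s * h s = g s" if "AE s in \<mu>. f s * h s = g s"
      using that f'(2) by eventually_elim simp
    show "AE s in \<mu>. f s * h s = g s" if "AE s in \<mu>. f' s * h s = g s"
      using that f'(2) by eventually_elim simp
  qed
  then have J_eq: "J_ideal \<mu> f = J_ideal \<mu> f'" by (simp add: J_ideal_def)
  have J: "F v = 0" if "v \<in> J_ideal \<mu> f'" for v
    using N_set_annihilates_J_ideal[OF F(1)] that J_eq by simp
  define c where "c = pm_transform F"
  have c: "finite {\<gamma> \<in> dual_group. \<epsilon> \<le> norm (c \<gamma>)}" if "\<epsilon> > 0" for \<epsilon>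
    using F(2) that by (simp add: pseudofunctions_def c_def)
  \<comment> \<open>a pseudomeasure is determined by its coefficients\<close>
  obtain \<gamma>0 where \<gamma>0: "\<gamma>0 \<in> dual_group" "c \<gamma>0 \<noteq> 0"
  proof (rule ccontr)
    assume no: "\<not> thesis"
    note conclude = that
    have "F u = 0" if u: "u \<in> fourier_algebra" for u
    proof -
      have "((\<lambda>\<gamma>. coef u \<gamma> * pm_transform F \<gamma>) has_sum F (fourier_transform (coef u))) dual_group"
        by (rule pseudomeasure_expansion[OF Fp fourier_algebraD(1)[OF u]])
      moreover have "((\<lambda>\<gamma>. coef u \<gamma> * pm_transform F \<gamma>) has_sum 0) dual_group"
        by (rule has_sum_0) (use no conclude in \<open>auto simp: c_def\<close>)
      ultimately have "F (fourier_transform (coef u)) = 0" by (rule has_sum_unique)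
      then show ?thesis by (simp only: fourier_algebraD(2)[OF u, symmetric])
    qed
    moreover have "F \<in> extensional fourier_algebra" using Fp by (simp add: pseudomeasures_def)
    ultimately have "F = zero_pm" by (intro extensionalityI[of F fourier_algebra]) (auto simp: zero_pm_def)
    then show False using F(3) by simp
  qed
  obtain T where T: "T \<in> compact_operators \<mu>"
    and T_close: "\<And>\<kappa> B \<xi>. \<kappa> \<in> bounded_borel \<Longrightarrow> (\<And>\<gamma>. \<gamma> \<in> dual_group \<Longrightarrow> norm (c \<gamma> - hat \<kappa> \<gamma>) \<le> B) \<Longrightarrow> \<xi> \<in> L2 \<mu> \<Longrightarrow>
      L2_nrm \<mu> (\<lambda>x. T \<xi> x - integral_operator \<mu> (diff_kernel \<kappa>) \<xi> x) \<le> B * L2_nrm \<mu> \<xi>"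
    using character_multiplier_compact[OF c] by blast
  define Z :: "('a \<Rightarrow> complex) \<Rightarrow> ('a \<Rightarrow> complex)" where "Z = (\<lambda>\<xi> x. 0)"
  have Z: "Z \<in> compact_operators \<mu>" unfolding Z_def by (rule zero_operator_compact)
  have graph: "(integral_operator \<mu> (diff_kernel \<kappa>), integral_operator \<mu> (diff_kernel w)) \<in> multiplier_graph \<mu> \<phi>"
    if \<kappa>: "\<kappa> \<in> bounded_borel" and w: "w \<in> bounded_borel" and ae: "AE s in \<mu>. w s = f' s * \<kappa> s" for \<kappa> w
  proof -
    have "AE s in \<mu>. w s = f s * \<kappa> s" using ae f'(2) by eventually_elim simp
    moreover have "\<phi> z = f (fst z - snd z)" for z using \<phi>[of "fst z" "snd z"] by simp
    ultimately have "AE z in \<mu> \<Otimes>\<^sub>M \<mu>. diff_kernel w z = \<phi> z * diff_kernel \<kappa> z"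
      using AE_square_diff[of "\<lambda>s. w s = f s * \<kappa> s"] by (simp add: diff_kernel_def)
    then show ?thesis using diff_kernel_L2[OF \<kappa>] diff_kernel_L2[OF w] by (auto simp: multiplier_graph_def)
  qed
  have "(Z, T) \<in> graph_closure \<mu> (multiplier_graph \<mu> \<phi>)"
  proof -
    have "\<exists>(A, B)\<in>multiplier_graph \<mu> \<phi>. op_dist \<mu> Z A < \<epsilon> \<and> op_dist \<mu> T B < \<epsilon>" if \<epsilon>: "\<epsilon> > 0" for \<epsilon>
    proof -
      obtain \<kappa> w where \<kappa>: "\<kappa> \<in> bounded_borel" and w: "w \<in> bounded_borel" and ae: "AE s in \<mu>. w s = f' s * \<kappa> s"
        and \<kappa>_small: "\<And>\<gamma>. \<gamma> \<in> dual_group \<Longrightarrow> norm (hat \<kappa> \<gamma>) \<le> \<epsilon> / 2"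
        and w_close: "\<And>\<gamma>. \<gamma> \<in> dual_group \<Longrightarrow> norm (pm_transform F \<gamma> - hat w \<gamma>) \<le> \<epsilon> / 2"
        using kernel_approximation[OF F(2) J f'(1) half_gt_zero[OF \<epsilon>]] by blast
      have "op_dist \<mu> Z (integral_operator \<mu> (diff_kernel \<kappa>)) \<le> \<epsilon> / 2"
      proof (rule op_dist_le)
        fix \<xi> assume \<xi>: "\<xi> \<in> L2 \<mu>"
        show "L2_nrm \<mu> (\<lambda>x. Z \<xi> x - integral_operator \<mu> (diff_kernel \<kappa>) \<xi> x) \<le> \<epsilon> / 2 * L2_nrm \<mu> \<xi>"
          using diff_kernel_operator_le[OF \<kappa> _ \<kappa>_small \<xi>] \<epsilon>
            L2_nrm_diff_commute[of \<mu> "Z \<xi>" "integral_operator \<mu> (diff_kernel \<kappa>) \<xi>"] by (simp add: Z_def)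
      qed (use \<epsilon> in simp)
      moreover have "op_dist \<mu> T (integral_operator \<mu> (diff_kernel w)) \<le> \<epsilon> / 2"
        by (rule op_dist_le[OF T_close[OF w]]) (use w_close \<epsilon> in \<open>auto simp: c_def\<close>)
      ultimately show ?thesis using graph[OF \<kappa> w ae] \<epsilon> by (intro bexI[of _ "(_, _)"]) auto
    qed
    then show ?thesis using Z T by (simp add: graph_closure_def)
  qed
  moreover have "(Z, Z) \<in> graph_closure \<mu> (multiplier_graph \<mu> \<phi>)"
  proof -
    have k0: "(\<lambda>_. 0) \<in> bounded_borel" by (rule bounded_borel_const)
    have "(integral_operator \<mu> (diff_kernel (\<lambda>_. 0)), integral_operator \<mu> (diff_kernel (\<lambda>_. 0))) \<in> multiplier_graph \<mu> \<phi>"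
      by (rule graph[OF k0 k0]) simp
    moreover have "integral_operator \<mu> (diff_kernel (\<lambda>_. 0)) = Z"
      by (simp add: integral_operator_def diff_kernel_def Z_def fun_eq_iff)
    ultimately have "(Z, Z) \<in> multiplier_graph \<mu> \<phi>" by simp
    moreover have "op_dist \<mu> Z Z \<le> 0" by (rule op_dist_le) (auto simp: Z_def)
    ultimately show ?thesis using Z by (force simp: graph_closure_def)
  qed
  moreover have "op_eq \<mu> Z Z" by (simp add: op_eq_def)
  ultimately have "op_eq \<mu> T Z" using closable unfolding closable_multiplier_def by blast
  \<comment> \<open>but \<open>T\<close> multiplies the character \<open>cnj \<circ> \<gamma>0\<close> by \<open>c \<gamma>0 \<noteq> 0\<close>\<close>
  define \<xi> where "\<xi> = (\<lambda>x. cnj (\<gamma>0 x))"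
  have \<xi>: "\<xi> \<in> L2 \<mu>" unfolding \<xi>_def by (rule bounded_borel_L2[OF bounded_borel_cnj[OF dual_groupD(9)[OF \<gamma>0(1)]]])
  have \<xi>_pos: "L2_nrm \<mu> \<xi> > 0"
    using total_pos by (simp add: \<xi>_def L2_nrm_def dual_groupD(3)[OF \<gamma>0(1)] total_def)
  \<comment> \<open>\<open>T\<close> is compared with a kernel operator, for which the action on the character can be computed; the two
    errors add up to at most half of \<open>|c \<gamma>0|\<close>\<close>
  define \<epsilon> where "\<epsilon> = norm (c \<gamma>0) / 4"
  have \<epsilon>: "\<epsilon> > 0" using \<gamma>0 by (simp add: \<epsilon>_def)
  obtain \<kappa> w where "\<kappa> \<in> bounded_borel" and w: "w \<in> bounded_borel" and "AE s in \<mu>. w s = f' s * \<kappa> s"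
    and "\<And>\<gamma>. \<gamma> \<in> dual_group \<Longrightarrow> norm (hat \<kappa> \<gamma>) \<le> \<epsilon>"
    and w_close: "\<And>\<gamma>. \<gamma> \<in> dual_group \<Longrightarrow> norm (pm_transform F \<gamma> - hat w \<gamma>) \<le> \<epsilon>"
    using kernel_approximation[OF F(2) J f'(1) \<epsilon>] by blast
  have op: "integral_operator \<mu> (diff_kernel w) \<xi> = (\<lambda>y. hat w \<gamma>0 * \<xi> y)"
    unfolding \<xi>_def by (rule ext, rule diff_kernel_operator_character[OF w \<gamma>0(1)])
  have "AE x in \<mu>. T \<xi> x = 0" using \<open>op_eq \<mu> T Z\<close> \<xi> by (simp add: op_eq_def Z_def)
  then have ae: "AE x in \<mu>. T \<xi> x - integral_operator \<mu> (diff_kernel w) \<xi> x = (- hat w \<gamma>0) * \<xi> x"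
    by eventually_elim (simp add: op)
  have TL2: "T \<xi> \<in> L2 \<mu>" using T \<xi> by (auto simp: compact_operators_def bounded_operators_def)
  have d: "(\<lambda>x. T \<xi> x - integral_operator \<mu> (diff_kernel w) \<xi> x) \<in> L2 \<mu>"
    unfolding op by (intro L2_diff TL2 L2_scale \<xi>)
  have "norm (hat w \<gamma>0) * L2_nrm \<mu> \<xi> = L2_nrm \<mu> (\<lambda>x. (- hat w \<gamma>0) * \<xi> x)"
    by (simp only: L2_nrm_scale norm_minus_cancel)
  also have "\<dots> = L2_nrm \<mu> (\<lambda>x. T \<xi> x - integral_operator \<mu> (diff_kernel w) \<xi> x)"
    by (rule L2_nrm_cong(2)[OF d L2_measurable[OF L2_scale[OF \<xi>]] ae])
  also have "\<dots> \<le> \<epsilon> * L2_nrm \<mu> \<xi>"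
    by (rule T_close[OF w _ \<xi>]) (use w_close in \<open>simp add: c_def\<close>)
  finally have "norm (hat w \<gamma>0) \<le> \<epsilon>" using \<xi>_pos by simp
  moreover have "norm (c \<gamma>0) \<le> norm (hat w \<gamma>0) + \<epsilon>"
    using w_close[OF \<gamma>0(1)] norm_triangle_sub[of "c \<gamma>0" "hat w \<gamma>0"] by (simp add: c_def)
  ultimately show False using \<epsilon> unfolding \<epsilon>_def by linarith
qed

end

lemma completion_borel_representative:
  fixes f :: "'a::topological_space \<Rightarrow> complex"
  assumes "f \<in> borel_measurable (completion M)"
  obtains f' where "f' \<in> borel_measurable M" "AE x in M. f x = f' x"
proof -
  have "(\<lambda>x. Re (f x)) \<in> borel_measurable (completion M)" "(\<lambda>x. Im (f x)) \<in> borel_measurable (completion M)"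
    using assms by (auto intro: measurable_compose[OF _ borel_measurable_continuous_onI] continuous_intros)
  then obtain u v where uv: "u \<in> borel_measurable M" "v \<in> borel_measurable M"
    and ae: "AE x in M. Re (f x) = u x" "AE x in M. Im (f x) = v x"
    using completion_ex_borel_measurable_real by metis
  from ae have "AE x in M. f x = Complex (u x) (v x)" by eventually_elim (simp add: complex_eq_iff)
  moreover have "(\<lambda>x. Complex (u x) (v x)) \<in> borel_measurable M"
    using uv unfolding Complex_eq by measurable
  ultimately show ?thesis by (rule that[rotated])
qed

theorem proposition7p14:
  fixes \<mu> :: "'a::{topological_ab_group_add, t2_space, second_countable_topology} measure"
    and f :: "'a \<Rightarrow> complex"
    and \<phi> :: "'a \<times> 'a \<Rightarrow> complex"
  assumes "compact (UNIV :: 'a set)"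
    and "haar_measure \<mu>"
    and "f \<in> borel_measurable (completion \<mu>)"
    and "\<And>s t. \<phi> (s, t) = f (s - t)"
  shows "(\<not> M_set (E_set \<mu> f) \<longrightarrow> closable_multiplier \<mu> \<phi>) \<and>
         (M1_set (E_set \<mu> f) \<longrightarrow> \<not> closable_multiplier \<mu> \<phi>)"
proof -
  interpret compact_haar \<mu> using assms(1,2) by unfold_locales
  obtain f' where f': "f' \<in> borel_measurable \<mu>" "AE s in \<mu>. f s = f' s"
    by (rule completion_borel_representative[OF assms(3)])
  have f'_borel: "f' \<in> borel_measurable borel" using f'(1) by simp
  show ?thesis
    using closable_if_not_M_set[of \<phi> f, OF assms(4)]
      not_closable_if_M1_set[of \<phi> f f', OF assms(4) _ f'_borel f'(2)] by blast
qed

end
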